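(* Let $p,q\in[1,\infty]$, $x_0\in\mathbb{R}^d$, let $\sigma=(\sigma_j)_j$ be an admissible sequence, and let a compactly supported wavelet basis of regularity $R>\overline{s}(\sigma)$ be given. If $f\in L^p_{\mathrm{loc}}(\mathbb{R}^d)$ belongs to the space $T^{\sigma}_{p,q}(x_0)$, then \[ (\sigma_j\, d^p_j(x_0))_j\in \ell^q , \] where $d^p_j(x_0)$ are the $p$-wavelet leaders of $f$ at $x_0$.
   Context: $\mathbb{N}_0=\{0,1,2,\dots\}$. If $p=\infty$, then $d/p=0$ and $\ell^p$-type sums are replaced by suprema. Admissible sequences. A sequence $\sigma=(\sigma_j)_{j\in\mathbb{N}_0}$ of positive reals is admissible if there is $C>0$ with $C^{-1}\sigma_j\le\sigma_{j+1}\le C\sigma_j$ for all $j$. Put $\underline{\sigma}_j=\inf_{k\in\mathbb{N}_0}\sigma_{j+k}/\sigma_k$, $\overline{\sigma}_j=\sup_{k\in\mathbb{N}_0}\sigma_{j+k}/\sigma_k$; the lower and upper Boyd indices are $\underline{s}(\sigma)=\lim_j \frac{\log_2\underline{\sigma}_j}{j}$ and $\overline{s}(\sigma)=\lim_j\frac{\log_2\overline{\sigma}_j}{j}$. The space $T^{\sigma}_{p,q}(x_0)$. Let $m=\lfloor\overline{s}(\sigma)\rfloor+1$, let $\Delta_h^1f(x)=f(x+h)-f(x)$, $\Delta_h^{k+1}f=\Delta_h^1\Delta_h^kf$, and let $B(x_0,r)$ be the open ball. Set $B_h(x_0,r)=\{x:[x,x+mh]\subset B(x_0,r)\}$. If $m\le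 0$, one puts $\Delta_h^mf=f$ and $B_h(x_0,r)=B(x_0,r)$. Then $f\in L^p_{\mathrm{loc}}(\mathbb{R}^d)$ belongs to $T^{\sigma}_{p,q}(x_0)$ if $(\sigma_j2^{jd/p}\sup_{|h|\le2^{-j}}\|\Delta_h^{m}f\|_{L^p(B_h(x_0,2^{-j}))})_{j\in\mathbb{N}_0}\in\ell^q$. Wavelets. $\varphi$ and $\psi^{(i)}$ ($1\le i<2^d$) are functions such that $\{\varphi(x-k):k\in\mathbb{Z}^d\}\cup\{\psi^{(i)}(2^jx-k):1\le i<2^d,k\in\mathbb{Z}^d,j\in\mathbb{N}_0\}$ is an orthogonal basis of $L^2(\mathbb{R}^d)$. The basis is compactly supported of regularity $R\in\mathbb{N}_0$ if $\varphi,\psi^{(i)}$ are compactly supported, of class $C^R$, with $\int x^\alpha\psi^{(i)}(x)\,dx=0$ for $|\alpha|\le R$. The wavelet coefficients of $f$ are $c^{(i)}_{j,k}=2^{dj}\int f(x)\psi^{(i)}(2^jx-k)\,dx$. Leaders. Identify $i\in\{1,\dots,2^d-1\}$ with an element of $\{0,1\}^d\setminus\{0\}$ and set $\lambda^{(i)}_{j,k}=\frac{i}{2^{j+1}}+\frac{k}{2^j}+[0,\frac1{2^{j+1}})^d$. For a dyadic cube $\lambda$ of side length $2^{-j}$ put \[d^p_\lambda=\sup_{j'\ge j}\Big(\sum_{(i,k'):\ \lambda^{(i)}_{j',k'}\subset\lambda}(2^{(j-j')d/p}|c^{(i)}_{j',k'}|)^p\Big)^{1/p}.\] $\lambda_j(x_0)$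 is the dyadic cube of side $2^{-j}$ containing $x_0$, $3\lambda_j(x_0)$ is the set of the $3^d$ dyadic cubes of side $2^{-j}$ at distance $0$ from it (itself included), and $d^p_j(x_0)=\sup_{\lambda\in3\lambda_j(x_0)}d^p_\lambda$. *)

theory Defs
  imports "HOL-Analysis.Analysis" "HOL-Probability.Essential_Supremum"
begin

(* Exponents p, q in [1, oo] are extended nonnegative reals; inverse \<infinity> = 0, so d/p is
   rendered as real CARD('d) * enn2real (inverse p) for every such p.
   Functions on R^d are complex-valued (this includes the real-valued ones). *)

(* Only used for exponents a > 0, where \<infinity> ^ a = \<infinity>. *)
definition epow :: "ennreal \<Rightarrow> real \<Rightarrow> ennreal" where
  "epow x a = (if x = \<infinity> then \<infinity> else ennreal (enn2real x powr a))"

(* L^p norm of a nonnegative function. Over count_space A it is the l^p norm of a family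
   indexed by A: a sum for finite p, the supremum for p = \<infinity>. *)
definition Lp_enorm :: "'a measure \<Rightarrow> ennreal \<Rightarrow> ('a \<Rightarrow> ennreal) \<Rightarrow> ennreal" where
  "Lp_enorm M p g =
     (if p = \<infinity> then esssup M g
      else epow (\<integral>\<^sup>+ x. epow (g x) (enn2real p) \<partial>M) (enn2real (inverse p)))"

definition Lp_norm :: "'a measure \<Rightarrow> ennreal \<Rightarrow> ('a \<Rightarrow> complex) \<Rightarrow> ennreal" where
  "Lp_norm M p f = Lp_enorm M p (\<lambda>x. ennreal (norm (f x)))"

definition in_ell :: "ennreal \<Rightarrow> (nat \<Rightarrow> ennreal) \<Rightarrow> bool" where
  "in_ell q a \<longleftrightarrow> Lp_enorm (count_space UNIV) q a < \<infinity>"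

definition Lp_loc :: "ennreal \<Rightarrow> (real^'d \<Rightarrow> complex) set" where
  "Lp_loc p = {f \<in> borel_measurable lebesgue. \<forall>K. compact K \<longrightarrow> Lp_norm (lebesgue_on K) p f < \<infinity>}"

definition admissible :: "(nat \<Rightarrow> real) \<Rightarrow> bool" where
  "admissible \<sigma> \<longleftrightarrow> (\<forall>j. \<sigma> j > 0) \<and>
     (\<exists>C>0. \<forall>j. inverse C * \<sigma> j \<le> \<sigma> (Suc j) \<and> \<sigma> (Suc j) \<le> C * \<sigma> j)"

definition upper_seq :: "(nat \<Rightarrow> real) \<Rightarrow> nat \<Rightarrow> real" where
  "upper_seq \<sigma> j = (SUP k. \<sigma> (j + k) / \<sigma> k)"

definition upper_boyd :: "(nat \<Rightarrow> real) \<Rightarrow> real" where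
  "upper_boyd \<sigma> = lim (\<lambda>j. log 2 (upper_seq \<sigma> j) / real j)"

definition fdiff :: "nat \<Rightarrow> real^'d \<Rightarrow> (real^'d \<Rightarrow> complex) \<Rightarrow> real^'d \<Rightarrow> complex" where
  "fdiff m h = (\<lambda>g x. g (x + h) - g x) ^^ m"

definition ball_shift :: "nat \<Rightarrow> real^'d \<Rightarrow> real^'d \<Rightarrow> real \<Rightarrow> (real^'d) set" where
  "ball_shift m h x0 r = {x. closed_segment x (x + real m *\<^sub>R h) \<subseteq> ball x0 r}"

(* The truncation nat realises the convention for floor (upper_boyd \<sigma>) + 1 \<le> 0: for order 0,
   fdiff 0 h f = f and ball_shift 0 h x0 r = ball x0 r. *)
definition diff_order :: "(nat \<Rightarrow> real) \<Rightarrow> nat" where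
  "diff_order \<sigma> = nat (\<lfloor>upper_boyd \<sigma>\<rfloor> + 1)"

definition T_space :: "(nat \<Rightarrow> real) \<Rightarrow> ennreal \<Rightarrow> ennreal \<Rightarrow> real^'d \<Rightarrow> (real^'d \<Rightarrow> complex) set" where
  "T_space \<sigma> p q x0 = {f \<in> Lp_loc p.
     in_ell q (\<lambda>j.
       ennreal (\<sigma> j * 2 powr (real j * (real CARD('d) * enn2real (inverse p)))) *
       (SUP h\<in>{h. norm h \<le> 1 / 2 ^ j}.
          Lp_norm (lebesgue_on (ball_shift (diff_order \<sigma>) h x0 (1 / 2 ^ j))) p
            (fdiff (diff_order \<sigma>) h f)))}"

definition L2_inner :: "(real^'d \<Rightarrow> complex) \<Rightarrow> (real^'d \<Rightarrow> complex) \<Rightarrow> complex" where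
  "L2_inner u v = (LINT x|lebesgue. u x * cnj (v x))"

definition L2 :: "(real^'d \<Rightarrow> complex) set" where
  "L2 = {g \<in> borel_measurable lebesgue. Lp_norm lebesgue 2 g < \<infinity>}"

definition orthogonal_basis_L2 :: "(real^'d \<Rightarrow> complex) set \<Rightarrow> bool" where
  "orthogonal_basis_L2 S \<longleftrightarrow>
     S \<subseteq> L2 \<and>
     (\<forall>u\<in>S. \<not> (AE x in lebesgue. u x = 0)) \<and>
     pairwise (\<lambda>u v. L2_inner u v = 0) S \<and>
     (\<forall>g\<in>L2. \<forall>\<epsilon>>0. \<exists>F c. finite F \<and> F \<subseteq> S \<and>
        Lp_norm lebesgue 2 (\<lambda>x. g x - (\<Sum>u\<in>F. c u * u x)) < ennreal \<epsilon>)"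

definition ivec :: "int^'d \<Rightarrow> real^'d" where
  "ivec k = (\<chi> n. of_int (k $ n))"

(* The 2^d - 1 wavelets are indexed directly by the nonzero elements of {0,1}^d. *)
definition wtypes :: "(int^'d) set" where
  "wtypes = {i. (\<forall>n. i $ n \<in> {0, 1}) \<and> i \<noteq> 0}"

definition wavelet_system ::
    "(real^'d \<Rightarrow> complex) \<Rightarrow> (int^'d \<Rightarrow> real^'d \<Rightarrow> complex) \<Rightarrow> (real^'d \<Rightarrow> complex) set" where
  "wavelet_system \<phi> \<psi> =
     {(\<lambda>x. \<phi> (x - ivec k)) |k. True} \<union>
     {(\<lambda>x. \<psi> i (2 ^ j *\<^sub>R x - ivec k)) |i j k. i \<in> wtypes}"

fun C_class :: "nat \<Rightarrow> (real^'d \<Rightarrow> complex) \<Rightarrow> bool" where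
  "C_class 0 f \<longleftrightarrow> continuous_on UNIV f"
| "C_class (Suc n) f \<longleftrightarrow> (\<forall>x. f differentiable (at x)) \<and>
     (\<forall>v. C_class n (\<lambda>x. frechet_derivative f (at x) v))"

definition compactly_supported :: "(real^'d \<Rightarrow> complex) \<Rightarrow> bool" where
  "compactly_supported f \<longleftrightarrow> compact (closure {x. f x \<noteq> 0})"

definition wavelet_basis ::
    "nat \<Rightarrow> (real^'d \<Rightarrow> complex) \<Rightarrow> (int^'d \<Rightarrow> real^'d \<Rightarrow> complex) \<Rightarrow> bool" where
  "wavelet_basis R \<phi> \<psi> \<longleftrightarrow>
     orthogonal_basis_L2 (wavelet_system \<phi> \<psi>) \<and>
     compactly_supported \<phi> \<and> C_class R \<phi> \<and>
     (\<forall>i\<in>wtypes. compactly_supported (\<psi> i) \<and> C_class R (\<psi> i) \<and>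
        (\<forall>\<alpha> :: 'd \<Rightarrow> nat. (\<Sum>n\<in>UNIV. \<alpha> n) \<le> R \<longrightarrow>
           (LINT x|lebesgue. complex_of_real (\<Prod>n\<in>UNIV. (x $ n) ^ \<alpha> n) * \<psi> i x) = 0))"

definition wcoeff ::
    "(int^'d \<Rightarrow> real^'d \<Rightarrow> complex) \<Rightarrow> (real^'d \<Rightarrow> complex) \<Rightarrow> int^'d \<Rightarrow> nat \<Rightarrow> int^'d \<Rightarrow> complex" where
  "wcoeff \<psi> f i j k = 2 ^ (CARD('d) * j) * (LINT x|lebesgue. f x * \<psi> i (2 ^ j *\<^sub>R x - ivec k))"

definition cube :: "real^'d \<Rightarrow> real \<Rightarrow> (real^'d) set" where
  "cube a s = {x. \<forall>n. a $ n \<le> x $ n \<and> x $ n < a $ n + s}"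

definition wcube :: "int^'d \<Rightarrow> nat \<Rightarrow> int^'d \<Rightarrow> (real^'d) set" where
  "wcube i j k = cube ((1 / 2 ^ (j + 1)) *\<^sub>R ivec i + (1 / 2 ^ j) *\<^sub>R ivec k) (1 / 2 ^ (j + 1))"

definition dyadic_cubes :: "nat \<Rightarrow> (real^'d) set set" where
  "dyadic_cubes j = {cube ((1 / 2 ^ j) *\<^sub>R ivec k) (1 / 2 ^ j) |k. True}"

(* j is the generation of the cube, i.e. cub \<in> dyadic_cubes j. *)
definition cube_leader ::
    "ennreal \<Rightarrow> (int^'d \<Rightarrow> real^'d \<Rightarrow> complex) \<Rightarrow> (real^'d \<Rightarrow> complex) \<Rightarrow> nat \<Rightarrow> (real^'d) set \<Rightarrow> ennreal" where
  "cube_leader p \<psi> f j cub =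
     (SUP j'\<in>{j..}. Lp_enorm (count_space {(i, k). i \<in> wtypes \<and> wcube i j' k \<subseteq> cub}) p
        (\<lambda>(i, k). ennreal (2 powr ((real j - real j') * (real CARD('d) * enn2real (inverse p)))
                     * norm (wcoeff \<psi> f i j' k))))"

definition cube_at :: "nat \<Rightarrow> real^'d \<Rightarrow> (real^'d) set" where
  "cube_at j x0 = (THE cub. cub \<in> dyadic_cubes j \<and> x0 \<in> cub)"

definition neighbour_cubes :: "nat \<Rightarrow> real^'d \<Rightarrow> (real^'d) set set" where
  "neighbour_cubes j x0 = {cub \<in> dyadic_cubes j. setdist cub (cube_at j x0) = 0}"

definition wleader ::
    "ennreal \<Rightarrow> (int^'d \<Rightarrow> real^'d \<Rightarrow> complex) \<Rightarrow> (real^'d \<Rightarrow> complex) \<Rightarrow> real^'d \<Rightarrow> nat \<Rightarrow> ennreal" where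
  "wleader p \<psi> f x0 j = (SUP cub\<in>neighbour_cubes j x0. cube_leader p \<psi> f j cub)"

end

theory Submission
  imports Defs
begin

text \<open>
The weight \<open>2 powr (j d / p)\<close> in the definition of the space \<open>T\<close> is the one that appears when leaders
at level \<open>j\<close> are compared with \<open>L\<^sup>p\<close> norms, so the theorem reduces to a local estimate of the leader by the
modulus of smoothness of order \<open>m = diff_order \<sigma>\<close> on a ball of radius comparable to \<open>2 ^ (- j)\<close>
(\<open>local_leader_bound\<close>). The radius there is \<open>2 ^ N / 2 ^ j\<close> with \<open>N\<close> fixed; for \<open>j \<ge> N\<close> the bound is
the term of index \<open>j - N\<close> of the sequence that defines \<open>T\<close>, and admissibility of \<open>\<sigma>\<close> makes this shift
harmless in \<open>\<ell>\<^sup>q\<close> (\<open>in_ell_shift\<close>). The leaders with \<open>j < N\<close> are finitely many and each of them is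
finite, by the same estimate with differences of order \<open>0\<close>.

The usual way to estimate a coefficient subtracts from \<open>f\<close> a polynomial of degree less than \<open>m\<close> and
invokes a Whitney inequality on the ball. Here the differences are extracted from the wavelet
instead. Let \<open>u\<close> be bounded with bounded support and orthogonal to the polynomials of degree less
than \<open>m\<close>, and let \<open>B\<close> be a spline with \<open>c = \<integral> B > 0\<close>. Write \<open>D h g\<close> for \<open>x \<mapsto> g (x + h) - g x\<close>. Then
\<open>\<integral> B h (\<integral> D h g u) dh\<close> equals \<open>\<integral> g (B * u) - c \<integral> g u\<close>. The spline is built so that each partial
derivative of \<open>B\<close> is a first difference with unit step of another spline. If \<open>\<integral> u = 0\<close>, integrating
that derivative along rays turns \<open>B * u\<close> into a sum over the coordinates of unit differences of
functions \<open>primitive u n\<close>. Hence \<open>\<integral> g u\<close> is a combination of integrals of first differences of \<open>g\<close>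
(\<open>difference_representation\<close>), against \<open>u\<close> itself and against the functions \<open>primitive u n\<close>, which
are orthogonal to the polynomials of degree less than \<open>m - 1\<close> (\<open>vanishing_primitive\<close>). Both
are covered by the induction hypothesis for \<open>m - 1\<close>, and after \<open>m\<close> rounds \<open>\<integral> g u\<close> is controlled by
mixed differences of order \<open>m\<close> on a fixed neighbourhood of the support of \<open>u\<close>.

The induction is carried out for \<open>p\<close>-th powers summed over all integer translates of \<open>u\<close>
(\<open>lattice_bound\<close>): the averages over \<open>h\<close> pass through the sum by Jensen's inequality, and the bounded
overlap of the translated supports is used once, for \<open>m = 0\<close>. An identity of Kemperman expresses mixed
differences by iterated differences with a single step (\<open>mixed_energy_le_pure\<close>), and dilation
transports the estimate to the level \<open>j'\<close> (\<open>dyadic_coefficient_bound\<close>). All differences then have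
steps at most a constant times \<open>2 ^ (- j')\<close> and live within a constant times \<open>2 ^ (- j)\<close> of the point
\<open>x0\<close>, whatever \<open>j' \<ge> j\<close> is, which gives the bound on the leader.
\<close>

section \<open>Mixed differences\<close>

definition step_diff :: "real^'d \<Rightarrow> (real^'d \<Rightarrow> complex) \<Rightarrow> real^'d \<Rightarrow> complex" where
  "step_diff h g = (\<lambda>x. g (x + h) - g x)"

primrec mixed_diff :: "(real^'d) list \<Rightarrow> (real^'d \<Rightarrow> complex) \<Rightarrow> real^'d \<Rightarrow> complex" where
  "mixed_diff [] g = g"
| "mixed_diff (h # hs) g = mixed_diff hs (step_diff h g)"

lemma fdiff_0 [simp]: "fdiff 0 h g = g"
  by (simp add: fdiff_def)

lemma fdiff_Suc: "fdiff (Suc m) h g x = fdiff m h g (x + h) - fdiff m h g x"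
  by (simp add: fdiff_def)

lemma fdiff_binomial:
  "fdiff m v g x = (\<Sum>l\<le>m. (-1) ^ (m + l) * of_nat (m choose l) * g (x + real l *\<^sub>R v))"
proof (induction m arbitrary: x)
  case (Suc m)
  let ?c = "\<lambda>m l. (-1) ^ (m + l) * of_nat (m choose l) :: complex"
  let ?g = "\<lambda>l. g (x + real l *\<^sub>R v)"
  have "(\<Sum>l\<le>Suc m. ?c (Suc m) l * ?g l)
      = ?c (Suc m) 0 * ?g 0 + (\<Sum>l\<le>m. ?c (Suc m) (Suc l) * ?g (Suc l))"
    by (rule sum.atMost_Suc_shift)
  also have "(\<Sum>l\<le>m. ?c (Suc m) (Suc l) * ?g (Suc l))
      = (\<Sum>l\<le>m. ?c m l * ?g (Suc l)) + (\<Sum>l\<le>m. ?c m (Suc l) * - ?g (Suc l))"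
    by (simp add: sum.distrib[symmetric] algebra_simps sum_negf[symmetric] sum_subtractf[symmetric])
  also have "(\<Sum>l\<le>m. ?c m (Suc l) * - ?g (Suc l)) = (\<Sum>l\<le>Suc m. ?c m l * - ?g l) + ?c m 0 * ?g 0"
    by (subst sum.atMost_Suc_shift) simp
  also have "(\<Sum>l\<le>Suc m. ?c m l * - ?g l) = - (\<Sum>l\<le>m. ?c m l * ?g l)"
    by (simp add: sum_negf)
  finally have "(\<Sum>l\<le>Suc m. ?c (Suc m) l * ?g l)
      = (\<Sum>l\<le>m. ?c m l * ?g (Suc l)) - (\<Sum>l\<le>m. ?c m l * ?g l)"
    by simp
  moreover have "fdiff m v g (x + v) = (\<Sum>l\<le>m. ?c m l * ?g (Suc l))"
    by (simp add: Suc.IH algebra_simps)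
  ultimately show ?case
    by (simp only: fdiff_Suc Suc.IH[of x])
qed simp

lemma sum_Pow_insert:
  assumes "finite A" "a \<notin> A"
  shows "(\<Sum>S\<in>Pow (insert a A). f S) = (\<Sum>S\<in>Pow A. f S) + (\<Sum>S\<in>Pow A. f (insert a S))"
proof -
  have "inj_on (insert a) (Pow A)"
    using assms(2) by (intro inj_onI) (metis Pow_iff insert_ident subset_iff)
  moreover have "Pow A \<inter> insert a ` Pow A = {}"
    using assms(2) by auto
  ultimately show ?thesis
    using assms(1) by (simp add: Pow_insert sum.union_disjoint sum.reindex o_def)
qed

lemma mixed_diff_subsets:
  assumes "distinct xs"
  shows "mixed_diff (map h xs) g x
    = (\<Sum>S\<in>Pow (set xs). (-1) ^ (length xs + card S) * g (x + (\<Sum>s\<in>S. h s)))"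
  using assms
proof (induction xs arbitrary: g)
  case (Cons a xs)
  have fin: "finite S" "a \<notin> S" if "S \<in> Pow (set xs)" for S
    using that Cons.prems by (auto intro: finite_subset)
  have "mixed_diff (map h (a # xs)) g x
     = (\<Sum>S\<in>Pow (set xs). (-1) ^ (length xs + card S) *
          (g (x + (\<Sum>s\<in>S. h s) + h a) - g (x + (\<Sum>s\<in>S. h s))))"
    using Cons by (simp add: step_diff_def)
  also have "\<dots> = (\<Sum>S\<in>Pow (set xs). (-1) ^ (length (a # xs) + card S) * g (x + (\<Sum>s\<in>S. h s)))
     + (\<Sum>S\<in>Pow (set xs). (-1) ^ (length (a # xs) + card (insert a S)) * g (x + (\<Sum>s\<in>insert a S. h s)))"
    unfolding sum.distrib[symmetric]
    by (intro sum.cong refl) (simp add: fin algebra_simps)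
  also have "\<dots> = (\<Sum>S\<in>Pow (set (a # xs)). (-1) ^ (length (a # xs) + card S) * g (x + (\<Sum>s\<in>S. h s)))"
    using Cons.prems by (simp only: list.set) (subst sum_Pow_insert, auto)
  finally show ?case .
qed simp

lemma mixed_diff_zero_fun [simp]: "mixed_diff hs (\<lambda>x. 0) = (\<lambda>x. 0)"
  by (induction hs) (auto simp: step_diff_def)

lemma mixed_diff_zero_step: "0 \<in> set hs \<Longrightarrow> mixed_diff hs g = (\<lambda>x. 0)"
proof (induction hs arbitrary: g)
  case (Cons h hs)
  show ?case
  proof (cases "h = 0")
    case True
    have "step_diff 0 g = (\<lambda>x. 0)" by (simp add: step_diff_def)
    with True show ?thesis by simp
  next
    case False
    then show ?thesis using Cons by simp
  qed
qed simp

text \<open>Expand every difference on the right by the binomial theorem and collect the terms with the same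
\<open>l\<close>. With the steps \<open>(1 - l / s) h\<^sub>s\<close> they form a mixed difference. For \<open>1 \<le> l \<le> m\<close> the step with
\<open>s = l\<close> is zero, so the term vanishes; only \<open>l = 0\<close> survives, and its steps are the \<open>h\<^sub>s\<close>.\<close>

lemma kemperman:
  fixes h :: "nat \<Rightarrow> real^'d"
  shows "mixed_diff (map h [1..<Suc m]) g x =
    (\<Sum>S\<in>Pow {1..m}. (-1) ^ card S *
       fdiff m (- (\<Sum>s\<in>S. (1 / real s) *\<^sub>R h s)) g (x + (\<Sum>s\<in>S. h s)))"
proof -
  define t where "t l s = (1 - real l / real s) *\<^sub>R h s" for l s
  have setm: "set [1..<Suc m] = {1..m}" by auto
  have t: "(\<Sum>s\<in>S. t l s) = (\<Sum>s\<in>S. h s) + real l *\<^sub>R - (\<Sum>s\<in>S. (1 / real s) *\<^sub>R h s)" for l S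
    by (simp add: t_def scaleR_sum_right scaleR_diff_left sum_subtractf)
  \<comment> \<open>the right-hand side is what multiplies the \<open>l\<close>-th binomial coefficient, up to a sign\<close>
  have e: "mixed_diff (map (t l) [1..<Suc m]) g x
     = (\<Sum>S\<in>Pow {1..m}. (-1) ^ (m + card S) * g (x + (\<Sum>s\<in>S. t l s)))" for l
    using mixed_diff_subsets[of "[1..<Suc m]" "t l" g x] by (simp only: setm) (simp del: upt_Suc)
  have z: "mixed_diff (map (t l) [1..<Suc m]) g x = 0" if "l \<in> {1..m}" for l
  proof -
    have "t l l \<in> set (map (t l) [1..<Suc m])"
      unfolding set_map setm using that by (rule imageI)
    moreover have "t l l = 0" using that by (simp add: t_def)
    ultimately show ?thesis by (simp add: mixed_diff_zero_step)
  qed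
  have "(\<Sum>S\<in>Pow {1..m}. (-1) ^ card S *
       fdiff m (- (\<Sum>s\<in>S. (1 / real s) *\<^sub>R h s)) g (x + (\<Sum>s\<in>S. h s)))
     = (\<Sum>S\<in>Pow {1..m}. \<Sum>l\<le>m. ((-1) ^ l * of_nat (m choose l)) *
          ((-1) ^ (m + card S) * g (x + (\<Sum>s\<in>S. t l s))))"
    unfolding fdiff_binomial sum_distrib_left
    by (intro sum.cong refl) (simp add: t algebra_simps power_add)
  also have "\<dots> = (\<Sum>l\<le>m. ((-1) ^ l * of_nat (m choose l)) * mixed_diff (map (t l) [1..<Suc m]) g x)"
    by (subst sum.swap) (simp only: e sum_distrib_left)
  also have "\<dots> = (\<Sum>l\<in>{0}. ((-1) ^ l * of_nat (m choose l)) * mixed_diff (map (t l) [1..<Suc m]) g x)"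
    by (intro sum.mono_neutral_right) (use z in auto)
  also have "\<dots> = mixed_diff (map h [1..<Suc m]) g x"
  proof -
    have "t 0 = h" by (simp add: t_def fun_eq_iff)
    then show ?thesis by simp
  qed
  finally show ?thesis ..
qed

section \<open>Test functions and locally integrable functions\<close>

definition test_fun :: "('a::euclidean_space \<Rightarrow> complex) \<Rightarrow> bool" where
  "test_fun u \<longleftrightarrow> u \<in> borel_measurable borel \<and> (\<exists>M. \<forall>x. norm (u x) \<le> M) \<and>
     (\<exists>A. \<forall>x. u x \<noteq> 0 \<longrightarrow> norm x \<le> A)"

text \<open>Borel rather than Lebesgue measurable representatives make \<open>(x, h) \<mapsto> g (x + h)\<close> jointly measurable,
which is what the exchanges of integrals below rest on.\<close>

definition loc_int :: "('a::euclidean_space \<Rightarrow> complex) \<Rightarrow> bool" where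
  "loc_int g \<longleftrightarrow> g \<in> borel_measurable borel \<and> (\<forall>r. set_integrable lborel (cball 0 r) g)"

lemma test_funI:
  assumes "u \<in> borel_measurable borel" "\<And>x. norm (u x) \<le> M" "\<And>x. u x \<noteq> 0 \<Longrightarrow> norm x \<le> A"
  shows "test_fun u"
  using assms unfolding test_fun_def by blast

lemma test_fun_continuous:
  fixes u :: "'a::euclidean_space \<Rightarrow> complex"
  assumes "continuous_on UNIV u" and "\<And>x. u x \<noteq> 0 \<Longrightarrow> norm x \<le> A"
  shows "test_fun u"
proof -
  have "compact (u ` cball 0 A)"
    by (intro compact_continuous_image continuous_on_subset[OF assms(1)]) auto
  then obtain M where M: "\<And>x. x \<in> cball 0 A \<Longrightarrow> norm (u x) \<le> M"
    by (metis bounded_iff compact_imp_bounded image_eqI)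
  have "norm (u x) \<le> max M 0" for x
    using M[of x] assms(2)[of x] by (cases "u x = 0") (auto simp: le_max_iff_disj)
  with assms show ?thesis
    unfolding test_fun_def by (auto intro: borel_measurable_continuous_onI)
qed

lemma loc_int_continuous:
  assumes "continuous_on UNIV g"
  shows "loc_int g"
  unfolding loc_int_def set_integrable_def
  using assms
  by (auto intro!: borel_integrable_compact borel_measurable_continuous_onI continuous_on_subset[OF assms])

lemma test_funE:
  assumes "test_fun u"
  obtains M A where "\<And>x. norm (u x) \<le> M" "\<And>x. u x \<noteq> 0 \<Longrightarrow> norm x \<le> A" "0 \<le> M" "0 \<le> A"
proof -
  obtain M A where *: "\<And>x. norm (u x) \<le> M" "\<And>x. u x \<noteq> 0 \<Longrightarrow> norm x \<le> A"
    using assms by (auto simp: test_fun_def)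
  then have "norm (u x) \<le> max M 0" "u x \<noteq> 0 \<Longrightarrow> norm x \<le> max A 0" for x
    by (auto simp: le_max_iff_disj)
  then show thesis by (intro that[of "max M 0" "max A 0"]) auto
qed

lemma lborel_integral_translate:
  fixes F :: "'a::euclidean_space \<Rightarrow> complex"
  assumes "F \<in> borel_measurable borel"
  shows "(\<integral>x. F (x + c) \<partial>lborel) = (\<integral>x. F x \<partial>lborel)"
proof -
  have "(\<integral>x. F x \<partial>lborel) = (\<integral>x. F x \<partial>distr lborel borel ((+) c))"
    by (simp add: lborel_distr_plus)
  also have "\<dots> = (\<integral>x. F (c + x) \<partial>lborel)"
    using assms by (subst integral_distr) auto
  finally show ?thesis by (simp add: add.commute)
qed

lemma lborel_integral_reflect:
  fixes F :: "'a::euclidean_space \<Rightarrow> complex"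
  assumes "F \<in> borel_measurable borel"
  shows "(\<integral>x. F (c - x) \<partial>lborel) = (\<integral>x. F x \<partial>lborel)"
proof -
  have "lborel = distr lborel borel (\<lambda>x::'a. c + (-1) *\<^sub>R x)"
    using lborel_affine[of "-1" c] by (simp add: density_1)
  then have "(\<integral>x. F x \<partial>lborel) = (\<integral>x. F x \<partial>distr lborel borel (\<lambda>x. c - x))"
    by simp
  also have "\<dots> = (\<integral>x. F (c - x) \<partial>lborel)"
    using assms by (subst integral_distr) auto
  finally show ?thesis by simp
qed

lemma nn_integral_translate:
  fixes F :: "'a::euclidean_space \<Rightarrow> ennreal"
  assumes "F \<in> borel_measurable borel"
  shows "(\<integral>\<^sup>+x. F (x + c) \<partial>lborel) = (\<integral>\<^sup>+x. F x \<partial>lborel)"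
proof -
  have "(\<integral>\<^sup>+x. F x \<partial>lborel) = (\<integral>\<^sup>+x. F x \<partial>distr lborel borel ((+) c))"
    by (simp add: lborel_distr_plus)
  also have "\<dots> = (\<integral>\<^sup>+x. F (c + x) \<partial>lborel)"
    using assms by (subst nn_integral_distr) auto
  finally show ?thesis by (simp add: add.commute)
qed

lemma loc_int_mult_integrable:
  assumes g: "loc_int g" and u: "test_fun u"
  shows "integrable lborel (\<lambda>x. g x * u x)"
proof -
  obtain M A where M: "\<And>x. norm (u x) \<le> M" "\<And>x. u x \<noteq> 0 \<Longrightarrow> norm x \<le> A" "0 \<le> M"
    using test_funE[OF u] by metis
  have [measurable]: "g \<in> borel_measurable borel" "u \<in> borel_measurable borel"
    using g u by (auto simp: loc_int_def test_fun_def)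
  have "integrable lborel (\<lambda>x. of_real M * (indicator (cball 0 A) x *\<^sub>R g x))"
    using g by (intro integrable_mult_right) (auto simp: loc_int_def set_integrable_def)
  then show ?thesis
  proof (rule Bochner_Integration.integrable_bound)
    show "AE x in lborel. norm (g x * u x) \<le> norm (of_real M * (indicator (cball 0 A) x *\<^sub>R g x))"
    proof (intro AE_I2)
      fix x show "norm (g x * u x) \<le> norm (of_real M * (indicator (cball 0 A) x *\<^sub>R g x))"
        using M(1)[of x] M(2)[of x] M(3)
        by (cases "u x = 0") (auto simp: norm_mult mult.commute[of M] intro!: mult_left_mono)
    qed
  qed measurable
qed

text \<open>The factor \<open>g\<close> depends on one variable only and everything else is bounded with bounded support,
so the double integral is dominated by \<open>\<bar>g\<bar>\<close> on a ball times the volume of another ball.\<close>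

lemma loc_int_Fubini:
  fixes g :: "'a::euclidean_space \<Rightarrow> complex" and k :: "'a \<Rightarrow> 'b::euclidean_space \<Rightarrow> complex"
  assumes g: "loc_int g"
    and k: "case_prod k \<in> borel_measurable (borel \<Otimes>\<^sub>M borel)"
    and M: "\<And>x y. norm (k x y) \<le> M"
    and A: "\<And>x y. k x y \<noteq> 0 \<Longrightarrow> norm x \<le> A \<and> norm y \<le> A"
  shows "(\<integral>y. (\<integral>x. g x * k x y \<partial>lborel) \<partial>lborel) = (\<integral>x. g x * (\<integral>y. k x y \<partial>lborel) \<partial>lborel)"
    and "integrable lborel (\<lambda>y. \<integral>x. g x * k x y \<partial>lborel)"
proof -
  have [measurable]: "g \<in> borel_measurable borel" "case_prod k \<in> borel_measurable (borel \<Otimes>\<^sub>M borel)"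
    using g k by (auto simp: loc_int_def)
  have M0: "0 \<le> M" using M[of 0 0] norm_ge_zero order_trans by blast
  have ky: "integrable lborel (k x)" for x
  proof -
    have "test_fun (k x)"
      by (rule test_funI[of _ M A]) (use M A in auto)
    moreover have "loc_int (\<lambda>_::'b. 1)"
      by (intro loc_int_continuous continuous_intros)
    ultimately show ?thesis
      using loc_int_mult_integrable[of "\<lambda>_. 1" "k x"] by simp
  qed
  have int: "integrable (lborel \<Otimes>\<^sub>M lborel) (\<lambda>(x, y). g x * k x y)"
  proof (rule lborel_pair.Fubini_integrable)
    show "(\<lambda>(x, y). g x * k x y) \<in> borel_measurable (lborel \<Otimes>\<^sub>M lborel)"
      by measurable
    show "AE x in lborel. integrable lborel (\<lambda>y. case (x, y) of (x, y) \<Rightarrow> g x * k x y)"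
      using ky by auto
    have n: "(\<integral>y. norm (case (x, y) of (x, y) \<Rightarrow> g x * k x y) \<partial>lborel)
          = norm (g x) * (\<integral>y. norm (k x y) \<partial>lborel)" for x
      by (simp add: norm_mult)
    let ?C = "measure lborel (cball 0 A :: 'b set) * M"
    have ck: "(\<integral>y. norm (k x y) \<partial>lborel) \<le> ?C" for x
    proof -
      have "(\<integral>y. norm (k x y) \<partial>lborel) \<le> (\<integral>y. indicator (cball (0::'b) A) y *\<^sub>R M \<partial>lborel)"
      proof (rule Bochner_Integration.integral_mono)
        show "norm (k x y) \<le> indicator (cball 0 A) y *\<^sub>R M" for y
          using M[of x y] A[of x y] by (cases "k x y = 0") (auto simp: M0)
      qed (use ky emeasure_lborel_cball_finite[of 0 A] in \<open>auto intro!: integrable_scaleR_left simp: less_top\<close>)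
      then show ?thesis by simp
    qed
    have "integrable lborel (\<lambda>x. of_real ?C * (indicator (cball 0 A) x *\<^sub>R g x))"
      using g by (intro integrable_mult_right) (auto simp: loc_int_def set_integrable_def)
    then show "integrable lborel (\<lambda>x. \<integral>y. norm (case (x, y) of (x, y) \<Rightarrow> g x * k x y) \<partial>lborel)"
      unfolding n
    proof (rule Bochner_Integration.integrable_bound)
      show "AE x in lborel. norm (norm (g x) * (\<integral>y. norm (k x y) \<partial>lborel))
          \<le> norm (of_real ?C * (indicator (cball 0 A) x *\<^sub>R g x))"
      proof (intro AE_I2)
        fix x show "norm (norm (g x) * (\<integral>y. norm (k x y) \<partial>lborel))
          \<le> norm (of_real ?C * (indicator (cball 0 A) x *\<^sub>R g x))"
        proof (cases "norm x \<le> A")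
          case True
          then show ?thesis using ck[of x] M0
            by (auto simp: norm_mult mult.commute[of _ "norm (g x)"] intro!: mult_left_mono)
        next
          case False
          then have "k x y = 0" for y using A by blast
          then show ?thesis by simp
        qed
      qed
    qed measurable
  qed
  show "(\<integral>y. (\<integral>x. g x * k x y \<partial>lborel) \<partial>lborel) = (\<integral>x. g x * (\<integral>y. k x y \<partial>lborel) \<partial>lborel)"
    using lborel_pair.Fubini_integral[OF int] by simp
  show "integrable lborel (\<lambda>y. \<integral>x. g x * k x y \<partial>lborel)"
    using lborel_pair.integrable_snd[OF int] by simp
qed

lemma integrable_translate_iff:
  fixes F :: "'a::euclidean_space \<Rightarrow> complex"
  assumes "F \<in> borel_measurable borel"
  shows "integrable lborel (\<lambda>x. F (x + c)) \<longleftrightarrow> integrable lborel F"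
proof -
  have "integrable lborel F \<longleftrightarrow> integrable (distr lborel borel ((+) c)) F"
    by (simp add: lborel_distr_plus)
  also have "\<dots> \<longleftrightarrow> integrable lborel (\<lambda>x. F (c + x))"
    using assms by (subst integrable_distr_eq) auto
  finally show ?thesis by (simp add: add.commute)
qed

lemma loc_int_measurable: "loc_int g \<Longrightarrow> g \<in> borel_measurable borel"
  by (simp add: loc_int_def)

lemma test_fun_measurable: "test_fun u \<Longrightarrow> u \<in> borel_measurable borel"
  by (simp add: test_fun_def)

lemma test_fun_integrable: "test_fun u \<Longrightarrow> integrable lborel u"
  using loc_int_mult_integrable[OF loc_int_continuous[of "\<lambda>_. 1"], of u] by simp

lemma loc_int_translate:
  assumes "loc_int g"
  shows "loc_int (\<lambda>x. g (x + c))"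
proof -
  have [measurable]: "g \<in> borel_measurable borel" using assms by (rule loc_int_measurable)
  have "set_integrable lborel (cball 0 r) (\<lambda>x. g (x + c))" for r
  proof -
    have "integrable lborel (\<lambda>x. indicator (cball 0 (r + norm c)) x *\<^sub>R g x)"
      using assms by (auto simp: loc_int_def set_integrable_def)
    then have "integrable lborel (\<lambda>x. indicator (cball 0 (r + norm c)) (x + c) *\<^sub>R g (x + c))"
      by (subst integrable_translate_iff) auto
    moreover have [measurable]: "cball (0::'a) r \<in> sets borel" by simp
    have "(\<lambda>x. indicator (cball 0 r) x *\<^sub>R g (x + c)) \<in> borel_measurable lborel" by measurable
    ultimately show ?thesis unfolding set_integrable_def
    proof (rule Bochner_Integration.integrable_bound)
      show "AE x in lborel. norm (indicator (cball 0 r) x *\<^sub>R g (x + c))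
          \<le> norm (indicator (cball 0 (r + norm c)) (x + c) *\<^sub>R g (x + c))"
      proof (intro AE_I2)
        fix x show "norm (indicator (cball 0 r) x *\<^sub>R g (x + c))
          \<le> norm (indicator (cball 0 (r + norm c)) (x + c) *\<^sub>R g (x + c))"
          using norm_triangle_ineq[of x c] by (auto simp: indicator_def)
      qed
    qed
  qed
  then show ?thesis by (auto simp: loc_int_def)
qed

lemma loc_int_step_diff: "loc_int g \<Longrightarrow> loc_int (step_diff h g)"
  using loc_int_translate[of g h]
  by (auto simp: step_diff_def loc_int_def set_integrable_def scaleR_diff_right)

lemma test_fun_translate:
  assumes "test_fun u"
  shows "test_fun (\<lambda>x. u (x + c))"
proof -
  obtain M A where M: "\<And>x. norm (u x) \<le> M" "\<And>x. u x \<noteq> 0 \<Longrightarrow> norm x \<le> A"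
    using test_funE[OF assms] by metis
  have [measurable]: "u \<in> borel_measurable borel" using assms by (rule test_fun_measurable)
  have "norm x \<le> A + norm c" if "u (x + c) \<noteq> 0" for x
    using M(2)[OF that] norm_triangle_ineq4[of "x + c" c] by simp
  then show ?thesis using M by (auto simp: test_fun_def)
qed

lemma test_fun_mult_continuous:
  assumes "test_fun u" "continuous_on UNIV p"
  shows "test_fun (\<lambda>x. p x * u x)"
proof -
  obtain M A where M: "\<And>x. norm (u x) \<le> M" "\<And>x. u x \<noteq> 0 \<Longrightarrow> norm x \<le> A" "0 \<le> M"
    using test_funE[OF assms(1)] by metis
  have "compact (p ` cball 0 A)"
    by (intro compact_continuous_image continuous_on_subset[OF assms(2)]) auto
  then obtain N where N: "\<And>x. x \<in> cball 0 A \<Longrightarrow> norm (p x) \<le> N"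
    by (metis bounded_iff compact_imp_bounded image_eqI)
  have [measurable]: "u \<in> borel_measurable borel" "p \<in> borel_measurable borel"
    using assms by (auto intro: test_fun_measurable borel_measurable_continuous_onI)
  have "norm (p x * u x) \<le> max N 0 * M" for x
    using N[of x] M(1)[of x] M(2)[of x] M(3)
    by (cases "u x = 0") (auto simp: norm_mult intro!: mult_mono)
  then show ?thesis using M unfolding test_fun_def by auto
qed

section \<open>A spline mollifier\<close>

text \<open>A smooth step from \<open>0\<close> to \<open>1\<close> on the interval from \<open>0\<close> to \<open>2\<close>, whose derivative is the piecewise
linear function \<open>hat\<close>. Differencing it gives a \<open>C\<^sup>1\<close> bump whose derivative is in turn a difference;
the tensor product of such bumps has partial derivatives of the same kind.\<close>

definition ramp :: "real \<Rightarrow> real" where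
  "ramp t = ((max 0 t)\<^sup>2 - 2 * (max 0 (t - 1))\<^sup>2 + (max 0 (t - 2))\<^sup>2) / 2"

definition hat :: "real \<Rightarrow> real" where
  "hat t = max 0 t - 2 * max 0 (t - 1) + max 0 (t - 2)"

definition bump :: "real \<Rightarrow> real" where
  "bump t = ramp (t + 1) - ramp t"

definition mollifier :: "real^'d \<Rightarrow> real" where
  "mollifier z = (\<Prod>n\<in>UNIV. bump (z $ n))"

text \<open>The factor of coordinate \<open>n\<close> is replaced by \<open>hat\<close>, so that the partial derivative of \<open>mollifier\<close> in that
coordinate is the difference of \<open>mollifier_part n\<close> with step \<open>axis n 1\<close>.\<close>

definition mollifier_part :: "'d::finite \<Rightarrow> real^'d \<Rightarrow> real" where
  "mollifier_part n z = hat (z $ n) * (\<Prod>k\<in>UNIV - {n}. bump (z $ k))"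

lemma truncated_square_deriv:
  "((\<lambda>t. (max 0 (t - a))\<^sup>2) has_real_derivative 2 * max 0 (t - a)) (at (t::real))"
proof -
  consider "t < a" | "t > a" | "t = a" by linarith
  then show ?thesis
  proof cases
    case 1
    have "((\<lambda>t. 0) has_real_derivative 2 * max 0 (t - a)) (at t)" using 1 by simp
    then show ?thesis
      by (rule DERIV_cong_ev[THEN iffD1, rotated 3])
        (use 1 in \<open>auto intro!: eventually_mono[OF order_tendstoD(2)[OF tendsto_ident_at]] eventually_mono[OF eventually_nhds_in_open[of "{..<a}"]]\<close>)
  next
    case 2
    have "((\<lambda>t. (t - a)\<^sup>2) has_real_derivative 2 * max 0 (t - a)) (at t)"
      using 2 by (auto intro!: derivative_eq_intros)
    then show ?thesis
      by (rule DERIV_cong_ev[THEN iffD1, rotated 3])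
        (use 2 in \<open>auto intro!: eventually_mono[OF eventually_nhds_in_open[of "{a<..}"]]\<close>)
  next
    case 3
    have "((\<lambda>h. (max 0 h)\<^sup>2 / h) \<longlongrightarrow> (0::real)) (at 0)"
    proof (rule Lim_null_comparison)
      show "\<forall>\<^sub>F h in at 0. norm ((max 0 h)\<^sup>2 / h) \<le> \<bar>h::real\<bar>"
        by (intro always_eventually) (auto simp: max_def power2_eq_square)
      show "((\<lambda>h. \<bar>h::real\<bar>) \<longlongrightarrow> 0) (at 0)"
        by (intro tendsto_eq_intros) auto
    qed
    then show ?thesis using 3 by (simp add: DERIV_def)
  qed
qed

lemma ramp_deriv [derivative_intros]: "(ramp has_real_derivative hat t) (at t)"
proof -
  have "((\<lambda>t. ((max 0 (t - 0))\<^sup>2 - 2 * (max 0 (t - 1))\<^sup>2 + (max 0 (t - 2))\<^sup>2) / 2)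
     has_real_derivative hat t) (at t)"
    by (rule derivative_eq_intros truncated_square_deriv refl | simp add: hat_def)+
  then show ?thesis by (simp add: ramp_def[abs_def])
qed

lemma hat_nonneg: "0 \<le> hat t" and hat_support: "hat t \<noteq> 0 \<Longrightarrow> \<bar>t\<bar> \<le> 2"
  by (auto simp: hat_def max_def split: if_splits)

lemma bump_nonneg: "0 \<le> bump t"
  unfolding bump_def
  using DERIV_nonneg_imp_nondecreasing[of t "t + 1" ramp] ramp_deriv hat_nonneg by auto

lemma bump_support: "bump t \<noteq> 0 \<Longrightarrow> \<bar>t\<bar> \<le> 2"
  by (auto simp: bump_def ramp_def max_def power2_eq_square field_simps split: if_splits)

lemma bump_deriv: "(bump has_real_derivative hat (t + 1) - hat t) (at t)"
proof -
  have "((\<lambda>t. ramp (t + 1)) has_real_derivative hat (t + 1)) (at t)"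
    using DERIV_shift ramp_deriv by blast
  then show ?thesis unfolding bump_def[abs_def] by (intro derivative_intros ramp_deriv)
qed

lemma continuous_hat: "continuous_on UNIV hat"
  unfolding hat_def[abs_def] by (intro continuous_intros)

lemma continuous_bump: "continuous_on UNIV bump"
  using bump_deriv by (metis DERIV_isCont continuous_at_imp_continuous_on)

lemma mollifier_continuous: "continuous_on UNIV (mollifier :: real^'d \<Rightarrow> real)"
  unfolding mollifier_def[abs_def]
  by (intro continuous_on_prod continuous_on_compose2[OF continuous_bump] continuous_intros) auto

lemma mollifier_part_continuous: "continuous_on UNIV (mollifier_part n :: real^'d \<Rightarrow> real)"
  unfolding mollifier_part_def[abs_def]
  by (intro continuous_on_prod continuous_on_mult continuous_on_compose2[OF continuous_bump]
      continuous_on_compose2[OF continuous_hat] continuous_intros) auto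

lemma norm_le_of_components:
  fixes z :: "real^'d"
  assumes "\<And>n. \<bar>z $ n\<bar> \<le> a"
  shows "norm z \<le> real CARD('d) * a"
proof -
  have "norm z \<le> (\<Sum>n\<in>UNIV. \<bar>z $ n\<bar>)" by (rule norm_le_l1_cart)
  also have "\<dots> \<le> real (card (UNIV :: 'd set)) * a"
    by (rule sum_bounded_above) (use assms in auto)
  finally show ?thesis .
qed

lemma mollifier_support: "mollifier (z :: real^'d) \<noteq> 0 \<Longrightarrow> norm z \<le> real CARD('d) * 2"
  by (intro norm_le_of_components bump_support) (auto simp: mollifier_def)

lemma mollifier_part_support: "mollifier_part n (z :: real^'d) \<noteq> 0 \<Longrightarrow> norm z \<le> real CARD('d) * 2"
proof (rule norm_le_of_components)
  fix k assume "mollifier_part n z \<noteq> 0"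
  then show "\<bar>z $ k\<bar> \<le> 2"
    by (cases "k = n") (auto simp: mollifier_part_def intro: bump_support hat_support)
qed

lemma mollifier_nonneg: "0 \<le> mollifier z"
  by (simp add: mollifier_def prod_nonneg bump_nonneg)

lemma test_fun_mollifier: "test_fun (\<lambda>z :: real^'d. complex_of_real (mollifier z))"
  by (rule test_fun_continuous[where A = "real CARD('d) * 2"])
    (auto intro!: continuous_intros mollifier_continuous dest: mollifier_support)

lemma test_fun_mollifier_part: "test_fun (\<lambda>z :: real^'d. complex_of_real (mollifier_part n z))"
  by (rule test_fun_continuous[where A = "real CARD('d) * 2"])
    (auto intro!: continuous_intros mollifier_part_continuous dest: mollifier_part_support)

lemma mollifier_integrable: "integrable lborel (mollifier :: real^'d \<Rightarrow> real)"
proof -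
  have "loc_int (\<lambda>_::real^'d. 1)" by (intro loc_int_continuous continuous_intros)
  from loc_int_mult_integrable[OF this test_fun_mollifier] show ?thesis
    by (simp add: complex_of_real_integrable_eq)
qed

lemma mollifier_integral_pos: "0 < (\<integral>z. mollifier (z :: real^'d) \<partial>lborel)"
proof -
  have "(\<integral>z. mollifier (z :: real^'d) \<partial>lborel) \<noteq> 0"
  proof
    assume "(\<integral>z. mollifier (z :: real^'d) \<partial>lborel) = 0"
    then have "AE z in lborel. mollifier (z :: real^'d) = 0"
      using integral_nonneg_eq_0_iff_AE[OF mollifier_integrable] by (auto simp: mollifier_nonneg)
    then have "AE z in lborel. z \<notin> {z :: real^'d. mollifier z \<noteq> 0}" by simp
    moreover have "{z :: real^'d. mollifier z \<noteq> 0} \<in> sets lborel"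
      using borel_measurable_continuous_onI[OF mollifier_continuous] by measurable
    ultimately have "{z :: real^'d. mollifier z \<noteq> 0} \<in> null_sets lborel"
      by (rule AE_iff_null_sets[THEN iffD2, rotated])
    then have "negligible {z :: real^'d. mollifier z \<noteq> 0}"
      by (simp add: negligible_iff_null_sets null_sets_completionI)
    moreover have "open {z :: real^'d. mollifier z \<noteq> 0}"
      by (intro open_Collect_neq mollifier_continuous continuous_intros)
    moreover have "mollifier (0 :: real^'d) \<noteq> 0"
      by (simp add: mollifier_def bump_def ramp_def)
    ultimately show False using open_not_negligible by blast
  qed
  moreover have "0 \<le> (\<integral>z. mollifier (z :: real^'d) \<partial>lborel)"
    by (simp add: mollifier_nonneg)
  ultimately show ?thesis by linarith
qed

lemma mollifier_deriv:
  fixes z x :: "real^'d"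
  shows "((\<lambda>t. mollifier (z - t *\<^sub>R x)) has_real_derivative
     - (\<Sum>n\<in>UNIV. x $ n * (mollifier_part n (z - t *\<^sub>R x + axis n 1) - mollifier_part n (z - t *\<^sub>R x)))) (at t)"
proof -
  have "((\<lambda>t. bump (z $ n - t * x $ n)) has_real_derivative
      (hat (z $ n - t * x $ n + 1) - hat (z $ n - t * x $ n)) * - (x $ n)) (at t)" for n
    by (rule DERIV_chain2[OF bump_deriv]) (auto intro!: derivative_eq_intros)
  then have "((\<lambda>t. \<Prod>n\<in>UNIV. bump (z $ n - t * x $ n)) has_real_derivative
     (\<Sum>n\<in>UNIV. ((hat (z $ n - t * x $ n + 1) - hat (z $ n - t * x $ n)) * - (x $ n))
        * (\<Prod>k\<in>UNIV - {n}. bump (z $ k - t * x $ k)))) (at t)"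
    by (intro has_field_derivative_prod) auto
  moreover have "(\<Sum>n\<in>UNIV. ((hat (z $ n - t * x $ n + 1) - hat (z $ n - t * x $ n)) * - (x $ n))
        * (\<Prod>k\<in>UNIV - {n}. bump (z $ k - t * x $ k)))
     = - (\<Sum>n\<in>UNIV. x $ n * (mollifier_part n (z - t *\<^sub>R x + axis n 1) - mollifier_part n (z - t *\<^sub>R x)))"
    unfolding mollifier_part_def sum_negf[symmetric]
  proof (intro sum.cong refl)
    fix n
    have "(\<Prod>k\<in>UNIV - {n}. bump ((z - t *\<^sub>R x + axis n 1) $ k)) = (\<Prod>k\<in>UNIV - {n}. bump (z $ k - t * x $ k))"
      by (intro prod.cong) (auto simp: axis_def)
    then show "(hat (z $ n - t * x $ n + 1) - hat (z $ n - t * x $ n)) * - (x $ n) * (\<Prod>k\<in>UNIV - {n}. bump (z $ k - t * x $ k)) =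
      - (x $ n * (hat ((z - t *\<^sub>R x + axis n 1) $ n) * (\<Prod>k\<in>UNIV - {n}. bump ((z - t *\<^sub>R x + axis n 1) $ k)) -
         hat ((z - t *\<^sub>R x) $ n) * (\<Prod>k\<in>UNIV - {n}. bump ((z - t *\<^sub>R x) $ k))))"
      by (simp add: axis_def algebra_simps)
  qed
  ultimately show ?thesis by (simp add: mollifier_def)
qed

section \<open>Polynomials and vanishing moments\<close>

text \<open>Polynomials of degree at most \<open>k\<close>, generated by multiplication with coordinates. Stability under
averages of translates is then an induction that never looks at coefficients.\<close>

inductive poly_le :: "nat \<Rightarrow> (real^'d \<Rightarrow> complex) \<Rightarrow> bool" where
  const: "poly_le k (\<lambda>x. c)"
| add: "poly_le k p \<Longrightarrow> poly_le k q \<Longrightarrow> poly_le k (\<lambda>x. p x + q x)"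
| coordinate: "poly_le k p \<Longrightarrow> poly_le (Suc k) (\<lambda>x. of_real (x $ n) * p x)"

definition vanishing :: "nat \<Rightarrow> (real^'d \<Rightarrow> complex) \<Rightarrow> bool" where
  "vanishing m u \<longleftrightarrow> (\<forall>k p. k < m \<longrightarrow> poly_le k p \<longrightarrow> (\<integral>x. p x * u x \<partial>lborel) = 0)"

lemma poly_le_continuous: "poly_le k p \<Longrightarrow> continuous_on UNIV p"
  by (induction rule: poly_le.induct) (auto intro!: continuous_intros)

lemma poly_le_Suc: "poly_le k p \<Longrightarrow> poly_le (Suc k) p"
  by (induction rule: poly_le.induct) (auto intro: poly_le.intros)

text \<open>In the step for a coordinate, \<open>(z + t x)\<^sub>n\<close> splits into \<open>z\<^sub>n\<close>, which is absorbed into the weight, and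
\<open>t x\<^sub>n\<close>, where \<open>t\<close> is absorbed into the weight and \<open>x\<^sub>n\<close> supplies the missing degree. This is why
the weight is arbitrary in the induction.\<close>

lemma poly_le_average:
  fixes p :: "real^'d \<Rightarrow> complex" and b :: "real \<times> (real^'d) \<Rightarrow> complex"
  assumes "poly_le k p" "test_fun b"
  shows "poly_le k (\<lambda>x. \<integral>y. p (snd y + fst y *\<^sub>R x) * b y \<partial>lborel)"
  using assms
proof (induction arbitrary: b rule: poly_le.induct)
  case (const k c)
  then show ?case by (intro poly_le.const)
next
  case (add k p q)
  have int: "integrable lborel (\<lambda>y. r (snd y + fst y *\<^sub>R x) * b y)" if "poly_le k r" for r and x :: "real^'d"
    by (intro loc_int_mult_integrable loc_int_continuous add.prems
        continuous_on_compose2[OF poly_le_continuous[OF that]] continuous_intros) auto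
  show ?case
    using poly_le.add[OF add.IH(1)[OF add.prems] add.IH(2)[OF add.prems]]
    by (simp add: distrib_right Bochner_Integration.integral_add int add.hyps)
next
  case (coordinate k p n)
  have b1: "test_fun (\<lambda>y. of_real (snd y $ n) * b y)" and b2: "test_fun (\<lambda>y. of_real (fst y) * b y)"
    by (intro test_fun_mult_continuous coordinate.prems continuous_intros)+
  have int: "integrable lborel (\<lambda>y. p (snd y + fst y *\<^sub>R x) * b' y)" if "test_fun b'" for b' and x :: "real^'d"
    by (intro loc_int_mult_integrable loc_int_continuous that
        continuous_on_compose2[OF poly_le_continuous[OF coordinate.hyps]] continuous_intros) auto
  have "(\<integral>y. of_real ((snd y + fst y *\<^sub>R x) $ n) * p (snd y + fst y *\<^sub>R x) * b y \<partial>lborel)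
     = (\<integral>y. p (snd y + fst y *\<^sub>R x) * (of_real (snd y $ n) * b y) \<partial>lborel)
       + of_real (x $ n) * (\<integral>y. p (snd y + fst y *\<^sub>R x) * (of_real (fst y) * b y) \<partial>lborel)" for x
    by (subst integral_mult_right_zero[symmetric],
        subst Bochner_Integration.integral_add[OF int[OF b1] integrable_mult_right[OF int[OF b2]], symmetric])
       (auto intro!: Bochner_Integration.integral_cong simp: algebra_simps)
  then show ?case
    by (simp only: ) (intro poly_le.add poly_le_Suc coordinate.IH[OF b1] poly_le.coordinate coordinate.IH[OF b2])
qed

text \<open>The claim is proved for products of a monomial with a polynomial: each coordinate that the
polynomial releases raises one exponent of the monomial.\<close>

lemma vanishing_of_moments:
  fixes u :: "real^'d \<Rightarrow> complex"
  assumes u: "test_fun u"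
    and mom: "\<And>\<alpha> :: 'd \<Rightarrow> nat. (\<Sum>n\<in>UNIV. \<alpha> n) < m \<Longrightarrow>
      (\<integral>x. complex_of_real (\<Prod>n\<in>UNIV. (x $ n) ^ \<alpha> n) * u x \<partial>lborel) = 0"
  shows "vanishing m u"
proof -
  let ?mono = "\<lambda>(\<alpha> :: 'd \<Rightarrow> nat) x. complex_of_real (\<Prod>n\<in>UNIV. (x $ n) ^ \<alpha> n)"
  have "(\<integral>x. ?mono \<alpha> x * p x * u x \<partial>lborel) = 0"
    if "poly_le k p" "(\<Sum>n\<in>UNIV. \<alpha> n) + k < m" for k p \<alpha>
    using that
  proof (induction arbitrary: \<alpha> rule: poly_le.induct)
    case (const k c)
    have "(\<integral>x. ?mono \<alpha> x * c * u x \<partial>lborel) = c * (\<integral>x. ?mono \<alpha> x * u x \<partial>lborel)"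
      by (subst integral_mult_right_zero[symmetric]) (simp only: ac_simps)
    then show ?case using mom[of \<alpha>] const by simp
  next
    case (add k p q)
    have i: "integrable lborel (\<lambda>x. ?mono \<alpha> x * r x * u x)" if "poly_le k r" for r
      by (intro test_fun_integrable test_fun_mult_continuous u continuous_intros poly_le_continuous[OF that])
    show ?case
      using add.IH[OF add.prems] i[OF add.hyps(1)] i[OF add.hyps(2)]
      by (simp only: distrib_left distrib_right Bochner_Integration.integral_add add_0)
  next
    case (coordinate k p n)
    let ?\<beta> = "\<alpha>(n := Suc (\<alpha> n))"
    have "(\<Prod>k\<in>UNIV. (x $ k) ^ ?\<beta> k) = (\<Prod>k\<in>UNIV. (x $ k) ^ \<alpha> k) * x $ n" for x :: "real^'d"
    proof -
      have "(\<Prod>k\<in>UNIV. (x $ k) ^ ?\<beta> k) = (x $ n) ^ ?\<beta> n * (\<Prod>k\<in>UNIV - {n}. (x $ k) ^ ?\<beta> k)"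
        by (rule prod.remove) auto
      also have "(\<Prod>k\<in>UNIV - {n}. (x $ k) ^ ?\<beta> k) = (\<Prod>k\<in>UNIV - {n}. (x $ k) ^ \<alpha> k)"
        by (intro prod.cong) auto
      also have "(x $ n) ^ ?\<beta> n * \<dots> = ((x $ n) ^ \<alpha> n * (\<Prod>k\<in>UNIV - {n}. (x $ k) ^ \<alpha> k)) * x $ n"
        by simp
      also have "(x $ n) ^ \<alpha> n * (\<Prod>k\<in>UNIV - {n}. (x $ k) ^ \<alpha> k) = (\<Prod>k\<in>UNIV. (x $ k) ^ \<alpha> k)"
        by (rule prod.remove[symmetric]) auto
      finally show ?thesis .
    qed
    moreover have "(\<Sum>k\<in>UNIV. ?\<beta> k) = (\<Sum>k\<in>UNIV. \<alpha> k) + 1"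
    proof -
      have "(\<Sum>k\<in>UNIV - {n}. ?\<beta> k) = (\<Sum>k\<in>UNIV - {n}. \<alpha> k)" by (intro sum.cong) auto
      then show ?thesis
        using sum.remove[of UNIV n "?\<beta>"] sum.remove[of UNIV n \<alpha>] by simp
    qed
    ultimately show ?case
      using coordinate.IH[of ?\<beta>] coordinate.prems by (simp only: of_real_mult mult.assoc)
  qed
  from this[of _ _ "\<lambda>_. 0"] show ?thesis by (simp add: vanishing_def)
qed

section \<open>Vanishing moments trade for differences\<close>

text \<open>The integral of \<open>mollifier_part n\<close> along the segment from \<open>z\<close> to \<open>z - x\<close>. By the fundamental theorem of
calculus the increments of \<open>mollifier\<close> are differences of these averages.\<close>

definition ray_average :: "'d::finite \<Rightarrow> real^'d \<Rightarrow> real^'d \<Rightarrow> complex" where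
  "ray_average n z x = (\<integral>t. indicator {0..1} t * of_real (mollifier_part n (z - t *\<^sub>R x)) \<partial>lborel)"

text \<open>If \<open>\<integral> u = 0\<close>, then \<open>mollifier * u\<close> is the sum over \<open>n\<close> of the differences of \<open>primitive u n\<close> with step
\<open>axis n 1\<close>; in this sense the functions are discrete primitives of the smoothed \<open>u\<close>.\<close>

definition primitive :: "(real^'d \<Rightarrow> complex) \<Rightarrow> 'd \<Rightarrow> real^'d \<Rightarrow> complex" where
  "primitive u n z = - (\<integral>x. of_real (x $ n) * u x * ray_average n z x \<partial>lborel)"

lemma vec_nth_measurable [measurable]: "(\<lambda>x :: real^'d. x $ n) \<in> borel_measurable borel"
  by (intro borel_measurable_continuous_onI continuous_intros)

lemma mollifier_measurable [measurable]: "mollifier \<in> borel_measurable borel"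
  by (intro borel_measurable_continuous_onI mollifier_continuous)

lemma mollifier_part_measurable [measurable]: "mollifier_part n \<in> borel_measurable borel"
  by (intro borel_measurable_continuous_onI mollifier_part_continuous)

lemma ray_average_measurable [measurable]:
  "(\<lambda>(z, x). ray_average n z x) \<in> borel_measurable (borel \<Otimes>\<^sub>M borel)"
  unfolding ray_average_def by measurable

lemma test_fun_ray_integrand:
  fixes z x :: "real^'d"
  shows "test_fun (\<lambda>t. indicator {0..1} t * complex_of_real (mollifier_part n (z - t *\<^sub>R x)))"
proof -
  obtain M A where M: "\<And>z::real^'d. norm (complex_of_real (mollifier_part n z)) \<le> M" "0 \<le> M"
    using test_funE[OF test_fun_mollifier_part] by metis
  show ?thesis
    by (rule test_funI[of _ M 1]) (use M in \<open>auto simp: indicator_def norm_mult\<close>)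
qed

lemma ray_average_bounded:
  obtains M where "\<And>z x :: real^'d. norm (ray_average n z x) \<le> M"
proof -
  obtain M A where M: "\<And>z::real^'d. norm (complex_of_real (mollifier_part n z)) \<le> M" "0 \<le> M"
    using test_funE[OF test_fun_mollifier_part] by metis
  have "norm (ray_average n z x) \<le> M" for z x :: "real^'d"
  proof -
    have "norm (ray_average n z x) \<le> (\<integral>t. norm (indicator {0..1} t * complex_of_real (mollifier_part n (z - t *\<^sub>R x))) \<partial>lborel)"
      unfolding ray_average_def by (rule integral_norm_bound)
    also have "\<dots> \<le> (\<integral>t. indicator {0..1::real} t *\<^sub>R M \<partial>lborel)"
    proof (rule Bochner_Integration.integral_mono)
      show "integrable lborel (\<lambda>t. norm (indicator {0..1} t * complex_of_real (mollifier_part n (z - t *\<^sub>R x))))"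
        by (rule integrable_norm, rule test_fun_integrable, rule test_fun_ray_integrand)
      show "integrable lborel (\<lambda>t. indicator {0..1::real} t *\<^sub>R M)"
        by (intro integrable_scaleR_left) (auto intro: integrable_real_indicator)
    qed (use M in \<open>auto simp: indicator_def norm_mult\<close>)
    also have "\<dots> = M" by simp
    finally show ?thesis .
  qed
  then show thesis by (rule that)
qed

lemma ray_average_support:
  fixes z x :: "real^'d"
  assumes "ray_average n z x \<noteq> 0"
  shows "norm z \<le> norm x + real CARD('d) * 2"
proof (rule ccontr)
  assume *: "\<not> ?thesis"
  have "indicator {0..1} t * complex_of_real (mollifier_part n (z - t *\<^sub>R x)) = 0" for t
  proof (cases "t \<in> {0..1}")
    case True
    have "norm z \<le> norm (z - t *\<^sub>R x) + norm (t *\<^sub>R x)"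
      using norm_triangle_sub[of z "t *\<^sub>R x"] by (simp add: add.commute)
    moreover have "norm (t *\<^sub>R x) \<le> norm x" using True by (simp add: mult_left_le_one_le)
    ultimately have "\<not> norm (z - t *\<^sub>R x) \<le> real CARD('d) * 2" using * by linarith
    then have "mollifier_part n (z - t *\<^sub>R x) = 0" using mollifier_part_support by blast
    then show ?thesis by simp
  qed simp
  then have "ray_average n z x = 0" unfolding ray_average_def by (simp only: integral_zero)
  with assms show False by simp
qed

lemma mollifier_increment:
  fixes z x :: "real^'d"
  shows "complex_of_real (mollifier (z - x) - mollifier z)
    = - (\<Sum>n\<in>UNIV. of_real (x $ n) * (ray_average n (z + axis n 1) x - ray_average n z x))"
proof -
  let ?k = "\<lambda>n t. mollifier_part n (z - t *\<^sub>R x)"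
  let ?k' = "\<lambda>n t. mollifier_part n (z - t *\<^sub>R x + axis n 1)"
  let ?D = "\<lambda>t. - (\<Sum>n\<in>UNIV. x $ n * (?k' n t - ?k n t))"
  have int: "integrable lborel (\<lambda>t. indicator {0..1} t * complex_of_real (mollifier_part n (w - t *\<^sub>R x)))" for n and w :: "real^'d"
    by (rule test_fun_integrable, rule test_fun_ray_integrand)
  have int': "integrable lborel (\<lambda>t. indicator {0..1} t * complex_of_real (?k' n t))" for n
    using int[of n "z + axis n 1"] by (simp add: algebra_simps)
  have r': "(\<integral>t. indicator {0..1} t * complex_of_real (?k' n t) \<partial>lborel) = ray_average n (z + axis n 1) x" for n
    by (simp add: ray_average_def algebra_simps)
  have "(\<integral>t. indicator {0..1} t *\<^sub>R complex_of_real (?D t) \<partial>lborel)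
     = complex_of_real (mollifier (z - 1 *\<^sub>R x)) - complex_of_real (mollifier (z - 0 *\<^sub>R x))"
  proof (rule integral_FTC_Icc)
    show "continuous_on {0..1} (\<lambda>t. complex_of_real (?D t))"
      by (intro continuous_intros continuous_on_compose2[OF mollifier_part_continuous]) auto
    fix t :: real
    have "((\<lambda>t. mollifier (z - t *\<^sub>R x)) has_real_derivative ?D t) (at t within {0..1})"
      using mollifier_deriv has_field_derivative_at_within by blast
    then show "((\<lambda>t. complex_of_real (mollifier (z - t *\<^sub>R x))) has_vector_derivative complex_of_real (?D t)) (at t within {0..1})"
      by (rule has_vector_derivative_of_real[unfolded has_real_derivative_iff_has_vector_derivative[symmetric]])
  qed auto
  moreover have "(\<integral>t. indicator {0..1} t *\<^sub>R complex_of_real (?D t) \<partial>lborel)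
    = (\<integral>t. - (\<Sum>n\<in>UNIV. of_real (x $ n) * (indicator {0..1} t * complex_of_real (?k' n t) - indicator {0..1} t * complex_of_real (?k n t))) \<partial>lborel)"
    by (intro Bochner_Integration.integral_cong) (auto simp: indicator_def)
  moreover have "\<dots> = - (\<Sum>n\<in>UNIV. of_real (x $ n) * (ray_average n (z + axis n 1) x - ray_average n z x))"
    by (simp add: int int' r' Bochner_Integration.integral_sum ray_average_def[symmetric])
  ultimately show ?thesis by simp
qed

lemma primitive_measurable [measurable]:
  assumes [measurable]: "u \<in> borel_measurable borel"
  shows "primitive u n \<in> borel_measurable borel"
  unfolding primitive_def by measurable

lemma primitive_integrand:
  fixes u :: "real^'d \<Rightarrow> complex"
  assumes u: "test_fun u"
  obtains M A where
    "\<And>z x. norm (of_real (x $ n) * u x * ray_average n z x) \<le> M"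
    "\<And>z x. of_real (x $ n) * u x * ray_average n z x \<noteq> 0 \<Longrightarrow> norm z \<le> A \<and> norm x \<le> A"
proof -
  have tf: "test_fun (\<lambda>x. of_real (x $ n) * u x)"
    by (intro test_fun_mult_continuous u continuous_intros)
  obtain M A where M: "\<And>x. norm (of_real (x $ n) * u x) \<le> M" "0 \<le> M"
    and A: "\<And>x. of_real (x $ n) * u x \<noteq> 0 \<Longrightarrow> norm x \<le> A"
    using test_funE[OF tf] by metis
  obtain N where N: "\<And>z x :: real^'d. norm (ray_average n z x) \<le> N"
    using ray_average_bounded by metis
  show thesis
  proof (rule that)
    fix z x :: "real^'d"
    have "norm ((of_real (x $ n) * u x) * ray_average n z x) \<le> M * N"
      unfolding norm_mult[of "of_real (x $ n) * u x"] by (intro mult_mono M N) auto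
    then show "norm (of_real (x $ n) * u x * ray_average n z x) \<le> M * N" by simp
    assume nz: "of_real (x $ n) * u x * ray_average n z x \<noteq> 0"
    then have "norm x \<le> A" using A[of x] by auto
    moreover have "norm z \<le> norm x + real CARD('d) * 2"
      using nz by (intro ray_average_support) auto
    ultimately show "norm z \<le> A + real CARD('d) * 2 \<and> norm x \<le> A + real CARD('d) * 2"
      by (smt (verit) of_nat_0_le_iff)
  qed
qed

lemma primitive_integrand_test_fun:
  fixes u :: "real^'d \<Rightarrow> complex"
  assumes u: "test_fun u"
  shows "test_fun (\<lambda>x. of_real (x $ n) * u x * ray_average n z x)"
proof -
  have [measurable]: "u \<in> borel_measurable borel" using u by (rule test_fun_measurable)
  obtain M A where "\<And>z x. norm (of_real (x $ n) * u x * ray_average n z x) \<le> M"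
    "\<And>z x. of_real (x $ n) * u x * ray_average n z x \<noteq> 0 \<Longrightarrow> norm z \<le> A \<and> norm x \<le> A"
    using primitive_integrand[OF u] by blast
  then show ?thesis
    by (intro test_funI[of _ M A]) auto
qed

lemma test_fun_primitive:
  fixes u :: "real^'d \<Rightarrow> complex"
  assumes u: "test_fun u"
  shows "test_fun (primitive u n)"
proof -
  have [measurable]: "u \<in> borel_measurable borel" using u by (rule test_fun_measurable)
  obtain M A where M: "\<And>z x. norm (of_real (x $ n) * u x * ray_average n z x) \<le> M"
    and A: "\<And>z x. of_real (x $ n) * u x * ray_average n z x \<noteq> 0 \<Longrightarrow> norm z \<le> A \<and> norm x \<le> A"
    using primitive_integrand[OF u] by blast
  have M0: "0 \<le> M" using M[of 0 0] norm_ge_zero order_trans by blast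
  let ?C = "measure lborel (cball (0::real^'d) A) * M"
  have "norm (primitive u n z) \<le> ?C" for z
  proof -
    have "norm (primitive u n z) \<le> (\<integral>x. norm (of_real (x $ n) * u x * ray_average n z x) \<partial>lborel)"
      unfolding primitive_def norm_minus_cancel by (rule integral_norm_bound)
    also have "\<dots> \<le> (\<integral>x. indicator (cball (0::real^'d) A) x *\<^sub>R M \<partial>lborel)"
    proof (rule Bochner_Integration.integral_mono)
      show "integrable lborel (\<lambda>x. norm (of_real (x $ n) * u x * ray_average n z x))"
        by (intro integrable_norm test_fun_integrable primitive_integrand_test_fun u)
      show "integrable lborel (\<lambda>x. indicator (cball (0::real^'d) A) x *\<^sub>R M)"
        using emeasure_lborel_cball_finite[of "0::real^'d" A]
        by (intro integrable_scaleR_left) (auto intro: integrable_real_indicator simp: less_top)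
      show "norm (of_real (x $ n) * u x * ray_average n z x) \<le> indicator (cball 0 A) x *\<^sub>R M" for x
        using M[of x z] A[of x z] M0
        by (cases "of_real (x $ n) * u x * ray_average n z x = 0") auto
    qed
    finally show ?thesis by simp
  qed
  moreover have "norm z \<le> A" if "primitive u n z \<noteq> 0" for z
  proof (rule ccontr)
    assume "\<not> norm z \<le> A"
    then have "of_real (x $ n) * u x * ray_average n z x = 0" for x using A by blast
    then have "primitive u n z = 0" unfolding primitive_def by (simp only: integral_zero minus_zero)
    with that show False by simp
  qed
  ultimately show ?thesis
    by (intro test_funI[of _ ?C A]) auto
qed

text \<open>Integrating a polynomial \<open>p\<close> against \<open>primitive u n\<close> and exchanging the integrals leaves \<open>u\<close> integrated
against \<open>x\<^sub>n\<close> times an average of the polynomials \<open>p (z + t x)\<close>. That product has degree one more than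
\<open>p\<close> in \<open>x\<close>, so exactly one order of vanishing is lost.\<close>

lemma vanishing_primitive:
  fixes u :: "real^'d \<Rightarrow> complex"
  assumes u: "test_fun u" and v: "vanishing (Suc m) u"
  shows "vanishing m (primitive u n)"
  unfolding vanishing_def
proof (intro allI impI)
  fix k and p :: "real^'d \<Rightarrow> complex"
  assume k: "k < m" and p: "poly_le k p"
  have [measurable]: "u \<in> borel_measurable borel" using u by (rule test_fun_measurable)
  have cp: "continuous_on UNIV p" by (rule poly_le_continuous[OF p])
  have [measurable]: "p \<in> borel_measurable borel" by (intro borel_measurable_continuous_onI cp)
  have lp: "loc_int p" by (rule loc_int_continuous[OF cp])
  obtain M A where M: "\<And>z x. norm (of_real (x $ n) * u x * ray_average n z x) \<le> M"
    and A: "\<And>z x. of_real (x $ n) * u x * ray_average n z x \<noteq> 0 \<Longrightarrow> norm z \<le> A \<and> norm x \<le> A"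
    using primitive_integrand[OF u] by blast
  define b where "b = (\<lambda>(t, z). indicator {0..1::real} t * complex_of_real (mollifier_part n (z :: real^'d)))"
  obtain Mk where Mk: "\<And>z::real^'d. norm (complex_of_real (mollifier_part n z)) \<le> Mk" "0 \<le> Mk"
    using test_funE[OF test_fun_mollifier_part] by metis
  have b: "test_fun b"
  proof -
    have [measurable]: "b \<in> borel_measurable borel"
      unfolding b_def borel_prod[symmetric] by measurable
    have 1: "norm (b y) \<le> Mk" for y
      using Mk by (auto simp: b_def indicator_def norm_mult split: prod.split)
    have 2: "norm y \<le> 1 + real CARD('d) * 2" if "b y \<noteq> 0" for y
    proof -
      obtain t z where y: "y = (t, z)" by force
      have "norm t \<le> 1" "norm z \<le> real CARD('d) * 2"
        using that unfolding y b_def by (auto simp: indicator_def split: if_splits dest: mollifier_part_support)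
      then show ?thesis unfolding y using norm_Pair_le[of t z] by linarith
    qed
    show ?thesis
      by (rule test_funI[of _ Mk "1 + real CARD('d) * 2"]) (use 1 2 in auto)
  qed
  \<comment> \<open>after a translation in \<open>z\<close> the moment of a ray average has the form covered by \<open>poly_le_average\<close>\<close>
  have ray: "(\<integral>z. p z * ray_average n z x \<partial>lborel) = (\<integral>y. p (snd y + fst y *\<^sub>R x) * b y \<partial>lborel)" for x
  proof -
    let ?k = "\<lambda>z t. indicator {0..1} t * complex_of_real (mollifier_part n (z - t *\<^sub>R x))"
    have "(\<integral>z. p z * ray_average n z x \<partial>lborel) = (\<integral>t. (\<integral>z. p z * ?k z t \<partial>lborel) \<partial>lborel)"
      unfolding ray_average_def
    proof (rule loc_int_Fubini(1)[OF lp, symmetric])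
      show "case_prod ?k \<in> borel_measurable (borel \<Otimes>\<^sub>M borel)" by measurable
      show "norm (?k z t) \<le> Mk" for z t using Mk by (auto simp: indicator_def norm_mult)
      fix z t assume nz: "?k z t \<noteq> 0"
      then have t: "0 \<le> t" "t \<le> 1" and *: "norm (z - t *\<^sub>R x) \<le> real CARD('d) * 2"
        by (auto simp: indicator_def split: if_splits dest: mollifier_part_support)
      have "norm z \<le> norm (z - t *\<^sub>R x) + norm (t *\<^sub>R x)"
        using norm_triangle_sub[of z "t *\<^sub>R x"] by (simp add: add.commute)
      moreover have "norm (t *\<^sub>R x) \<le> norm x" using t by (simp add: mult_left_le_one_le)
      ultimately show "norm z \<le> 1 + norm x + real CARD('d) * 2 \<and> norm t \<le> 1 + norm x + real CARD('d) * 2"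
        using * t by (auto simp: add_increasing2)
    qed
    also have "\<dots> = (\<integral>t. (\<integral>z. p (z + t *\<^sub>R x) * b (t, z) \<partial>lborel) \<partial>lborel)"
    proof (rule Bochner_Integration.integral_cong[OF refl])
      fix t
      have "(\<lambda>z. p z * ?k z t) \<in> borel_measurable borel" by measurable
      from lborel_integral_translate[OF this, of "t *\<^sub>R x"]
      show "(\<integral>z. p z * ?k z t \<partial>lborel) = (\<integral>z. p (z + t *\<^sub>R x) * b (t, z) \<partial>lborel)"
        by (simp add: b_def)
    qed
    also have "\<dots> = (\<integral>y. p (snd y + fst y *\<^sub>R x) * b y \<partial>(lborel \<Otimes>\<^sub>M lborel))"
    proof -
      have "loc_int (\<lambda>y :: real \<times> (real^'d). p (snd y + fst y *\<^sub>R x))"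
        by (intro loc_int_continuous continuous_on_compose2[OF cp] continuous_intros) auto
      from loc_int_mult_integrable[OF this b]
      have "integrable (lborel \<Otimes>\<^sub>M lborel) (\<lambda>y. p (snd y + fst y *\<^sub>R x) * b y)"
        by (simp add: lborel_prod)
      from lborel_pair.integral_fst'[OF this] show ?thesis by simp
    qed
    finally show ?thesis by (simp add: lborel_prod)
  qed
  have "(\<integral>z. p z * primitive u n z \<partial>lborel)
      = - (\<integral>z. p z * (\<integral>x. of_real (x $ n) * u x * ray_average n z x \<partial>lborel) \<partial>lborel)"
    by (simp add: primitive_def)
  also have "(\<integral>z. p z * (\<integral>x. of_real (x $ n) * u x * ray_average n z x \<partial>lborel) \<partial>lborel)
      = (\<integral>x. (\<integral>z. p z * (of_real (x $ n) * u x * ray_average n z x) \<partial>lborel) \<partial>lborel)"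
  proof (rule loc_int_Fubini(1)[OF lp, symmetric])
    show "(\<lambda>(z, x). of_real (x $ n) * u x * ray_average n z x) \<in> borel_measurable (borel \<Otimes>\<^sub>M borel)"
      by measurable
  qed (fact M A)+
  also have "\<dots> = (\<integral>x. (of_real (x $ n) * (\<integral>y. p (snd y + fst y *\<^sub>R x) * b y \<partial>lborel)) * u x \<partial>lborel)"
  proof (rule Bochner_Integration.integral_cong[OF refl])
    fix x
    have "(\<integral>z. p z * (of_real (x $ n) * u x * ray_average n z x) \<partial>lborel)
        = (\<integral>z. (of_real (x $ n) * u x) * (p z * ray_average n z x) \<partial>lborel)"
      by (simp only: mult.left_commute)
    also have "\<dots> = (of_real (x $ n) * u x) * (\<integral>z. p z * ray_average n z x \<partial>lborel)"
      by (rule integral_mult_right_zero)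
    finally show "(\<integral>z. p z * (of_real (x $ n) * u x * ray_average n z x) \<partial>lborel)
      = (of_real (x $ n) * (\<integral>y. p (snd y + fst y *\<^sub>R x) * b y \<partial>lborel)) * u x"
      unfolding ray by (simp only: mult.assoc mult.commute[of "u x"])
  qed
  also have "\<dots> = 0"
    using v poly_le.coordinate[OF poly_le_average[OF p b]] k unfolding vanishing_def by blast
  finally show "(\<integral>z. p z * primitive u n z \<partial>lborel) = 0" by simp
qed

lemma vanishing_integral: "vanishing (Suc m) u \<Longrightarrow> integral\<^sup>L lborel u = 0"
  using poly_le.const[of 0 1] by (force simp: vanishing_def)

lemma vanishing_mono: "vanishing m u \<Longrightarrow> n \<le> m \<Longrightarrow> vanishing n u"
  unfolding vanishing_def by (meson less_le_trans)

text \<open>Since \<open>\<integral> u = 0\<close>, the function \<open>mollifier (z - x)\<close> may be replaced by its increment from \<open>mollifier z\<close>.\<close>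

lemma mollifier_convolution:
  fixes u :: "real^'d \<Rightarrow> complex"
  assumes u: "test_fun u" and z: "integral\<^sup>L lborel u = 0"
  shows "(\<integral>h. of_real (mollifier h) * u (z - h) \<partial>lborel)
    = (\<Sum>n\<in>UNIV. primitive u n (z + axis n 1) - primitive u n z)"
proof -
  have [measurable]: "u \<in> borel_measurable borel" using u by (rule test_fun_measurable)
  have ru: "integrable lborel (\<lambda>x. of_real (x $ n) * u x * ray_average n w x)" for n w
    by (intro test_fun_integrable primitive_integrand_test_fun u)
  have iu: "integrable lborel u" by (intro test_fun_integrable u)
  have ku: "integrable lborel (\<lambda>x. complex_of_real (mollifier (z - x)) * u x)"
    by (intro test_fun_integrable test_fun_mult_continuous u continuous_intros
        continuous_on_compose2[OF mollifier_continuous]) auto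
  have "(\<integral>h. of_real (mollifier h) * u (z - h) \<partial>lborel) = (\<integral>x. complex_of_real (mollifier (z - x)) * u x \<partial>lborel)"
    using lborel_integral_reflect[of "\<lambda>h. of_real (mollifier h) * u (z - h)" z] by simp
  also have "\<dots> = (\<integral>x. complex_of_real (mollifier (z - x)) * u x - of_real (mollifier z) * u x \<partial>lborel)"
    by (subst Bochner_Integration.integral_diff) (auto intro: ku iu simp: z)
  also have "\<dots> = (\<integral>x. (\<Sum>n\<in>UNIV. of_real (x $ n) * u x * ray_average n z x
       - of_real (x $ n) * u x * ray_average n (z + axis n 1) x) \<partial>lborel)"
  proof (intro Bochner_Integration.integral_cong refl)
    fix x
    have "complex_of_real (mollifier (z - x)) * u x - of_real (mollifier z) * u x
       = complex_of_real (mollifier (z - x) - mollifier z) * u x" by (simp add: algebra_simps)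
    also have "\<dots> = (\<Sum>n\<in>UNIV. of_real (x $ n) * u x * ray_average n z x
       - of_real (x $ n) * u x * ray_average n (z + axis n 1) x)"
      unfolding mollifier_increment minus_mult_left[symmetric] sum_distrib_right sum_negf[symmetric]
      by (intro sum.cong) (auto simp: algebra_simps)
    finally show "complex_of_real (mollifier (z - x)) * u x - of_real (mollifier z) * u x = \<dots>" .
  qed
  also have "\<dots> = (\<Sum>n\<in>UNIV. primitive u n (z + axis n 1) - primitive u n z)"
    by (subst Bochner_Integration.integral_sum) (auto simp: ru primitive_def)
  finally show ?thesis .
qed

text \<open>Averaging \<open>\<integral> step_diff h g u = \<integral> g (x + h) u x - \<integral> g u\<close> over \<open>h\<close> with weight \<open>mollifier\<close> produces
\<open>\<integral> g (mollifier * u) - c \<integral> g u\<close>. The convolution is a sum of differences of primitives, and these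
differences move over to \<open>g\<close> with the opposite step.\<close>

lemma difference_representation:
  fixes u g :: "real^'d \<Rightarrow> complex"
  assumes u: "test_fun u" and z: "integral\<^sup>L lborel u = 0" and g: "loc_int g"
  shows "of_real (\<integral>h. mollifier (h :: real^'d) \<partial>lborel) * (\<integral>x. g x * u x \<partial>lborel)
    = (\<Sum>n\<in>UNIV. \<integral>x. step_diff (- axis n 1) g x * primitive u n x \<partial>lborel)
      - (\<integral>h. of_real (mollifier h) * (\<integral>x. step_diff h g x * u x \<partial>lborel) \<partial>lborel)"
proof -
  have [measurable]: "u \<in> borel_measurable borel" "g \<in> borel_measurable borel"
    using u g by (auto intro: test_fun_measurable loc_int_measurable)
  let ?c = "complex_of_real (\<integral>h. mollifier (h :: real^'d) \<partial>lborel)"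
  let ?I = "\<integral>x. g x * u x \<partial>lborel"
  let ?k = "\<lambda>z h. complex_of_real (mollifier h) * u (z - h)"
  obtain M A where M: "\<And>x. norm (u x) \<le> M" "\<And>x. u x \<noteq> 0 \<Longrightarrow> norm x \<le> A" "0 \<le> M" "0 \<le> A"
    using test_funE[OF u] by metis
  obtain Mk where Mk: "\<And>z::real^'d. norm (complex_of_real (mollifier z)) \<le> Mk" "0 \<le> Mk"
    using test_funE[OF test_fun_mollifier] by metis
  have k1: "case_prod ?k \<in> borel_measurable (borel \<Otimes>\<^sub>M borel)" by measurable
  have k2: "norm (?k z h) \<le> Mk * M" for z h
    unfolding norm_mult by (intro mult_mono M Mk) auto
  have k3: "norm z \<le> A + real CARD('d) * 2 \<and> norm h \<le> A + real CARD('d) * 2" if "?k z h \<noteq> 0" for z h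
  proof -
    have "norm h \<le> real CARD('d) * 2" "norm (z - h) \<le> A"
      using that by (auto intro: M mollifier_support)
    moreover have "norm z \<le> norm (z - h) + norm h"
      using norm_triangle_sub[of z h] by (simp add: add.commute)
    ultimately show ?thesis using M(4) by auto
  qed
  note F = loc_int_Fubini[OF g k1 k2 k3]
  \<comment> \<open>the translate is moved from \<open>g\<close> to \<open>u\<close>, where Fubini's theorem applies\<close>
  have sd: "of_real (mollifier h) * (\<integral>x. step_diff h g x * u x \<partial>lborel)
     = (\<integral>z. g z * ?k z h \<partial>lborel) - of_real (mollifier h) * ?I" for h
  proof -
    have "(\<integral>x. step_diff h g x * u x \<partial>lborel) = (\<integral>x. g (x + h) * u x - g x * u x \<partial>lborel)"
      by (simp add: step_diff_def algebra_simps)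
    also have "\<dots> = (\<integral>x. g (x + h) * u x \<partial>lborel) - ?I"
      by (intro Bochner_Integration.integral_diff loc_int_mult_integrable loc_int_translate g u)
    also have "(\<integral>x. g (x + h) * u x \<partial>lborel) = (\<integral>z. g z * u (z - h) \<partial>lborel)"
      using lborel_integral_translate[of "\<lambda>z. g z * u (z - h)" h] by simp
    finally have "of_real (mollifier h) * (\<integral>x. step_diff h g x * u x \<partial>lborel)
        = of_real (mollifier h) * (\<integral>z. g z * u (z - h) \<partial>lborel) - of_real (mollifier h) * ?I"
      by (simp only: right_diff_distrib)
    also have "of_real (mollifier h) * (\<integral>z. g z * u (z - h) \<partial>lborel) = (\<integral>z. of_real (mollifier h) * (g z * u (z - h)) \<partial>lborel)"
      by (rule integral_mult_right_zero[symmetric])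
    finally show ?thesis
      by (simp only: mult.left_commute)
  qed
  have "(\<integral>h. of_real (mollifier h) * (\<integral>x. step_diff h g x * u x \<partial>lborel) \<partial>lborel)
     = (\<integral>h. (\<integral>z. g z * ?k z h \<partial>lborel) \<partial>lborel) - ?c * ?I"
    unfolding sd
    by (subst Bochner_Integration.integral_diff)
       (use F(2) integrable_mult_left[OF test_fun_integrable[OF test_fun_mollifier], of ?I] in \<open>auto simp: mult.commute\<close>)
  also have "(\<integral>h. (\<integral>z. g z * ?k z h \<partial>lborel) \<partial>lborel)
     = (\<integral>z. (\<Sum>n\<in>UNIV. g z * primitive u n (z + axis n 1) - g z * primitive u n z) \<partial>lborel)"
  proof -
    have "(\<integral>h. (\<integral>z. g z * ?k z h \<partial>lborel) \<partial>lborel) = (\<integral>z. g z * (\<integral>h. ?k z h \<partial>lborel) \<partial>lborel)"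
      by (rule F(1))
    then show ?thesis
      unfolding mollifier_convolution[OF u z] sum_distrib_left right_diff_distrib .
  qed
  also have "\<dots> = (\<Sum>n\<in>UNIV. (\<integral>z. g z * primitive u n (z + axis n 1) \<partial>lborel) - (\<integral>z. g z * primitive u n z \<partial>lborel))"
  proof -
    have i: "integrable lborel (\<lambda>z. g z * primitive u n (z + c))" for n c
      by (intro loc_int_mult_integrable g test_fun_translate test_fun_primitive u)
    have i0: "integrable lborel (\<lambda>z. g z * primitive u n z)" for n
      by (intro loc_int_mult_integrable g test_fun_primitive u)
    show ?thesis
      by (subst Bochner_Integration.integral_sum)
        (simp_all only: Bochner_Integration.integral_diff[OF i i0] Bochner_Integration.integrable_diff[OF i i0])
  qed
  also have "\<dots> = (\<Sum>n\<in>UNIV. \<integral>x. step_diff (- axis n 1) g x * primitive u n x \<partial>lborel)"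
  proof (intro sum.cong refl)
    fix n
    have "(\<integral>x. step_diff (- axis n 1) g x * primitive u n x \<partial>lborel)
       = (\<integral>x. g (x + - axis n 1) * primitive u n x - g x * primitive u n x \<partial>lborel)"
      by (simp add: step_diff_def algebra_simps)
    also have "\<dots> = (\<integral>x. g (x + - axis n 1) * primitive u n x \<partial>lborel) - (\<integral>x. g x * primitive u n x \<partial>lborel)"
      by (intro Bochner_Integration.integral_diff loc_int_mult_integrable loc_int_translate g test_fun_primitive u)
    also have "(\<integral>x. g (x + - axis n 1) * primitive u n x \<partial>lborel) = (\<integral>z. g z * primitive u n (z + axis n 1) \<partial>lborel)"
      using lborel_integral_translate[of "\<lambda>z. g z * primitive u n (z + axis n 1)" "- axis n 1"] u
      by (simp add: primitive_measurable)
    finally show "(\<integral>z. g z * primitive u n (z + axis n 1) \<partial>lborel) - (\<integral>z. g z * primitive u n z \<partial>lborel)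
       = (\<integral>x. step_diff (- axis n 1) g x * primitive u n x \<partial>lborel)" ..
  qed
  finally show ?thesis by (simp add: algebra_simps)
qed

section \<open>Power means\<close>

lemma powr_above_tangent:
  fixes a \<mu> P :: real
  assumes "1 \<le> P" "0 \<le> a" "0 < \<mu>"
  shows "\<mu> powr P + P * \<mu> powr (P - 1) * (a - \<mu>) \<le> a powr P"
proof (cases "a = 0")
  case True
  have "\<mu> powr P = \<mu> powr (P - 1) * \<mu>" using assms by (simp add: powr_diff)
  then have "\<mu> powr P + P * \<mu> powr (P - 1) * (a - \<mu>) = (1 - P) * \<mu> powr P"
    using True by (simp add: algebra_simps)
  also have "\<dots> \<le> 0" using assms by (simp add: mult_nonpos_nonneg)
  finally show ?thesis using True by simp
next
  case False
  have "P * \<mu> powr (P - 1) * (a - \<mu>) \<le> a powr P - \<mu> powr P"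
  proof (rule convex_on_imp_above_tangent[of "{0<..}" "\<lambda>x. x powr P"])
    show "convex_on {0<..} (\<lambda>x::real. x powr P)" by (rule powr_convex[OF assms(1)])
    show "((\<lambda>x. x powr P) has_real_derivative P * \<mu> powr (P - 1)) (at \<mu> within {0<..})"
      using assms by (auto intro!: derivative_eq_intros)
  qed (use assms False in \<open>auto simp: interior_open\<close>)
  then show ?thesis by simp
qed

text \<open>Jensen's inequality for \<open>a \<mapsto> a powr P\<close>, stated without normalising the weight. It follows by
integrating the tangent inequality at the weighted mean. The right-hand side is an extended integral,
so that no integrability of \<open>a powr P\<close> has to be known in advance.\<close>

lemma weighted_power_mean:
  fixes w a :: "'a \<Rightarrow> real"
  assumes P: "1 \<le> P" and w: "integrable M w" and w0: "\<And>x. 0 \<le> w x"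
    and a [measurable]: "a \<in> borel_measurable M" and a0: "\<And>x. 0 \<le> a x"
  shows "ennreal ((\<integral>x. w x * a x \<partial>M) powr P)
    \<le> ennreal ((\<integral>x. w x \<partial>M) powr (P - 1)) * (\<integral>\<^sup>+x. ennreal (w x) * ennreal (a x powr P) \<partial>M)"
proof -
  have [measurable]: "w \<in> borel_measurable M" using w by auto
  let ?W = "\<integral>x. w x \<partial>M" and ?I = "\<integral>x. w x * a x \<partial>M"
  have I0: "0 \<le> ?I" and W0: "0 \<le> ?W" by (simp_all add: w0 a0)
  show ?thesis
  proof (cases "?I = 0")
    case True then show ?thesis by simp
  next
    case False
    with I0 have I: "0 < ?I" by simp
    then have wa: "integrable M (\<lambda>x. w x * a x)"
      using not_integrable_integral_eq[of M "\<lambda>x. w x * a x"] by fastforce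
    have W: "0 < ?W"
    proof (rule ccontr)
      assume "\<not> ?thesis"
      with W0 have "?W = 0" by linarith
      then have "AE x in M. w x = 0"
        using integral_nonneg_eq_0_iff_AE[OF w] w0 by auto
      then have "AE x in M. w x * a x = 0" by eventually_elim simp
      then have "?I = 0" by (rule integral_eq_zero_AE)
      with I show False by simp
    qed
    show ?thesis
    proof (cases "(\<integral>\<^sup>+x. ennreal (w x) * ennreal (a x powr P) \<partial>M) = \<infinity>")
      case True
      then show ?thesis using W by (simp add: ennreal_mult_top)
    next
      case False
      have e: "ennreal (w x) * ennreal (a x powr P) = ennreal (w x * a x powr P)" for x
        by (simp add: ennreal_mult w0)
      have wp: "integrable M (\<lambda>x. w x * a x powr P)"
        using False by (intro integrableI_nonneg) (auto simp: w0 e less_top)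
      \<comment> \<open>the point of tangency is the weighted mean, which makes the linear term integrate to zero\<close>
      define \<mu> where "\<mu> = ?I / ?W"
      have mu: "0 < \<mu>" using I W by (simp add: \<mu>_def)
      let ?t = "\<lambda>x. \<mu> powr P * w x + P * \<mu> powr (P - 1) * (w x * a x - \<mu> * w x)"
      have "integral\<^sup>L M ?t \<le> (\<integral>x. w x * a x powr P \<partial>M)"
      proof (rule Bochner_Integration.integral_mono)
        show "integrable M ?t" using w wa by auto
        show "?t x \<le> w x * a x powr P" for x
          using mult_left_mono[OF powr_above_tangent[OF P a0 mu, of x] w0[of x]]
          by (simp add: algebra_simps)
      qed (rule wp)
      also have "integral\<^sup>L M ?t = \<mu> powr P * ?W + P * \<mu> powr (P - 1) * (?I - \<mu> * ?W)"
        using w wa by simp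
      also have "?I - \<mu> * ?W = 0" using W by (simp add: \<mu>_def)
      finally have "\<mu> powr P * ?W \<le> (\<integral>x. w x * a x powr P \<partial>M)" by simp
      then have "?W powr (P - 1) * (\<mu> powr P * ?W) \<le> ?W powr (P - 1) * (\<integral>x. w x * a x powr P \<partial>M)"
        by (intro mult_left_mono) auto
      moreover have "?W powr (P - 1) * (\<mu> powr P * ?W) = ?I powr P"
        using I W by (simp add: \<mu>_def powr_divide powr_diff)
      ultimately have "?I powr P \<le> ?W powr (P - 1) * (\<integral>x. w x * a x powr P \<partial>M)" by simp
      then have "ennreal (?I powr P) \<le> ennreal (?W powr (P - 1)) * ennreal (\<integral>x. w x * a x powr P \<partial>M)"
        by (simp add: ennreal_mult[symmetric] w0 ennreal_leI)
      also have "ennreal (\<integral>x. w x * a x powr P \<partial>M) = (\<integral>\<^sup>+x. ennreal (w x) * ennreal (a x powr P) \<partial>M)"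
        unfolding e using wp by (intro nn_integral_eq_integral[symmetric]) (auto simp: w0)
      finally show ?thesis .
    qed
  qed
qed

lemma sum_powr_le:
  fixes a :: "'i \<Rightarrow> real"
  assumes "finite I" "\<And>i. i \<in> I \<Longrightarrow> 0 \<le> a i" "0 \<le> P"
  shows "(\<Sum>i\<in>I. a i) powr P \<le> real (card I) powr P * (\<Sum>i\<in>I. a i powr P)"
proof (cases "I = {}")
  case False
  define M where "M = Max (a ` I)"
  have "M \<in> a ` I" using assms(1) False by (auto simp: M_def)
  then obtain i where i: "i \<in> I" "M = a i" by auto
  have "(\<Sum>i\<in>I. a i) \<le> real (card I) * M"
    by (rule sum_bounded_above) (use assms(1) in \<open>auto simp: M_def\<close>)
  then have "(\<Sum>i\<in>I. a i) powr P \<le> (real (card I) * M) powr P"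
    by (intro powr_mono2 assms sum_nonneg)
  also have "\<dots> = real (card I) powr P * M powr P"
    by (simp add: powr_mult)
  also have "M powr P \<le> (\<Sum>i\<in>I. a i powr P)"
    unfolding i(2) by (rule member_le_sum) (use i assms in auto)
  finally show ?thesis by (simp add: mult_left_mono)
qed simp

section \<open>Lattice points in balls\<close>

lemma card_int_box:
  fixes S :: "'d::finite \<Rightarrow> int set"
  assumes "\<And>n. finite (S n)" "\<And>n. card (S n) \<le> c"
  shows "finite {k :: int^'d. \<forall>n. k $ n \<in> S n}" "card {k :: int^'d. \<forall>n. k $ n \<in> S n} \<le> c ^ CARD('d)"
proof -
  have eq: "{k :: int^'d. \<forall>n. k $ n \<in> S n} = vec_lambda ` (PiE UNIV S)"
  proof (intro set_eqI iffI)
    fix k :: "int^'d" assume "k \<in> {k. \<forall>n. k $ n \<in> S n}"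
    then show "k \<in> vec_lambda ` (PiE UNIV S)"
      by (intro image_eqI[of _ _ "vec_nth k"]) (auto simp: vec_nth_inverse)
  qed auto
  have fin: "finite (PiE UNIV S)" by (intro finite_PiE assms) auto
  then show "finite {k :: int^'d. \<forall>n. k $ n \<in> S n}" unfolding eq by (rule finite_imageI)
  have "card {k :: int^'d. \<forall>n. k $ n \<in> S n} \<le> card (PiE UNIV S)"
    unfolding eq by (rule card_image_le[OF fin])
  also have "\<dots> = (\<Prod>n\<in>UNIV. card (S n))" by (rule card_PiE) auto
  also have "\<dots> \<le> (\<Prod>n\<in>(UNIV :: 'd set). c)" by (intro prod_mono) (auto simp: assms)
  finally show "card {k :: int^'d. \<forall>n. k $ n \<in> S n} \<le> c ^ CARD('d)" by simp
qed

lemma lattice_points_in_ball: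
  fixes A :: real
  assumes "0 \<le> A"
  shows "finite {k :: int^'d. dist (ivec k) x < A}"
    and "card {k :: int^'d. dist (ivec k) x < A} \<le> (nat (\<lceil>2 * A\<rceil> + 3)) ^ CARD('d)"
proof -
  let ?S = "\<lambda>n. {\<lfloor>x $ n - A\<rfloor>..\<lceil>x $ n + A\<rceil>}"
  have sub: "{k :: int^'d. dist (ivec k) x < A} \<subseteq> {k. \<forall>n. k $ n \<in> ?S n}"
  proof (intro subsetI CollectI allI)
    fix k :: "int^'d" and n assume k: "k \<in> {k. dist (ivec k) x < A}"
    have "\<bar>(ivec k - x) $ n\<bar> \<le> norm (ivec k - x)" by (rule component_le_norm_cart)
    then have "\<bar>real_of_int (k $ n) - x $ n\<bar> < A" using k by (simp add: ivec_def dist_norm)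
    then show "k $ n \<in> ?S n" by (auto simp: abs_less_iff; linarith)
  qed
  have c: "card (?S n) \<le> nat (\<lceil>2 * A\<rceil> + 3)" for n
  proof -
    have "\<lceil>x $ n + A\<rceil> + 1 - \<lfloor>x $ n - A\<rfloor> \<le> \<lceil>2 * A\<rceil> + 3" by linarith
    then show ?thesis by simp
  qed
  show "finite {k :: int^'d. dist (ivec k) x < A}"
    by (rule finite_subset[OF sub]) (rule card_int_box[OF _ c], simp)
  have "card {k :: int^'d. dist (ivec k) x < A} \<le> card {k. \<forall>n. k $ n \<in> ?S n}"
    by (rule card_mono[OF card_int_box(1)[OF _ c] sub]) simp
  also have "\<dots> \<le> (nat (\<lceil>2 * A\<rceil> + 3)) ^ CARD('d)"
    by (rule card_int_box(2)[OF _ c]) simp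
  finally show "card {k :: int^'d. dist (ivec k) x < A} \<le> (nat (\<lceil>2 * A\<rceil> + 3)) ^ CARD('d)" .
qed

section \<open>The lattice estimate\<close>

definition energy :: "real \<Rightarrow> (real^'d) set \<Rightarrow> (real^'d \<Rightarrow> complex) \<Rightarrow> ennreal" where
  "energy P S g = (\<integral>\<^sup>+x\<in>S. ennreal (norm (g x) powr P) \<partial>lborel)"

definition lattice_nbhd :: "(int^'d) set \<Rightarrow> real \<Rightarrow> (real^'d) set" where
  "lattice_nbhd K A = (\<Union>k\<in>K. ball (ivec k) A)"

text \<open>The supremum is taken over the steps only after integration in \<open>x\<close> over all of the neighbourhood, not
separately near each lattice point. This order is what can later be compared with a modulus of
smoothness.\<close>

definition mixed_energy :: "real \<Rightarrow> nat \<Rightarrow> real \<Rightarrow> (int^'d) set \<Rightarrow> (real^'d \<Rightarrow> complex) \<Rightarrow> ennreal" where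
  "mixed_energy P m A K g =
     (SUP hs\<in>{hs. length hs = m \<and> (\<forall>h\<in>set hs. norm h \<le> A)}. energy P (lattice_nbhd K A) (mixed_diff hs g))"

lemma energy_mono: "S \<subseteq> T \<Longrightarrow> energy P S g \<le> energy P T g"
  unfolding energy_def by (intro nn_integral_mono) (auto simp: indicator_def)

lemma lattice_nbhd_borel: "lattice_nbhd K A \<in> sets borel"
  unfolding lattice_nbhd_def by (intro borel_open open_UN) auto

lemma lattice_nbhd_mono: "A \<le> B \<Longrightarrow> lattice_nbhd K A \<subseteq> lattice_nbhd K B"
  by (auto simp: lattice_nbhd_def intro: less_le_trans)

lemma mixed_energy_mono:
  fixes g :: "real^'d \<Rightarrow> complex"
  shows "A \<le> B \<Longrightarrow> mixed_energy P m A K g \<le> mixed_energy P m B K g"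
  unfolding mixed_energy_def
proof (intro SUP_mono)
  fix hs :: "(real^'d) list" assume "A \<le> B" "hs \<in> {hs. length hs = m \<and> (\<forall>h\<in>set hs. norm h \<le> A)}"
  then show "\<exists>hs'\<in>{hs. length hs = m \<and> (\<forall>h\<in>set hs. norm h \<le> B)}.
      energy P (lattice_nbhd K A) (mixed_diff hs g) \<le> energy P (lattice_nbhd K B) (mixed_diff hs' g)"
    by (intro bexI[of _ hs] energy_mono lattice_nbhd_mono) (auto intro: order_trans)
qed

lemma mixed_energy_step:
  fixes h :: "real^'d"
  assumes "norm h \<le> A"
  shows "mixed_energy P m A K (step_diff h g) \<le> mixed_energy P (Suc m) A K g"
  unfolding mixed_energy_def
proof (rule SUP_least)
  fix hs :: "(real^'d) list" assume "hs \<in> {hs. length hs = m \<and> (\<forall>h\<in>set hs. norm h \<le> A)}"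
  with assms have "h # hs \<in> {hs. length hs = Suc m \<and> (\<forall>h\<in>set hs. norm h \<le> A)}" by auto
  then show "energy P (lattice_nbhd K A) (mixed_diff hs (step_diff h g))
    \<le> (SUP hs\<in>{hs. length hs = Suc m \<and> (\<forall>h\<in>set hs. norm h \<le> A)}. energy P (lattice_nbhd K A) (mixed_diff hs g))"
    by (rule SUP_upper2) simp
qed

text \<open>The coefficients of all translates are estimated together, because suprema over the steps taken for
each translate separately do not add up to one supremum over the whole neighbourhood. The constants depend on \<open>u\<close>, not on
\<open>g\<close> and \<open>K\<close>.\<close>

definition lattice_estimate :: "real \<Rightarrow> nat \<Rightarrow> (real^'d \<Rightarrow> complex) \<Rightarrow> real \<Rightarrow> real \<Rightarrow> bool" where
  "lattice_estimate P m u C A \<longleftrightarrow> 0 \<le> C \<and> 0 \<le> A \<and> (\<forall>g K. loc_int g \<longrightarrow> finite K \<longrightarrow>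
     (\<Sum>k\<in>K. ennreal (norm (\<integral>x. g (x + ivec k) * u x \<partial>lborel) powr P))
       \<le> ennreal C * mixed_energy P m A K g)"

text \<open>Jensen's inequality with weight \<open>\<bar>u\<bar>\<close> bounds each coefficient by the energy of \<open>g\<close> on a ball around
its lattice point; a point lies in boundedly many of these balls.\<close>

lemma lattice_bound_zero:
  fixes u :: "real^'d \<Rightarrow> complex"
  assumes P: "1 \<le> P" and u: "test_fun u"
  shows "\<exists>C A. lattice_estimate P 0 u C A"
proof -
  obtain M B where M: "\<And>x. norm (u x) \<le> M" "\<And>x. u x \<noteq> 0 \<Longrightarrow> norm x \<le> B" "0 \<le> M" "0 \<le> B"
    using test_funE[OF u] by metis
  have [measurable]: "u \<in> borel_measurable borel" using u by (rule test_fun_measurable)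
  define A where "A = B + 1"
  \<comment> \<open>a bound for the number of balls of radius \<open>A\<close> around lattice points that contain a given point\<close>
  define N where "N = (nat (\<lceil>2 * A\<rceil> + 3)) ^ CARD('d)"
  define W where "W = (\<integral>x. norm (u x) \<partial>lborel) powr (P - 1)"
  have A0: "0 \<le> A" using M by (simp add: A_def)
  have "(\<Sum>k\<in>K. ennreal (norm (\<integral>x. g (x + ivec k) * u x \<partial>lborel) powr P))
      \<le> ennreal (W * M * real N) * energy P (lattice_nbhd K A) g" if g: "loc_int g" and K: "finite K" for g K
  proof -
    have [measurable]: "g \<in> borel_measurable borel" using g by (rule loc_int_measurable)
    have "ennreal (norm (\<integral>x. g (x + ivec k) * u x \<partial>lborel) powr P)
        \<le> ennreal (W * M) * energy P (ball (ivec k) A) g" for k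
    proof -
      have [measurable]: "ball (ivec k :: real^'d) A \<in> sets borel" by simp
      have "norm (\<integral>x. g (x + ivec k) * u x \<partial>lborel) \<le> (\<integral>x. norm (g (x + ivec k) * u x) \<partial>lborel)"
        by (rule integral_norm_bound)
      also have "\<dots> = (\<integral>x. norm (u x) * norm (g (x + ivec k)) \<partial>lborel)"
        by (simp add: norm_mult mult.commute)
      finally have "ennreal (norm (\<integral>x. g (x + ivec k) * u x \<partial>lborel) powr P)
         \<le> ennreal ((\<integral>x. norm (u x) * norm (g (x + ivec k)) \<partial>lborel) powr P)"
        using P by (intro ennreal_leI powr_mono2) auto
      also have "\<dots> \<le> ennreal W * (\<integral>\<^sup>+x. ennreal (norm (u x)) * ennreal (norm (g (x + ivec k)) powr P) \<partial>lborel)"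
        unfolding W_def by (rule weighted_power_mean[OF P]) (auto intro: integrable_norm test_fun_integrable u)
      also have "(\<integral>\<^sup>+x. ennreal (norm (u x)) * ennreal (norm (g (x + ivec k)) powr P) \<partial>lborel)
        \<le> (\<integral>\<^sup>+x. ennreal M * (ennreal (norm (g (x + ivec k)) powr P) * indicator (ball (ivec k) A) (x + ivec k)) \<partial>lborel)"
      proof (intro nn_integral_mono)
        fix x
        show "ennreal (norm (u x)) * ennreal (norm (g (x + ivec k)) powr P)
          \<le> ennreal M * (ennreal (norm (g (x + ivec k)) powr P) * indicator (ball (ivec k) A) (x + ivec k))"
        proof (cases "u x = 0")
          case False
          then have "x + ivec k \<in> ball (ivec k) A"
            using M(2)[of x] by (simp add: A_def dist_norm)
          then show ?thesis using M(1)[of x] by (auto intro!: mult_right_mono ennreal_leI)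
        qed simp
      qed
      also have "\<dots> = ennreal M * (\<integral>\<^sup>+x. ennreal (norm (g (x + ivec k)) powr P) * indicator (ball (ivec k) A) (x + ivec k) \<partial>lborel)"
        by (rule nn_integral_cmult) measurable
      also have "(\<integral>\<^sup>+x. ennreal (norm (g (x + ivec k)) powr P) * indicator (ball (ivec k) A) (x + ivec k) \<partial>lborel)
        = energy P (ball (ivec k) A) g"
        unfolding energy_def
        by (rule nn_integral_translate[of "\<lambda>x. ennreal (norm (g x) powr P) * indicator (ball (ivec k) A) x"]) measurable
      finally show ?thesis
        using M by (simp add: W_def ennreal_mult mult.assoc mult_left_mono)
    qed
    then have "(\<Sum>k\<in>K. ennreal (norm (\<integral>x. g (x + ivec k) * u x \<partial>lborel) powr P))
       \<le> (\<Sum>k\<in>K. ennreal (W * M) * energy P (ball (ivec k) A) g)"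
      by (intro sum_mono)
    also have "\<dots> = ennreal (W * M) * (\<integral>\<^sup>+x. (\<Sum>k\<in>K. ennreal (norm (g x) powr P) * indicator (ball (ivec k) A) x) \<partial>lborel)"
    proof -
      have "(\<lambda>x. ennreal (norm (g x) powr P) * indicator (ball (ivec k) A) x) \<in> borel_measurable borel" for k
      proof -
        have [measurable]: "ball (ivec k :: real^'d) A \<in> sets borel" by simp
        show ?thesis by measurable
      qed
      then show ?thesis
        unfolding energy_def by (subst nn_integral_sum) (simp_all add: sum_distrib_left)
    qed
    also have "(\<integral>\<^sup>+x. (\<Sum>k\<in>K. ennreal (norm (g x) powr P) * indicator (ball (ivec k) A) x) \<partial>lborel)
       \<le> (\<integral>\<^sup>+x. ennreal (real N) * (ennreal (norm (g x) powr P) * indicator (lattice_nbhd K A) x) \<partial>lborel)"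
    proof (intro nn_integral_mono)
      fix x :: "real^'d"
      have "(\<Sum>k\<in>K. indicator (ball (ivec k) A) x :: ennreal) = of_nat (card {k\<in>K. dist (ivec k) x < A})"
        using K by (simp add: indicator_def sum.If_cases Int_def if_distrib)
      also have "card {k\<in>K. dist (ivec k) x < A} \<le> N"
        using card_mono[OF lattice_points_in_ball(1)[OF A0, of x], of "{k\<in>K. dist (ivec k) x < A}"]
          lattice_points_in_ball(2)[OF A0, of x] unfolding N_def by (auto intro: order_trans)
      finally have 1: "(\<Sum>k\<in>K. indicator (ball (ivec k) A) x :: ennreal) \<le> of_nat N" by simp
      have "(\<Sum>k\<in>K. indicator (ball (ivec k) A) x :: ennreal) = 0" if "x \<notin> lattice_nbhd K A"
        using that by (auto simp: lattice_nbhd_def indicator_def intro!: sum.neutral)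
      with 1 have "(\<Sum>k\<in>K. indicator (ball (ivec k) A) x :: ennreal) \<le> of_nat N * indicator (lattice_nbhd K A) x"
        by (cases "x \<in> lattice_nbhd K A") auto
      then have "ennreal (norm (g x) powr P) * (\<Sum>k\<in>K. indicator (ball (ivec k) A) x)
         \<le> ennreal (norm (g x) powr P) * (of_nat N * indicator (lattice_nbhd K A) x)"
        by (intro mult_left_mono) auto
      then show "(\<Sum>k\<in>K. ennreal (norm (g x) powr P) * indicator (ball (ivec k) A) x)
         \<le> ennreal (real N) * (ennreal (norm (g x) powr P) * indicator (lattice_nbhd K A) x)"
        by (simp add: sum_distrib_left ennreal_of_nat_eq_real_of_nat ac_simps)
    qed
    also have "\<dots> = ennreal (real N) * energy P (lattice_nbhd K A) g"
    proof -
      have [measurable]: "lattice_nbhd K A \<in> sets borel" by (rule lattice_nbhd_borel)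
      show ?thesis unfolding energy_def by (rule nn_integral_cmult) measurable
    qed
    finally show ?thesis
      using M by (simp add: W_def ennreal_mult mult.assoc mult_left_mono)
  qed
  moreover have "0 \<le> W * M * real N" using M by (simp add: W_def)
  ultimately have "lattice_estimate P 0 u (W * M * real N) A"
    using A0 by (simp add: lattice_estimate_def mixed_energy_def)
  then show ?thesis by blast
qed

text \<open>The \<open>P\<close>-th power of \<open>difference_representation\<close>, with the average over \<open>h\<close> pulled out by Jensen's
inequality. It is linear in the powers of the single terms and can therefore be summed over
translates.\<close>

lemma difference_representation_powr:
  fixes u :: "real^'d \<Rightarrow> complex"
  assumes P: "1 \<le> P" and u: "test_fun u" and z: "integral\<^sup>L lborel u = 0" and g: "loc_int g"
  defines "c \<equiv> \<integral>h. mollifier (h :: real^'d) \<partial>lborel"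
  defines "D \<equiv> (1 / c) powr P * 2 powr P * real CARD('d) powr P"
  shows "ennreal (norm (\<integral>x. g x * u x \<partial>lborel) powr P) \<le> ennreal D *
     ((\<Sum>n\<in>UNIV. ennreal (norm (\<integral>x. step_diff (- axis n 1) g x * primitive u n x \<partial>lborel) powr P))
      + ennreal (c powr (P - 1)) *
        (\<integral>\<^sup>+h. ennreal (mollifier h) * ennreal (norm (\<integral>x. step_diff h g x * u x \<partial>lborel) powr P) \<partial>lborel))"
proof -
  have [measurable]: "u \<in> borel_measurable borel" "g \<in> borel_measurable borel"
    using u g by (auto intro: test_fun_measurable loc_int_measurable)
  have c: "0 < c" unfolding c_def by (rule mollifier_integral_pos)
  define J where "J n = (\<integral>x. step_diff (- axis n 1) g x * primitive u n x \<partial>lborel)" for n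
  define F where "F h = (\<integral>x. step_diff h g x * u x \<partial>lborel)" for h
  have [measurable]: "F \<in> borel_measurable borel"
    unfolding F_def step_diff_def by measurable
  let ?I = "\<integral>x. g x * u x \<partial>lborel" and ?H = "\<integral>h. mollifier h * norm (F h) \<partial>lborel"
  have "c * norm ?I = norm (of_real c * ?I)" using c by (simp add: norm_mult)
  also have "\<dots> \<le> norm (\<Sum>n\<in>UNIV. J n) + norm (\<integral>h. of_real (mollifier h) * F h \<partial>lborel)"
    unfolding c_def difference_representation[OF u z g] J_def F_def by (rule norm_triangle_ineq4)
  also have "norm (\<integral>h. of_real (mollifier h) * F h \<partial>lborel) \<le> (\<integral>h. norm (of_real (mollifier h) * F h) \<partial>lborel)"
    by (rule integral_norm_bound)
  also have "\<dots> = ?H" by (simp add: norm_mult mollifier_nonneg)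
  finally have "c * norm ?I \<le> (\<Sum>n\<in>UNIV. norm (J n)) + ?H"
    using norm_sum[of J UNIV] by linarith
  then have "norm ?I \<le> (1 / c) * ((\<Sum>n\<in>UNIV. norm (J n)) + ?H)"
    using c by (simp add: field_simps)
  then have "norm ?I powr P \<le> ((1 / c) * ((\<Sum>n\<in>UNIV. norm (J n)) + ?H)) powr P"
    using P by (intro powr_mono2) auto
  also have "\<dots> = (1 / c) powr P * ((\<Sum>n\<in>UNIV. norm (J n)) + ?H) powr P"
    by (rule powr_mult)
  finally have I: "norm ?I powr P \<le> (1 / c) powr P * ((\<Sum>n\<in>UNIV. norm (J n)) + ?H) powr P" .
  let ?d = "real CARD('d) powr P"
  have "((\<Sum>n\<in>UNIV. norm (J n)) + ?H) powr P \<le> 2 powr P * ((\<Sum>n\<in>UNIV. norm (J n)) powr P + ?H powr P)"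
    using sum_powr_le[of "UNIV :: bool set" "\<lambda>b. if b then (\<Sum>n\<in>UNIV. norm (J n)) else ?H" P] P
    by (simp add: UNIV_bool mollifier_nonneg sum_nonneg add.commute)
  also have "\<dots> \<le> 2 powr P * (?d * (\<Sum>n\<in>UNIV. norm (J n) powr P) + ?d * ?H powr P)"
  proof (intro mult_left_mono add_mono)
    show "(\<Sum>n\<in>UNIV. norm (J n)) powr P \<le> ?d * (\<Sum>n\<in>UNIV. norm (J n) powr P)"
      using P by (intro sum_powr_le) auto
    have "1 \<le> ?d"
      using P by (intro ge_one_powr_ge_zero) (auto simp: Suc_le_eq)
    from mult_right_mono[OF this, of "?H powr P"] show "?H powr P \<le> ?d * ?H powr P" by simp
  qed simp
  finally have "norm ?I powr P \<le> (1 / c) powr P * (2 powr P * (?d * (\<Sum>n\<in>UNIV. norm (J n) powr P) + ?d * ?H powr P))"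
    by (rule order_trans[OF I mult_left_mono]) simp
  also have "\<dots> = D * ((\<Sum>n\<in>UNIV. norm (J n) powr P) + ?H powr P)"
    by (simp only: D_def distrib_left mult.assoc)
  finally have "norm ?I powr P \<le> D * ((\<Sum>n\<in>UNIV. norm (J n) powr P) + ?H powr P)" .
  then have "ennreal (norm ?I powr P) \<le> ennreal D * ((\<Sum>n\<in>UNIV. ennreal (norm (J n) powr P)) + ennreal (?H powr P))"
    by (simp add: ennreal_mult[symmetric] ennreal_plus[symmetric] sum_nonneg D_def ennreal_leI del: ennreal_plus)
  also have "ennreal (?H powr P) \<le> ennreal (c powr (P - 1)) * (\<integral>\<^sup>+h. ennreal (mollifier h) * ennreal (norm (F h) powr P) \<partial>lborel)"
    unfolding c_def by (rule weighted_power_mean[OF P mollifier_integrable]) (auto simp: mollifier_nonneg)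
  finally show ?thesis
    unfolding J_def F_def by (simp add: mult_left_mono add_left_mono)
qed

text \<open>Induction on the order of vanishing. Both kinds of terms in the difference representation are
integrals of a first difference of \<open>g\<close> against a function with one order less: a primitive of \<open>u\<close>,
or \<open>u\<close> itself, of which one order is given up.\<close>

lemma lattice_bound:
  fixes u :: "real^'d \<Rightarrow> complex"
  assumes P: "1 \<le> P"
  shows "test_fun u \<Longrightarrow> vanishing m u \<Longrightarrow> \<exists>C A. lattice_estimate P m u C A"
proof (induction m arbitrary: u)
  case 0
  then show ?case using lattice_bound_zero[OF P] by blast
next
  case (Suc m)
  have z: "integral\<^sup>L lborel u = 0" by (rule vanishing_integral[OF Suc.prems(2)])
  have [measurable]: "u \<in> borel_measurable borel" using Suc.prems(1) by (rule test_fun_measurable)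
  obtain C0 A0 where e0: "lattice_estimate P m u C0 A0"
    using Suc.IH[OF Suc.prems(1) vanishing_mono[OF Suc.prems(2)]] by auto
  have "\<exists>C A. lattice_estimate P m (primitive u n) C A" for n
    by (rule Suc.IH[OF test_fun_primitive vanishing_primitive]) (rule Suc.prems)+
  then obtain C1 A1 where e1: "\<And>n. lattice_estimate P m (primitive u n) (C1 n) (A1 n)"
    by metis
  note C0 = e0[unfolded lattice_estimate_def, THEN conjunct1]
    e0[unfolded lattice_estimate_def, THEN conjunct2, THEN conjunct1]
  note C1 = e1[unfolded lattice_estimate_def, THEN conjunct1]
    e1[unfolded lattice_estimate_def, THEN conjunct2, THEN conjunct1]
  note b0 = e0[unfolded lattice_estimate_def, THEN conjunct2, THEN conjunct2, rule_format]
  note b1 = e1[unfolded lattice_estimate_def, THEN conjunct2, THEN conjunct2, rule_format]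
  \<comment> \<open>large enough for all radii of the induction hypothesis, for the support of the mollifier and for unit steps\<close>
  define A where "A = A0 + (\<Sum>n\<in>UNIV. A1 n) + (real CARD('d) * 2 + 1)"
  have sA: "A1 n \<le> (\<Sum>n\<in>UNIV. A1 n)" for n
    by (rule member_le_sum) (auto simp: C1)
  have s0: "0 \<le> (\<Sum>n\<in>UNIV. A1 n)" by (intro sum_nonneg C1)
  have A: "A0 \<le> A" "real CARD('d) * 2 \<le> A" "1 \<le> A" "0 \<le> A" "A1 n \<le> A" for n
    using C0 sA[of n] s0 unfolding A_def by (simp_all add: add_increasing2) 
  define c where "c = (\<integral>h. mollifier (h :: real^'d) \<partial>lborel)"
  define D where "D = (1 / c) powr P * 2 powr P * real CARD('d) powr P"
  have c: "0 < c" unfolding c_def by (rule mollifier_integral_pos)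
  let ?C = "D * ((\<Sum>n\<in>UNIV. C1 n) + c powr (P - 1) * (c * C0))"
  have "(\<Sum>k\<in>K. ennreal (norm (\<integral>x. g (x + ivec k) * u x \<partial>lborel) powr P)) \<le> ennreal ?C * mixed_energy P (Suc m) A K g"
    if g: "loc_int g" and K: "finite K" for g K
  proof -
    have [measurable]: "g \<in> borel_measurable borel" using g by (rule loc_int_measurable)
    let ?E = "mixed_energy P (Suc m) A K g"
    let ?J = "\<lambda>n k. ennreal (norm (\<integral>x. step_diff (- axis n 1) g (x + ivec k) * primitive u n x \<partial>lborel) powr P)"
    let ?F = "\<lambda>h k. ennreal (norm (\<integral>x. step_diff h g (x + ivec k) * u x \<partial>lborel) powr P)"
    have t: "step_diff h (\<lambda>x. g (x + ivec k)) x = step_diff h g (x + ivec k)" for h k x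
      by (simp add: step_diff_def algebra_simps)
    have Fm [measurable]: "(\<lambda>h. ?F h k) \<in> borel_measurable borel" for k
      unfolding step_diff_def by measurable
    have J: "(\<Sum>k\<in>K. ?J n k) \<le> ennreal (C1 n) * ?E" for n
    proof -
      have "(\<Sum>k\<in>K. ?J n k) \<le> ennreal (C1 n) * mixed_energy P m (A1 n) K (step_diff (- axis n 1) g)"
        by (intro b1 loc_int_step_diff g K)
      also have "mixed_energy P m (A1 n) K (step_diff (- axis n 1) g) \<le> mixed_energy P m A K (step_diff (- axis n 1) g)"
        by (intro mixed_energy_mono A)
      also have "\<dots> \<le> ?E" using A by (intro mixed_energy_step) simp
      finally show ?thesis by (simp add: mult_left_mono)
    qed
    have F: "(\<Sum>k\<in>K. ?F h k) \<le> ennreal C0 * ?E" if h: "mollifier h \<noteq> 0" for h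
    proof -
      have "(\<Sum>k\<in>K. ?F h k) \<le> ennreal C0 * mixed_energy P m A0 K (step_diff h g)"
        by (intro b0 loc_int_step_diff g K)
      also have "mixed_energy P m A0 K (step_diff h g) \<le> mixed_energy P m A K (step_diff h g)"
        by (intro mixed_energy_mono A)
      also have "\<dots> \<le> ?E" using A mollifier_support[OF h] by (intro mixed_energy_step) linarith
      finally show ?thesis by (simp add: mult_left_mono)
    qed
    have "(\<Sum>k\<in>K. \<integral>\<^sup>+h. ennreal (mollifier h) * ?F h k \<partial>lborel) = (\<integral>\<^sup>+h. ennreal (mollifier h) * (\<Sum>k\<in>K. ?F h k) \<partial>lborel)"
      unfolding sum_distrib_left by (rule nn_integral_sum[symmetric]) measurable
    also have "\<dots> \<le> (\<integral>\<^sup>+h. ennreal (mollifier (h :: real^'d)) * (ennreal C0 * ?E) \<partial>lborel)"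
    proof (intro nn_integral_mono)
      fix h show "ennreal (mollifier h) * (\<Sum>k\<in>K. ?F h k) \<le> ennreal (mollifier h) * (ennreal C0 * ?E)"
        using F[of h] by (cases "mollifier h = 0") (auto intro!: mult_left_mono)
    qed
    also have "\<dots> = (\<integral>\<^sup>+h. ennreal (mollifier (h :: real^'d)) \<partial>lborel) * (ennreal C0 * ?E)"
      by (rule nn_integral_multc) measurable
    also have "(\<integral>\<^sup>+h. ennreal (mollifier (h :: real^'d)) \<partial>lborel) = ennreal c"
      unfolding c_def by (rule nn_integral_eq_integral[OF mollifier_integrable]) (simp add: mollifier_nonneg)
    finally have H: "(\<Sum>k\<in>K. \<integral>\<^sup>+h. ennreal (mollifier h) * ?F h k \<partial>lborel) \<le> ennreal c * (ennreal C0 * ?E)" .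
    have "(\<Sum>k\<in>K. ennreal (norm (\<integral>x. g (x + ivec k) * u x \<partial>lborel) powr P))
       \<le> (\<Sum>k\<in>K. ennreal D * ((\<Sum>n\<in>UNIV. ?J n k) + ennreal (c powr (P - 1)) * (\<integral>\<^sup>+h. ennreal (mollifier h) * ?F h k \<partial>lborel)))"
      unfolding D_def c_def t[symmetric]
      by (intro sum_mono difference_representation_powr[OF P Suc.prems(1) z] loc_int_translate g)
    also have "\<dots> = ennreal D * ((\<Sum>n\<in>UNIV. \<Sum>k\<in>K. ?J n k) + ennreal (c powr (P - 1)) * (\<Sum>k\<in>K. \<integral>\<^sup>+h. ennreal (mollifier h) * ?F h k \<partial>lborel))"
      by (subst sum.swap) (simp only: sum_distrib_left[symmetric] sum.distrib)
    also have "\<dots> \<le> ennreal D * ((\<Sum>n\<in>UNIV. ennreal (C1 n) * ?E) + ennreal (c powr (P - 1)) * (ennreal c * (ennreal C0 * ?E)))"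
      by (intro mult_left_mono add_mono sum_mono J H) auto
    also have "\<dots> = ennreal ?C * ?E"
      using C0 C1 c
      by (simp add: D_def ennreal_mult ennreal_plus sum_nonneg sum_distrib_right[symmetric] sum_ennreal
          distrib_left distrib_right mult.assoc)
    finally show ?thesis .
  qed
  moreover have "0 \<le> ?C" using C0 C1 c by (simp add: D_def sum_nonneg)
  ultimately have "lattice_estimate P (Suc m) u ?C A"
    using A(4) by (simp add: lattice_estimate_def)
  then show ?case by blast
qed

section \<open>From mixed differences to differences with one step\<close>

lemma fdiff_measurable [measurable]:
  assumes [measurable]: "g \<in> borel_measurable borel"
  shows "fdiff m h g \<in> borel_measurable borel"
proof (induction m)
  case (Suc m)
  have [measurable]: "fdiff m h g \<in> borel_measurable borel" by (rule Suc)
  have "fdiff (Suc m) h g = (\<lambda>x. fdiff m h g (x + h) - fdiff m h g x)"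
    by (simp add: fdiff_Suc fun_eq_iff)
  also have "\<dots> \<in> borel_measurable borel" by measurable
  finally show ?case .
qed simp

text \<open>By Kemperman's identity a mixed difference is a sum of \<open>2 ^ m\<close> differences with a single step, each
translated by at most \<open>m A\<close>; the larger radius absorbs these translations.\<close>

lemma mixed_energy_le_pure:
  fixes g :: "real^'d \<Rightarrow> complex" and m :: nat
  assumes P: "1 \<le> P" and A: "0 \<le> A" and [measurable]: "g \<in> borel_measurable borel"
  defines "B \<equiv> (real m + 1) * A"
  shows "mixed_energy P m A K g \<le> ennreal ((2 ^ m) powr P * 2 ^ m) *
    (SUP a\<in>{a. norm a \<le> B}. energy P (lattice_nbhd K B) (fdiff m a g))"
  unfolding mixed_energy_def
proof (rule SUP_least)
  fix hs :: "(real^'d) list" assume hs: "hs \<in> {hs. length hs = m \<and> (\<forall>h\<in>set hs. norm h \<le> A)}"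
  let ?S = "SUP a\<in>{a. norm a \<le> B}. energy P (lattice_nbhd K B) (fdiff m a g)"
  define h where "h s = hs ! (s - 1)" for s
  define a where "a S = - (\<Sum>s\<in>S. (1 / real s) *\<^sub>R h s)" for S
  define b where "b S = (\<Sum>s\<in>S. h s)" for S
  have eq: "map h [1..<Suc m] = hs"
    using hs by (intro nth_equalityI) (auto simp: h_def simp del: upt_Suc)
  have hn: "norm (h s) \<le> A" if "s \<in> {1..m}" for s
    using hs that unfolding h_def by (auto intro!: nth_mem)
  have card_le: "real (card S) \<le> real m" and fin: "finite S" if "S \<in> Pow {1..m}" for S
    using that card_mono[of "{1..m}" S] by (auto intro: finite_subset)
  have bn: "norm (b S) \<le> real m * A" if S: "S \<in> Pow {1..m}" for S
  proof -
    have "norm (b S) \<le> real (card S) * A"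
      unfolding b_def by (rule sum_norm_bound) (use S hn in auto)
    also have "\<dots> \<le> real m * A" using card_le[OF S] A by (intro mult_right_mono)
    finally show ?thesis .
  qed
  have an: "norm (a S) \<le> B" if S: "S \<in> Pow {1..m}" for S
  proof -
    have "norm (a S) \<le> real (card S) * A"
      unfolding a_def norm_minus_cancel
    proof (rule sum_norm_bound)
      fix s assume "s \<in> S"
      then have s: "s \<in> {1..m}" using S by auto
      have "norm ((1 / real s) *\<^sub>R h s) = (1 / real s) * norm (h s)" by simp
      also have "\<dots> \<le> 1 * A" using s hn[OF s] by (intro mult_mono) auto
      finally show "norm ((1 / real s) *\<^sub>R h s) \<le> A" by simp
    qed
    also have "\<dots> \<le> (real m + 1) * A" using card_le[OF S] A by (intro mult_right_mono) auto
    finally show ?thesis by (simp add: B_def)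
  qed
  have point: "norm (mixed_diff hs g x) powr P
      \<le> (2 ^ m) powr P * (\<Sum>S\<in>Pow {1..m}. norm (fdiff m (a S) g (x + b S)) powr P)" for x
  proof -
    have "norm (mixed_diff hs g x) = norm (\<Sum>S\<in>Pow {1..m}. (-1) ^ card S * fdiff m (a S) g (x + b S))"
      unfolding eq[symmetric] kemperman a_def b_def ..
    also have "\<dots> \<le> (\<Sum>S\<in>Pow {1..m}. norm ((-1) ^ card S * fdiff m (a S) g (x + b S)))"
      by (rule norm_sum)
    also have "\<dots> = (\<Sum>S\<in>Pow {1..m}. norm (fdiff m (a S) g (x + b S)))"
      by (simp add: norm_mult norm_power)
    finally have "norm (mixed_diff hs g x) powr P \<le> (\<Sum>S\<in>Pow {1..m}. norm (fdiff m (a S) g (x + b S))) powr P"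
      using P by (intro powr_mono2) auto
    also have "\<dots> \<le> real (card (Pow {1..m})) powr P * (\<Sum>S\<in>Pow {1..m}. norm (fdiff m (a S) g (x + b S)) powr P)"
      by (rule sum_powr_le) (use P in auto)
    finally show ?thesis by (simp add: card_Pow)
  qed
  have [measurable]: "lattice_nbhd K T \<in> sets borel" for T by (rule lattice_nbhd_borel)
  have shift: "(\<integral>\<^sup>+x. ennreal (norm (fdiff m (a S) g (x + b S)) powr P) * indicator (lattice_nbhd K A) x \<partial>lborel) \<le> ?S"
    if S: "S \<in> Pow {1..m}" for S
  proof -
    have "(\<integral>\<^sup>+x. ennreal (norm (fdiff m (a S) g (x + b S)) powr P) * indicator (lattice_nbhd K A) x \<partial>lborel)
       \<le> (\<integral>\<^sup>+x. ennreal (norm (fdiff m (a S) g (x + b S)) powr P) * indicator (lattice_nbhd K B) (x + b S) \<partial>lborel)"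
    proof (intro nn_integral_mono mult_left_mono)
      fix x
      have "x + b S \<in> lattice_nbhd K B" if x: "x \<in> lattice_nbhd K A"
      proof -
        obtain k where k: "k \<in> K" "dist (ivec k) x < A" using x by (auto simp: lattice_nbhd_def)
        have "dist (ivec k) (x + b S) \<le> dist (ivec k) x + norm (b S)"
          using dist_triangle[of "ivec k" "x + b S" x] by (simp add: dist_norm)
        also have "\<dots> < A + real m * A" using k(2) bn[OF S] by linarith
        finally show ?thesis using k(1) by (auto simp: lattice_nbhd_def B_def algebra_simps)
      qed
      then show "indicator (lattice_nbhd K A) x \<le> (indicator (lattice_nbhd K B) (x + b S) :: ennreal)"
        by (auto simp: indicator_def)
    qed simp
    also have "\<dots> = energy P (lattice_nbhd K B) (fdiff m (a S) g)"
      unfolding energy_def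
      by (rule nn_integral_translate[of "\<lambda>x. ennreal (norm (fdiff m (a S) g x) powr P) * indicator (lattice_nbhd K B) x"]) measurable
    also have "\<dots> \<le> ?S" using an[OF S] by (intro SUP_upper) auto
    finally show ?thesis .
  qed
  have "energy P (lattice_nbhd K A) (mixed_diff hs g)
     \<le> (\<integral>\<^sup>+x. ennreal ((2 ^ m) powr P) * (\<Sum>S\<in>Pow {1..m}. ennreal (norm (fdiff m (a S) g (x + b S)) powr P) * indicator (lattice_nbhd K A) x) \<partial>lborel)"
    unfolding energy_def
  proof (intro nn_integral_mono)
    fix x
    have "ennreal (norm (mixed_diff hs g x) powr P)
       \<le> ennreal ((2 ^ m) powr P) * (\<Sum>S\<in>Pow {1..m}. ennreal (norm (fdiff m (a S) g (x + b S)) powr P))"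
      using ennreal_leI[OF point[of x]] by (simp add: ennreal_mult sum_nonneg sum_ennreal)
    then show "ennreal (norm (mixed_diff hs g x) powr P) * indicator (lattice_nbhd K A) x
      \<le> ennreal ((2 ^ m) powr P) * (\<Sum>S\<in>Pow {1..m}. ennreal (norm (fdiff m (a S) g (x + b S)) powr P) * indicator (lattice_nbhd K A) x)"
      by (auto simp: indicator_def)
  qed
  also have "\<dots> = ennreal ((2 ^ m) powr P) * (\<Sum>S\<in>Pow {1..m}. (\<integral>\<^sup>+x. ennreal (norm (fdiff m (a S) g (x + b S)) powr P) * indicator (lattice_nbhd K A) x \<partial>lborel))"
  proof -
    have mS: "(\<lambda>x. ennreal (norm (fdiff m (a S) g (x + b S)) powr P) * indicator (lattice_nbhd K A) x)
        \<in> borel_measurable lborel" for S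
      by measurable
    have "(\<integral>\<^sup>+x. (\<Sum>S\<in>Pow {1..m}. ennreal (norm (fdiff m (a S) g (x + b S)) powr P) * indicator (lattice_nbhd K A) x) \<partial>lborel)
      = (\<Sum>S\<in>Pow {1..m}. (\<integral>\<^sup>+x. ennreal (norm (fdiff m (a S) g (x + b S)) powr P) * indicator (lattice_nbhd K A) x \<partial>lborel))"
      by (rule nn_integral_sum[OF mS])
    then show ?thesis
      by (subst nn_integral_cmult[OF borel_measurable_sum[OF mS]]) (rule arg_cong)
  qed
  also have "\<dots> \<le> ennreal ((2 ^ m) powr P) * (\<Sum>S\<in>Pow {1..m}. ?S)"
    by (intro mult_left_mono sum_mono shift) auto
  also have "\<dots> = ennreal ((2 ^ m) powr P * 2 ^ m) * ?S"
    using ennreal_power[of 2 m] by (simp add: card_Pow ennreal_mult mult.assoc)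
  finally show "energy P (lattice_nbhd K A) (mixed_diff hs g) \<le> ennreal ((2 ^ m) powr P * 2 ^ m) * ?S" .
qed

section \<open>Rescaling to dyadic level\<close>

lemma nn_integral_rescale:
  fixes F :: "real^'d \<Rightarrow> ennreal"
  assumes [measurable]: "F \<in> borel_measurable borel" and r: "0 < r"
  shows "(\<integral>\<^sup>+x. F ((1 / r) *\<^sub>R x) \<partial>lborel) = ennreal (r ^ CARD('d)) * (\<integral>\<^sup>+x. F x \<partial>lborel)"
proof -
  have "(\<integral>\<^sup>+x. F ((1 / r) *\<^sub>R x) \<partial>lborel)
     = (\<integral>\<^sup>+x. F ((1 / r) *\<^sub>R x) \<partial>density (distr lborel borel (\<lambda>x::real^'d. 0 + r *\<^sub>R x)) (\<lambda>_. ennreal (\<bar>r\<bar> ^ DIM(real^'d))))"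
    using lborel_affine[of r "0 :: real^'d"] r by simp
  also have "\<dots> = ennreal (r ^ CARD('d)) * (\<integral>\<^sup>+x. F x \<partial>lborel)"
    using r by (simp add: nn_integral_density nn_integral_distr nn_integral_cmult)
  finally show ?thesis .
qed

lemma lborel_integral_rescale:
  fixes F :: "real^'d \<Rightarrow> complex"
  assumes [measurable]: "F \<in> borel_measurable borel" and r: "0 < r"
  shows "(\<integral>x. F ((1 / r) *\<^sub>R x) \<partial>lborel) = of_real (r ^ CARD('d)) * (\<integral>x. F x \<partial>lborel)"
proof -
  have "(\<integral>x. F ((1 / r) *\<^sub>R x) \<partial>lborel)
     = (\<integral>x. F ((1 / r) *\<^sub>R x) \<partial>density (distr lborel borel (\<lambda>x::real^'d. 0 + r *\<^sub>R x)) (\<lambda>_. ennreal (\<bar>r\<bar> ^ DIM(real^'d))))"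
    using lborel_affine[of r "0 :: real^'d"] r by simp
  also have "\<dots> = (r ^ CARD('d)) *\<^sub>R (\<integral>x. F x \<partial>lborel)"
    using r by (simp add: integral_density integral_distr)
  finally show ?thesis by (simp only: scaleR_conv_of_real)
qed

lemma loc_int_iff_nn_integral:
  "loc_int g \<longleftrightarrow> g \<in> borel_measurable borel \<and>
     (\<forall>r. (\<integral>\<^sup>+x\<in>cball 0 r. ennreal (norm (g x)) \<partial>lborel) < \<infinity>)"
proof -
  have "set_integrable lborel (cball 0 r) g \<longleftrightarrow> (\<integral>\<^sup>+x\<in>cball 0 r. ennreal (norm (g x)) \<partial>lborel) < \<infinity>"
    if [measurable]: "g \<in> borel_measurable borel" for r
  proof -
    have [measurable]: "cball (0::'a) r \<in> sets borel" by simp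
    have "(\<integral>\<^sup>+x. ennreal (norm (indicator (cball 0 r) x *\<^sub>R g x)) \<partial>lborel) = (\<integral>\<^sup>+x\<in>cball 0 r. ennreal (norm (g x)) \<partial>lborel)"
      by (intro nn_integral_cong) (auto simp: indicator_def)
    then show ?thesis
      unfolding set_integrable_def integrable_iff_bounded by simp
  qed
  then show ?thesis by (auto simp: loc_int_def)
qed

lemma loc_int_rescale:
  fixes f :: "real^'d \<Rightarrow> complex"
  assumes f: "loc_int f" and r: "0 < r"
  shows "loc_int (\<lambda>y. f ((1 / r) *\<^sub>R y))"
proof -
  have [measurable]: "f \<in> borel_measurable borel" using f by (rule loc_int_measurable)
  have "(\<integral>\<^sup>+y\<in>cball 0 R. ennreal (norm (f ((1 / r) *\<^sub>R y))) \<partial>lborel) < \<infinity>" for R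
  proof -
    have [measurable]: "cball (0::real^'d) (R / r) \<in> sets borel" by simp
    have "(\<integral>\<^sup>+y\<in>cball 0 R. ennreal (norm (f ((1 / r) *\<^sub>R y))) \<partial>lborel)
      = (\<integral>\<^sup>+y. (\<lambda>x. ennreal (norm (f x)) * indicator (cball 0 (R / r)) x) ((1 / r) *\<^sub>R y) \<partial>lborel)"
      using r by (intro nn_integral_cong) (auto simp: indicator_def field_simps)
    also have "\<dots> = ennreal (r ^ CARD('d)) * (\<integral>\<^sup>+x\<in>cball 0 (R / r). ennreal (norm (f x)) \<partial>lborel)"
      by (rule nn_integral_rescale[OF _ r]) measurable
    also have "\<dots> < \<infinity>"
      using f unfolding loc_int_iff_nn_integral by (simp add: ennreal_mult_less_top)
    finally show ?thesis .
  qed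
  then show ?thesis by (simp add: loc_int_iff_nn_integral)
qed

lemma fdiff_rescale: "fdiff m a (\<lambda>y. f (c *\<^sub>R y)) x = fdiff m (c *\<^sub>R a) f (c *\<^sub>R x)"
  by (induction m arbitrary: x) (simp_all add: fdiff_Suc scaleR_add_right)

definition dyadic_nbhd :: "nat \<Rightarrow> (int^'d) set \<Rightarrow> real \<Rightarrow> (real^'d) set" where
  "dyadic_nbhd j K A = (\<Union>k\<in>K. ball ((1 / 2 ^ j) *\<^sub>R ivec k) (A / 2 ^ j))"

lemma energy_rescale:
  fixes f :: "real^'d \<Rightarrow> complex"
  assumes [measurable]: "f \<in> borel_measurable borel"
  shows "energy P (lattice_nbhd K A) (fdiff m a (\<lambda>y. f ((1 / 2 ^ j) *\<^sub>R y)))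
    = ennreal (2 ^ (CARD('d) * j)) * energy P (dyadic_nbhd j K A) (fdiff m ((1 / 2 ^ j) *\<^sub>R a) f)"
proof -
  have [measurable]: "dyadic_nbhd j K A \<in> sets borel"
    unfolding dyadic_nbhd_def by (intro borel_open open_UN) auto
  have mem: "x \<in> lattice_nbhd K A \<longleftrightarrow> (1 / 2 ^ j) *\<^sub>R x \<in> dyadic_nbhd j K A" for x
  proof -
    have "dist ((1 / 2 ^ j) *\<^sub>R ivec k) ((1 / 2 ^ j) *\<^sub>R x) = dist (ivec k) x / 2 ^ j" for k
      by (simp add: dist_norm scaleR_diff_right[symmetric])
    then show ?thesis by (auto simp: lattice_nbhd_def dyadic_nbhd_def divide_less_cancel)
  qed
  have "energy P (lattice_nbhd K A) (fdiff m a (\<lambda>y. f ((1 / 2 ^ j) *\<^sub>R y)))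
    = (\<integral>\<^sup>+x. (\<lambda>x. ennreal (norm (fdiff m ((1 / 2 ^ j) *\<^sub>R a) f x) powr P) * indicator (dyadic_nbhd j K A) x) ((1 / 2 ^ j) *\<^sub>R x) \<partial>lborel)"
    unfolding energy_def by (intro nn_integral_cong) (simp add: fdiff_rescale mem indicator_def)
  also have "\<dots> = ennreal ((2 ^ j) ^ CARD('d)) * energy P (dyadic_nbhd j K A) (fdiff m ((1 / 2 ^ j) *\<^sub>R a) f)"
    unfolding energy_def by (rule nn_integral_rescale) auto
  finally show ?thesis by (simp add: power_mult[symmetric] mult.commute)
qed

text \<open>The factor \<open>2 ^ (d j)\<close> on the right is the Jacobian of the dilation to unit scale. It is cancelled by the normalisation \<open>2 ^ ((j - j') d / p)\<close> in the leaders.\<close>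

definition coefficient_estimate :: "real \<Rightarrow> nat \<Rightarrow> (real^'d \<Rightarrow> complex) \<Rightarrow> real \<Rightarrow> real \<Rightarrow> bool" where
  "coefficient_estimate P m u C A \<longleftrightarrow> 0 \<le> C \<and> 0 \<le> A \<and> (\<forall>f j K. loc_int f \<longrightarrow> finite K \<longrightarrow>
     (\<Sum>k\<in>K. ennreal (norm (2 ^ (CARD('d) * j) * (\<integral>x. f x * u (2 ^ j *\<^sub>R x - ivec k) \<partial>lborel)) powr P))
     \<le> ennreal (C * 2 ^ (CARD('d) * j)) *
        (SUP a\<in>{a. norm a \<le> A / 2 ^ j}. energy P (dyadic_nbhd j K A) (fdiff m a f)))"

text \<open>Apply the lattice estimate to \<open>y \<mapsto> f (y / 2 ^ j)\<close>. Dilation turns steps of size \<open>A\<close> into steps of size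
\<open>A / 2 ^ j\<close>, so that the order of the differences is not affected.\<close>

lemma dyadic_coefficient_bound:
  fixes u :: "real^'d \<Rightarrow> complex"
  assumes P: "1 \<le> P" and u: "test_fun u" and v: "vanishing m u"
  shows "\<exists>C A. coefficient_estimate P m u C A"
proof -
  obtain C A where e: "lattice_estimate P m u C A" using lattice_bound[OF P u v] by blast
  then have C: "0 \<le> C" and A: "0 \<le> A" by (simp_all add: lattice_estimate_def)
  have [measurable]: "u \<in> borel_measurable borel" using u by (rule test_fun_measurable)
  define D where "D = (2 ^ m) powr P * (2 ^ m :: real)"
  define B where "B = (real m + 1) * A"
  have D: "0 \<le> D" by (simp add: D_def)
  have "coefficient_estimate P m u (C * D) B"
    unfolding coefficient_estimate_def
  proof (intro conjI allI impI)
    fix f :: "real^'d \<Rightarrow> complex" and j and K :: "(int^'d) set"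
    assume f: "loc_int f" and K: "finite K"
    have [measurable]: "f \<in> borel_measurable borel" using f by (rule loc_int_measurable)
    define g where "g y = f ((1 / 2 ^ j) *\<^sub>R y)" for y
    have g: "loc_int g" unfolding g_def by (rule loc_int_rescale[OF f]) simp
    have [measurable]: "g \<in> borel_measurable borel" using g by (rule loc_int_measurable)
    let ?S = "SUP a\<in>{a. norm a \<le> B / 2 ^ j}. energy P (dyadic_nbhd j K B) (fdiff m a f)"
    have c: "2 ^ (CARD('d) * j) * (\<integral>x. f x * u (2 ^ j *\<^sub>R x - ivec k) \<partial>lborel) = (\<integral>x. g (x + ivec k) * u x \<partial>lborel)" for k
    proof -
      have "(\<integral>x. g (x + ivec k) * u x \<partial>lborel) = (\<integral>y. g y * u (y - ivec k) \<partial>lborel)"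
        using lborel_integral_translate[of "\<lambda>y. g y * u (y - ivec k)" "ivec k"] by simp
      also have "\<dots> = (\<integral>y. (\<lambda>x. f x * u (2 ^ j *\<^sub>R x - ivec k)) ((1 / 2 ^ j) *\<^sub>R y) \<partial>lborel)"
        by (simp add: g_def)
      also have "\<dots> = of_real ((2 ^ j) ^ CARD('d)) * (\<integral>x. f x * u (2 ^ j *\<^sub>R x - ivec k) \<partial>lborel)"
        by (rule lborel_integral_rescale) auto
      finally show ?thesis by (simp add: power_mult[symmetric] mult.commute[of j])
    qed
    have "(\<Sum>k\<in>K. ennreal (norm (\<integral>x. g (x + ivec k) * u x \<partial>lborel) powr P)) \<le> ennreal C * mixed_energy P m A K g"
      using e g K by (simp add: lattice_estimate_def)
    also have "\<dots> \<le> ennreal C * (ennreal D * (SUP a\<in>{a. norm a \<le> B}. energy P (lattice_nbhd K B) (fdiff m a g)))"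
      unfolding D_def B_def by (intro mult_left_mono mixed_energy_le_pure P A) auto
    also have "(SUP a\<in>{a. norm a \<le> B}. energy P (lattice_nbhd K B) (fdiff m a g)) \<le> ennreal (2 ^ (CARD('d) * j)) * ?S"
    proof (rule SUP_least)
      fix a :: "real^'d" assume a: "a \<in> {a. norm a \<le> B}"
      have "energy P (lattice_nbhd K B) (fdiff m a g)
         = ennreal (2 ^ (CARD('d) * j)) * energy P (dyadic_nbhd j K B) (fdiff m ((1 / 2 ^ j) *\<^sub>R a) f)"
        unfolding g_def by (rule energy_rescale) measurable
      also have "\<dots> \<le> ennreal (2 ^ (CARD('d) * j)) * ?S"
        using a by (intro mult_left_mono SUP_upper) (auto simp: divide_right_mono)
      finally show "energy P (lattice_nbhd K B) (fdiff m a g) \<le> \<dots>" .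
    qed
    finally show "(\<Sum>k\<in>K. ennreal (norm (2 ^ (CARD('d) * j) * (\<integral>x. f x * u (2 ^ j *\<^sub>R x - ivec k) \<partial>lborel)) powr P))
      \<le> ennreal (C * D * 2 ^ (CARD('d) * j)) * ?S"
      unfolding c using C D by (simp add: ennreal_mult mult.assoc mult_left_mono)
  qed (use C D A in \<open>auto simp: B_def\<close>)
  then show ?thesis by blast
qed

section \<open>Dyadic cubes around a point\<close>

lemma cube_dist:
  fixes a :: "real^'d"
  assumes "x \<in> cube a s" "y \<in> cube a s"
  shows "dist x y \<le> real CARD('d) * s"
  unfolding dist_norm
proof (rule norm_le_of_components)
  fix n
  from assms have "a $ n \<le> x $ n" "x $ n < a $ n + s" "a $ n \<le> y $ n" "y $ n < a $ n + s"
    by (auto simp: cube_def)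
  then show "\<bar>(x - y) $ n\<bar> \<le> s" by simp
qed

lemma mem_dyadic_cube_iff:
  "x \<in> cube ((1 / 2 ^ j) *\<^sub>R ivec k) (1 / 2 ^ j) \<longleftrightarrow> (\<forall>n. k $ n = \<lfloor>2 ^ j * x $ n\<rfloor>)"
proof -
  have "real_of_int l / 2 ^ j \<le> t \<and> t < real_of_int l / 2 ^ j + 1 / 2 ^ j \<longleftrightarrow> l = \<lfloor>2 ^ j * t\<rfloor>" for l t
  proof -
    have "real_of_int l / 2 ^ j \<le> t \<and> t < real_of_int l / 2 ^ j + 1 / 2 ^ j
       \<longleftrightarrow> real_of_int l \<le> 2 ^ j * t \<and> 2 ^ j * t < real_of_int l + 1"
      by (simp add: add_divide_distrib[symmetric] pos_divide_le_eq pos_less_divide_eq mult.commute)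
    also have "\<dots> \<longleftrightarrow> l = \<lfloor>2 ^ j * t\<rfloor>" by (auto simp: floor_eq_iff intro: floor_unique[symmetric])
    finally show ?thesis .
  qed
  then show ?thesis by (simp add: cube_def ivec_def)
qed

lemma cube_at_dyadic: "cube_at j x0 \<in> dyadic_cubes j" "x0 \<in> cube_at j x0"
proof -
  let ?k = "\<chi> n. \<lfloor>2 ^ j * x0 $ n\<rfloor>"
  have "cube_at j x0 \<in> dyadic_cubes j \<and> x0 \<in> cube_at j x0"
    unfolding cube_at_def
  proof (rule theI)
    show "cube ((1 / 2 ^ j) *\<^sub>R ivec ?k) (1 / 2 ^ j) \<in> dyadic_cubes j \<and> x0 \<in> cube ((1 / 2 ^ j) *\<^sub>R ivec ?k) (1 / 2 ^ j)"
      by (auto simp: dyadic_cubes_def mem_dyadic_cube_iff)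
    fix c assume c: "c \<in> dyadic_cubes j \<and> x0 \<in> c"
    then obtain k where k: "c = cube ((1 / 2 ^ j) *\<^sub>R ivec k) (1 / 2 ^ j)" by (auto simp: dyadic_cubes_def)
    with c have "k = ?k" by (auto simp: mem_dyadic_cube_iff vec_eq_iff)
    with k show "c = cube ((1 / 2 ^ j) *\<^sub>R ivec ?k) (1 / 2 ^ j)" by simp
  qed
  then show "cube_at j x0 \<in> dyadic_cubes j" "x0 \<in> cube_at j x0" by auto
qed

lemma dyadic_cube_dist:
  fixes c :: "(real^'d) set"
  assumes "c \<in> dyadic_cubes j" "x \<in> c" "y \<in> c"
  shows "dist x y \<le> real CARD('d) / 2 ^ j"
  using assms cube_dist[of x _ "1 / 2 ^ j" y] by (auto simp: dyadic_cubes_def)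

lemma dyadic_cube_nonempty: "c \<in> dyadic_cubes j \<Longrightarrow> c \<noteq> {}"
proof -
  assume "c \<in> dyadic_cubes j"
  then obtain k where "c = cube ((1 / 2 ^ j) *\<^sub>R ivec k) (1 / 2 ^ j)" by (auto simp: dyadic_cubes_def)
  then have "(1 / 2 ^ j) *\<^sub>R ivec k \<in> c" by (simp add: cube_def)
  then show ?thesis by auto
qed

lemma neighbour_cube_dist:
  fixes x0 :: "real^'d"
  assumes c: "c \<in> neighbour_cubes j x0" and x: "x \<in> c"
  shows "dist x x0 \<le> (2 * real CARD('d) + 1) / 2 ^ j"
proof -
  have c': "c \<in> dyadic_cubes j" and z: "setdist c (cube_at j x0) = 0"
    using c by (auto simp: neighbour_cubes_def)
  obtain a b where ab: "a \<in> c" "b \<in> cube_at j x0" "dist a b < 1 / 2 ^ j"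
  proof (rule setdist_ltE)
    show "setdist c (cube_at j x0) < 1 / 2 ^ j" using z by simp
  qed (use dyadic_cube_nonempty[OF c'] dyadic_cube_nonempty[OF cube_at_dyadic(1)] in auto)
  have "dist x x0 \<le> dist x a + dist a b + dist b x0"
    using dist_triangle[of x x0 a] dist_triangle[of a x0 b] by linarith
  also have "\<dots> \<le> real CARD('d) / 2 ^ j + 1 / 2 ^ j + real CARD('d) / 2 ^ j"
    using dyadic_cube_dist[OF c' x ab(1)] dyadic_cube_dist[OF cube_at_dyadic(1) ab(2) cube_at_dyadic(2)] ab(3)
    by linarith
  finally show ?thesis by (simp add: add_divide_distrib)
qed

text \<open>The corner of \<open>wcube i j' k\<close> lies in \<open>c\<close>, so \<open>neighbour_cube_dist\<close> applies to it, and the type \<open>i\<close>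
displaces it from the centre \<open>k / 2 ^ j'\<close> by at most \<open>d / 2 ^ j\<close>.\<close>

lemma wavelet_centre_dist:
  fixes x0 :: "real^'d"
  assumes c: "c \<in> neighbour_cubes j x0" and i: "i \<in> wtypes" and k: "wcube i j' k \<subseteq> c" and j: "j \<le> j'"
  shows "dist ((1 / 2 ^ j') *\<^sub>R ivec k) x0 \<le> (3 * real CARD('d) + 1) / 2 ^ j"
proof -
  let ?z = "(1 / 2 ^ (j' + 1)) *\<^sub>R ivec i + (1 / 2 ^ j') *\<^sub>R ivec k :: real^'d"
  have "?z \<in> wcube i j' k" by (simp add: wcube_def cube_def)
  then have 1: "dist ?z x0 \<le> (2 * real CARD('d) + 1) / 2 ^ j"
    using neighbour_cube_dist[OF c] k by blast
  have "norm (ivec i :: real^'d) \<le> real CARD('d) * 1"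
  proof (rule norm_le_of_components)
    fix n show "\<bar>(ivec i :: real^'d) $ n\<bar> \<le> 1"
      using i by (cases "i $ n = 0") (auto simp: wtypes_def ivec_def)
  qed
  then have "norm ((1 / 2 ^ (j' + 1)) *\<^sub>R (ivec i :: real^'d)) \<le> (1 / 2 ^ (j' + 1)) * real CARD('d)"
    by (simp add: divide_right_mono)
  also have "\<dots> \<le> (1 / 2 ^ j) * real CARD('d)"
    using j by (intro mult_right_mono divide_left_mono power_increasing) auto
  finally have 2: "dist ((1 / 2 ^ j') *\<^sub>R ivec k) ?z \<le> real CARD('d) / 2 ^ j"
    by (simp add: dist_norm)
  have "dist ((1 / 2 ^ j') *\<^sub>R ivec k) x0 \<le> dist ((1 / 2 ^ j') *\<^sub>R ivec k) ?z + dist ?z x0"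
    by (rule dist_triangle)
  also have "\<dots> \<le> real CARD('d) / 2 ^ j + (2 * real CARD('d) + 1) / 2 ^ j"
    using 1 2 by (rule add_mono[rotated])
  finally show ?thesis by (simp add: add_divide_distrib)
qed

lemma finite_wtypes: "finite (wtypes :: (int^'d) set)"
  by (rule finite_subset[OF _ card_int_box(1)[of "\<lambda>_. {0, 1}" 2]]) (auto simp: wtypes_def)

lemma finite_wavelets_in_cube:
  fixes x0 :: "real^'d"
  assumes c: "c \<in> neighbour_cubes j x0" and i: "i \<in> wtypes" and j: "j \<le> j'"
  shows "finite {k. wcube i j' k \<subseteq> c}"
proof (rule finite_subset)
  let ?r = "(3 * real CARD('d) + 1) / 2 ^ j * 2 ^ j' + 1"
  show "finite {k :: int^'d. dist (ivec k) (2 ^ j' *\<^sub>R x0) < ?r}"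
    by (rule lattice_points_in_ball) simp
  show "{k. wcube i j' k \<subseteq> c} \<subseteq> {k. dist (ivec k) (2 ^ j' *\<^sub>R x0) < ?r}"
  proof clarify
    fix k assume k: "wcube i j' k \<subseteq> c"
    have "ivec k - 2 ^ j' *\<^sub>R x0 = 2 ^ j' *\<^sub>R ((1 / 2 ^ j') *\<^sub>R ivec k - x0)"
      by (simp add: scaleR_diff_right)
    then have "dist (ivec k) (2 ^ j' *\<^sub>R x0) = 2 ^ j' * dist ((1 / 2 ^ j') *\<^sub>R ivec k) x0"
      by (simp only: dist_norm norm_scaleR) simp
    also have "\<dots> \<le> 2 ^ j' * ((3 * real CARD('d) + 1) / 2 ^ j)"
      by (intro mult_left_mono wavelet_centre_dist[OF c i k j]) simp
    finally show "dist (ivec k) (2 ^ j' *\<^sub>R x0) < ?r" by (simp add: mult.commute)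
  qed
qed

lemma ball_shift_eq: "ball_shift m h x0 r = {x. x \<in> ball x0 r \<and> x + real m *\<^sub>R h \<in> ball x0 r}"
proof -
  have "closed_segment x (x + real m *\<^sub>R h) \<subseteq> ball x0 r \<longleftrightarrow> x \<in> ball x0 r \<and> x + real m *\<^sub>R h \<in> ball x0 r" for x
    using closed_segment_subset[OF _ _ convex_ball, of x x0 r "x + real m *\<^sub>R h"]
      subsetD[OF _ ends_in_segment(1)] subsetD[OF _ ends_in_segment(2)] by blast
  then show ?thesis by (simp only: ball_shift_def)
qed

lemma ball_shift_borel: "ball_shift m h x0 r \<in> sets borel"
proof -
  have "open (ball x0 r \<inter> (\<lambda>x. x + real m *\<^sub>R h) -` ball x0 r)"
    by (intro open_Int open_vimage continuous_intros) auto
  moreover have "ball_shift m h x0 r = ball x0 r \<inter> (\<lambda>x. x + real m *\<^sub>R h) -` ball x0 r"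
    by (auto simp: ball_shift_eq)
  ultimately show ?thesis by simp
qed

lemma ball_shift_0: "ball_shift 0 h x0 r = ball x0 r"
  by (auto simp: ball_shift_eq)

text \<open>The distances at level \<open>j'\<close> are dominated by those at level \<open>j\<close>, so one \<open>N\<close> serves for all \<open>j' \<ge> j\<close>.
This uniformity is what allows the supremum over \<open>j'\<close> in the leader.\<close>

lemma wavelet_support_in_ball_shift:
  fixes x0 :: "real^'d" and A :: real
  assumes A: "0 \<le> A"
  obtains N where "A \<le> 2 ^ N"
    "\<And>j j' i k c h. j \<le> j' \<Longrightarrow> c \<in> neighbour_cubes j x0 \<Longrightarrow> i \<in> wtypes \<Longrightarrow> wcube i j' k \<subseteq> c \<Longrightarrow>
      norm h \<le> A / 2 ^ j' \<Longrightarrow> ball ((1 / 2 ^ j') *\<^sub>R ivec k) (A / 2 ^ j') \<subseteq> ball_shift m h x0 (2 ^ N / 2 ^ j)"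
proof -
  \<comment> \<open>distance to the centre of the wavelet, radius of its neighbourhood, and length of the segment of the difference\<close>
  let ?R = "3 * real CARD('d) + 1 + A + real m * A"
  obtain N where N: "?R < 2 ^ N" using real_arch_pow[of 2 ?R] by auto
  show thesis
  proof (rule that)
    show "A \<le> 2 ^ N" 
    proof -
      have "0 \<le> real m * A" using A by simp
      then show ?thesis using N by linarith
    qed
    fix j j' :: nat and i k :: "int^'d" and c :: "(real^'d) set" and h :: "real^'d"
    assume j: "j \<le> j'" and c: "c \<in> neighbour_cubes j x0" and i: "i \<in> wtypes"
      and k: "wcube i j' k \<subseteq> c" and h: "norm h \<le> A / 2 ^ j'"
    have Aj: "A / 2 ^ j' \<le> A / 2 ^ j"
      using A j by (intro divide_left_mono power_increasing) auto
    show "ball ((1 / 2 ^ j') *\<^sub>R ivec k) (A / 2 ^ j') \<subseteq> ball_shift m h x0 (2 ^ N / 2 ^ j)"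
    proof
      fix x :: "real^'d" assume x: "x \<in> ball ((1 / 2 ^ j') *\<^sub>R ivec k) (A / 2 ^ j')"
      have "dist x0 x \<le> dist ((1 / 2 ^ j') *\<^sub>R ivec k) x0 + dist ((1 / 2 ^ j') *\<^sub>R ivec k) x"
        by (metis dist_commute dist_triangle)
      also have "\<dots> \<le> (3 * real CARD('d) + 1) / 2 ^ j + A / 2 ^ j"
        using wavelet_centre_dist[OF c i k j] x Aj by (intro add_mono) auto
      finally have 1: "dist x0 x \<le> (3 * real CARD('d) + 1) / 2 ^ j + A / 2 ^ j" .
      have "norm (real m *\<^sub>R h) \<le> real m * (A / 2 ^ j)"
        unfolding norm_scaleR using h Aj by (intro mult_mono) auto
      then have "dist x0 (x + real m *\<^sub>R h) \<le> dist x0 x + real m * (A / 2 ^ j)"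
        using dist_triangle[of x0 "x + real m *\<^sub>R h" x] by (simp add: dist_norm)
      with 1 have 2: "dist x0 (x + real m *\<^sub>R h) \<le> (3 * real CARD('d) + 1) / 2 ^ j + A / 2 ^ j + real m * (A / 2 ^ j)"
        by linarith
      have "(3 * real CARD('d) + 1) / 2 ^ j + A / 2 ^ j + real m * (A / 2 ^ j) = ?R / 2 ^ j"
        by (simp add: add_divide_distrib)
      also have "\<dots> < 2 ^ N / 2 ^ j" using N by (simp add: divide_strict_right_mono)
      finally have 3: "(3 * real CARD('d) + 1) / 2 ^ j + A / 2 ^ j + real m * (A / 2 ^ j) < 2 ^ N / 2 ^ j" .
      have "0 \<le> real m * (A / 2 ^ j)" using A by simp
      with 1 2 3 show "x \<in> ball_shift m h x0 (2 ^ N / 2 ^ j)"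
        by (simp add: ball_shift_eq)
    qed
  qed
qed

section \<open>The Lebesgue norms\<close>

lemma epow_top [simp]: "epow \<infinity> a = \<infinity>" and epow_top' [simp]: "epow top a = top"
  by (simp_all add: epow_def infinity_ennreal_def)

lemma epow_ennreal [simp]: "0 \<le> x \<Longrightarrow> epow (ennreal x) a = ennreal (x powr a)"
  by (simp add: epow_def)

lemma epow_eq_top_iff: "epow x a = \<infinity> \<longleftrightarrow> x = \<infinity>"
  by (simp add: epow_def)

lemma epow_less_top_iff: "epow x a < \<infinity> \<longleftrightarrow> x < \<infinity>"
  using epow_eq_top_iff[of x a] by (simp add: less_top[symmetric])

lemma epow_mono: "x \<le> y \<Longrightarrow> 0 \<le> a \<Longrightarrow> epow x a \<le> epow y a"
  by (cases x; cases y) (auto simp: top_unique intro!: ennreal_leI powr_mono2)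

lemma epow_mult: "0 < a \<Longrightarrow> epow (x * y) a = epow x a * epow y a"
proof -
  assume a: "0 < a"
  have z: "epow z a = 0 \<longleftrightarrow> z = 0" for z
    using a by (cases z) (auto simp: epow_def)
  show ?thesis
  proof (cases x; cases y)
    fix r s assume "x = ennreal r" "0 \<le> r" "y = ennreal s" "0 \<le> s"
    then show ?thesis by (simp add: ennreal_mult[symmetric] powr_mult)
  qed (use z[of x] z[of y] z[of 0] in \<open>auto simp: ennreal_mult_top ennreal_top_mult ennreal_mult_eq_top_iff\<close>)
qed

lemma epow_epow: "epow (epow x a) b = epow x (a * b)"
  by (cases x) (simp_all add: powr_powr)

lemma epow_one [simp]: "epow x 1 = x"
  by (cases x) simp_all

lemma epow_root_power: "P \<noteq> 0 \<Longrightarrow> epow (epow x P) (1 / P) = x" "P \<noteq> 0 \<Longrightarrow> epow (epow x (1 / P)) P = x"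
  by (simp_all add: epow_epow)

lemma enn2real_inverse:
  assumes "1 \<le> p" "p \<noteq> \<infinity>"
  shows "enn2real (inverse p) = 1 / enn2real p" "1 \<le> enn2real p"
proof -
  obtain r where r: "p = ennreal r" "0 \<le> r" using assms(2) by (cases p) auto
  then have "1 \<le> r" using assms(1) by simp
  then show "enn2real (inverse p) = 1 / enn2real p" "1 \<le> enn2real p"
    using r by (simp_all add: inverse_ennreal divide_inverse)
qed

lemma Lp_norm_eq_energy:
  fixes F :: "real^'d \<Rightarrow> complex"
  assumes p: "1 \<le> p" "p \<noteq> \<infinity>" and S: "S \<in> sets borel"
  shows "Lp_norm (lebesgue_on S) p F = epow (energy (enn2real p) S F) (1 / enn2real p)"
proof -
  have "(\<integral>\<^sup>+x. epow (ennreal (norm (F x))) (enn2real p) \<partial>lebesgue_on S) = energy (enn2real p) S F"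
    using S by (simp add: nn_integral_restrict_space nn_integral_completion energy_def)
  then show ?thesis
    using p by (simp add: Lp_norm_def Lp_enorm_def enn2real_inverse)
qed

lemma energy_le_Lp_norm:
  fixes F :: "real^'d \<Rightarrow> complex"
  assumes p: "1 \<le> p" "p \<noteq> \<infinity>" and S: "S \<in> sets borel"
    and T: "Lp_norm (lebesgue_on S) p F \<le> T"
  shows "energy (enn2real p) S F \<le> epow T (enn2real p)"
proof -
  have P: "1 \<le> enn2real p" by (rule enn2real_inverse(2)[OF p])
  then have "energy (enn2real p) S F = epow (Lp_norm (lebesgue_on S) p F) (enn2real p)"
    unfolding Lp_norm_eq_energy[OF p S] by (simp add: epow_root_power)
  also have "\<dots> \<le> epow T (enn2real p)" using T P by (intro epow_mono) auto
  finally show ?thesis .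
qed

lemma energy_one_le_esssup:
  fixes F :: "real^'d \<Rightarrow> complex"
  assumes S: "S \<in> sets borel" and B: "B \<in> sets borel" "B \<subseteq> S"
    and T: "Lp_norm (lebesgue_on S) \<infinity> F \<le> T"
  shows "energy 1 B F \<le> T * emeasure lborel B"
proof -
  have "AE x in lebesgue_on S. ennreal (norm (F x)) \<le> T"
    using esssup_AE[of "\<lambda>x. ennreal (norm (F x))" "lebesgue_on S"] T
    unfolding Lp_norm_def Lp_enorm_def by (auto elim: eventually_mono)
  then have "AE x in lebesgue. x \<in> S \<longrightarrow> ennreal (norm (F x)) \<le> T"
    using S by (simp add: AE_restrict_space_iff)
  then have "AE x in lebesgue. ennreal (norm (F x) powr 1) * indicator B x \<le> T * indicator B x"
    by eventually_elim (use B(2) in \<open>auto simp: indicator_def\<close>)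
  then have "(\<integral>\<^sup>+x. ennreal (norm (F x) powr 1) * indicator B x \<partial>lebesgue) \<le> (\<integral>\<^sup>+x. T * indicator B x \<partial>lebesgue)"
    by (rule nn_integral_mono_AE)
  also have "\<dots> = T * emeasure lborel B"
    using B by (simp add: nn_integral_completion nn_integral_cmult_indicator)
  finally show ?thesis by (simp add: energy_def nn_integral_completion)
qed

lemma Lp_norm_AE_le:
  fixes F G :: "real^'d \<Rightarrow> complex"
  assumes G: "G \<in> borel_measurable borel" and ae: "AE x in lborel. F x = G x" and S: "S \<in> sets borel"
  shows "Lp_norm (lebesgue_on S) p G \<le> Lp_norm (lebesgue_on S) p F"
proof -
  have ae': "AE x in lebesgue_on S. F x = G x"
    using AE_completion[OF ae] S by (auto simp: AE_restrict_space_iff elim: eventually_mono)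
  show ?thesis
  proof (cases "p = \<infinity>")
    case True
    have "(\<lambda>x. ennreal (norm (G x))) \<in> borel_measurable (lebesgue_on S)"
      using G by (intro measurable_restrict_space1 measurable_completion) auto
    moreover have "AE x in lebesgue_on S. ennreal (norm (G x)) \<le> ennreal (norm (F x))"
      using ae' by eventually_elim simp
    ultimately show ?thesis
      using True by (simp add: Lp_norm_def Lp_enorm_def esssup_AE_mono)
  next
    case False
    have "(\<integral>\<^sup>+x. epow (ennreal (norm (G x))) (enn2real p) \<partial>lebesgue_on S)
       = (\<integral>\<^sup>+x. epow (ennreal (norm (F x))) (enn2real p) \<partial>lebesgue_on S)"
      using ae' by (intro nn_integral_cong_AE) (auto elim: eventually_mono)
    with False show ?thesis by (simp add: Lp_norm_def Lp_enorm_def)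
  qed
qed

lemma Lp_norm_subset_le:
  fixes F :: "real^'d \<Rightarrow> complex"
  assumes F: "F \<in> borel_measurable lebesgue" and S: "S \<in> sets borel" "T \<in> sets borel" "S \<subseteq> T" and p: "1 \<le> p"
  shows "Lp_norm (lebesgue_on S) p F \<le> Lp_norm (lebesgue_on T) p F"
proof (cases "p = \<infinity>")
  case True
  have m: "(\<lambda>x. ennreal (norm (F x))) \<in> borel_measurable (lebesgue_on S)"
    using F by (intro measurable_restrict_space1) auto
  have "AE x in lebesgue_on T. ennreal (norm (F x)) \<le> esssup (lebesgue_on T) (\<lambda>x. ennreal (norm (F x)))"
    by (rule esssup_AE)
  then have "AE x in lebesgue_on S. ennreal (norm (F x)) \<le> esssup (lebesgue_on T) (\<lambda>x. ennreal (norm (F x)))"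
    using S by (auto simp: AE_restrict_space_iff elim!: eventually_mono)
  with m show ?thesis using True by (simp add: Lp_norm_def Lp_enorm_def esssup_I)
next
  case False
  then show ?thesis
    using S p enn2real_inverse[OF p False] by (simp add: Lp_norm_eq_energy epow_mono energy_mono)
qed

section \<open>Bounding the leaders by the local modulus\<close>

text \<open>For \<open>r = 1 / 2 ^ j\<close> this is the supremum in the definition of \<open>T_space\<close>.\<close>

definition local_modulus :: "ennreal \<Rightarrow> nat \<Rightarrow> real^'d \<Rightarrow> (real^'d \<Rightarrow> complex) \<Rightarrow> real \<Rightarrow> ennreal" where
  "local_modulus p m x0 f r =
     (SUP h\<in>{h. norm h \<le> r}. Lp_norm (lebesgue_on (ball_shift m h x0 r)) p (fdiff m h f))"

lemma coefficient_estimate_mono: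
  fixes u :: "real^'d \<Rightarrow> complex"
  assumes e: "coefficient_estimate P m u C A" and C: "C \<le> C'" and A: "A \<le> A'"
  shows "coefficient_estimate P m u C' A'"
proof -
  have C': "0 \<le> C'" using e C by (simp add: coefficient_estimate_def)
  have "ennreal (C * 2 ^ (CARD('d) * j)) *
         (SUP a\<in>{a. norm a \<le> A / 2 ^ j}. energy P (dyadic_nbhd j K A) (fdiff m a f))
     \<le> ennreal (C' * 2 ^ (CARD('d) * j)) *
         (SUP a\<in>{a. norm a \<le> A' / 2 ^ j}. energy P (dyadic_nbhd j K A') (fdiff m a f))" for f :: "real^'d \<Rightarrow> complex" and j K
  proof (intro mult_mono ennreal_leI mult_right_mono C)
    have sub: "dyadic_nbhd j K A \<subseteq> dyadic_nbhd j K A'"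
      using divide_right_mono[OF A, of "2 ^ j"] by (auto simp: dyadic_nbhd_def intro: less_le_trans)
    show "(SUP a\<in>{a. norm a \<le> A / 2 ^ j}. energy P (dyadic_nbhd j K A) (fdiff m a f))
       \<le> (SUP a\<in>{a. norm a \<le> A' / 2 ^ j}. energy P (dyadic_nbhd j K A') (fdiff m a f))"
    proof (rule SUP_mono)
      fix a :: "real^'d" assume "a \<in> {a. norm a \<le> A / 2 ^ j}"
      then have "a \<in> {a. norm a \<le> A' / 2 ^ j}"
        using divide_right_mono[OF A, of "2 ^ j"] by auto
      then show "\<exists>b\<in>{a. norm a \<le> A' / 2 ^ j}.
        energy P (dyadic_nbhd j K A) (fdiff m a f) \<le> energy P (dyadic_nbhd j K A') (fdiff m b f)"
        using energy_mono[OF sub] by blast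
    qed
  qed (use C' in auto)
  with e C A show ?thesis
    unfolding coefficient_estimate_def by (blast intro: order_trans)
qed

lemma dyadic_coefficient_bound_uniform:
  fixes \<psi> :: "int^'d \<Rightarrow> real^'d \<Rightarrow> complex"
  assumes P: "1 \<le> P" and \<psi>: "\<And>i. i \<in> wtypes \<Longrightarrow> test_fun (\<psi> i) \<and> vanishing m (\<psi> i)"
  obtains C A where "0 \<le> C" "0 \<le> A" "\<And>i. i \<in> wtypes \<Longrightarrow> coefficient_estimate P m (\<psi> i) C A"
proof -
  have "\<exists>C A. coefficient_estimate P m (\<psi> i) C A" if i: "i \<in> wtypes" for i
    using dyadic_coefficient_bound[OF P] \<psi>[OF i] by blast
  then obtain C A where e: "\<And>i. i \<in> wtypes \<Longrightarrow> coefficient_estimate P m (\<psi> i) (C i) (A i)" by metis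
  have nn: "0 \<le> C i" "0 \<le> A i" if "i \<in> wtypes" for i
    using e[OF that] by (auto simp: coefficient_estimate_def)
  show thesis
  proof (rule that)
    show "0 \<le> (\<Sum>i\<in>wtypes. C i)" "0 \<le> (\<Sum>i\<in>wtypes. A i)" by (intro sum_nonneg nn; assumption)+
    fix i :: "int^'d" assume i: "i \<in> wtypes"
    show "coefficient_estimate P m (\<psi> i) (\<Sum>i\<in>wtypes. C i) (\<Sum>i\<in>wtypes. A i)"
      by (rule coefficient_estimate_mono[OF e[OF i]]; rule member_le_sum[OF i]; use nn finite_wtypes in auto)
  qed
qed

lemma wcoeff_lborel:
  fixes f g :: "real^'d \<Rightarrow> complex"
  assumes f: "f \<in> borel_measurable lebesgue" and g: "g \<in> borel_measurable borel"
    and ae: "AE x in lborel. f x = g x" and u: "test_fun (\<psi> i)"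
  shows "wcoeff \<psi> f i j k = 2 ^ (CARD('d) * j) * (\<integral>x. g x * \<psi> i (2 ^ j *\<^sub>R x - ivec k) \<partial>lborel)"
proof -
  have [measurable]: "\<psi> i \<in> borel_measurable borel" using u by (rule test_fun_measurable)
  have m: "(\<lambda>x. \<psi> i (2 ^ j *\<^sub>R x - ivec k)) \<in> borel_measurable borel" by measurable
  have ml: "(\<lambda>x. \<psi> i (2 ^ j *\<^sub>R x - ivec k)) \<in> borel_measurable lebesgue"
    by (rule measurable_completion) (use m in simp)
  have gl: "g \<in> borel_measurable lebesgue" by (rule measurable_completion) (use g in simp)
  have "(\<integral>x. f x * \<psi> i (2 ^ j *\<^sub>R x - ivec k) \<partial>lebesgue) = (\<integral>x. g x * \<psi> i (2 ^ j *\<^sub>R x - ivec k) \<partial>lebesgue)"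
  proof (rule integral_cong_AE)
    show "AE x in lebesgue. f x * \<psi> i (2 ^ j *\<^sub>R x - ivec k) = g x * \<psi> i (2 ^ j *\<^sub>R x - ivec k)"
      using AE_completion[OF ae] by eventually_elim simp
  qed (intro borel_measurable_times f gl ml)+
  also have "\<dots> = (\<integral>x. g x * \<psi> i (2 ^ j *\<^sub>R x - ivec k) \<partial>lborel)"
    by (rule integral_completion) (use g m in auto)
  finally show ?thesis by (simp add: wcoeff_def)
qed

text \<open>In each generation \<open>j'\<close> the normalisation \<open>2 ^ ((j - j') d)\<close> of the \<open>p\<close>-th powers cancels the factor
\<open>2 ^ (d j')\<close> of the coefficient estimate up to \<open>2 ^ (j d)\<close>, which does not depend on \<open>j'\<close>.\<close>

lemma leader_bound_finite:
  fixes \<psi> :: "int^'d \<Rightarrow> real^'d \<Rightarrow> complex" and x0 :: "real^'d"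
  assumes p: "1 \<le> p" "p \<noteq> \<infinity>" and \<psi>: "\<And>i. i \<in> wtypes \<Longrightarrow> test_fun (\<psi> i) \<and> vanishing m (\<psi> i)"
  obtains C N where "0 \<le> C" "\<And>f j. loc_int f \<Longrightarrow> wleader p \<psi> f x0 j \<le>
     ennreal (C * 2 powr (real j * (real CARD('d) * enn2real (inverse p)))) * local_modulus p m x0 f (2 ^ N / 2 ^ j)"
proof -
  define P where "P = enn2real p"
  have P: "1 \<le> P" and ip: "enn2real (inverse p) = 1 / P"
    using enn2real_inverse[OF p] by (simp_all add: P_def)
  obtain C A where C: "0 \<le> C" and A: "0 \<le> A"
    and e: "\<And>i. i \<in> wtypes \<Longrightarrow> coefficient_estimate P m (\<psi> i) C A"
    using dyadic_coefficient_bound_uniform[where \<psi> = \<psi> and m = m, OF P \<psi>] by blast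
  note b = e[unfolded coefficient_estimate_def, THEN conjunct2, THEN conjunct2, rule_format]
  obtain N where N: "A \<le> 2 ^ N" and g:
    "\<And>j j' i k c h. j \<le> j' \<Longrightarrow> c \<in> neighbour_cubes j x0 \<Longrightarrow> i \<in> wtypes \<Longrightarrow> wcube i j' k \<subseteq> c \<Longrightarrow>
      norm h \<le> A / 2 ^ j' \<Longrightarrow> ball ((1 / 2 ^ j') *\<^sub>R ivec k) (A / 2 ^ j') \<subseteq> ball_shift m h x0 (2 ^ N / 2 ^ j)"
    using wavelet_support_in_ball_shift[where m = m and ?x0.0 = x0, OF A] by blast
  define M where "M = real (card (wtypes :: (int^'d) set)) * C"
  have M: "0 \<le> M" using C by (simp add: M_def)
  show thesis
  proof (rule that)
    show "0 \<le> M powr (1 / P)" by simp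
    fix f :: "real^'d \<Rightarrow> complex" and j assume f: "loc_int f"
    have fm: "f \<in> borel_measurable borel" using f by (rule loc_int_measurable)
    let ?T = "local_modulus p m x0 f (2 ^ N / 2 ^ j)"
    show "wleader p \<psi> f x0 j \<le> ennreal (M powr (1 / P) * 2 powr (real j * (real CARD('d) * enn2real (inverse p)))) * ?T"
      unfolding wleader_def cube_leader_def
    proof (intro SUP_least)
      fix c :: "(real^'d) set" and j' assume c: "c \<in> neighbour_cubes j x0" and "j' \<in> {j..}"
      then have j: "j \<le> j'" by simp
      define I where "I = {(i, k). i \<in> wtypes \<and> wcube i j' k \<subseteq> c}"
      define K where "K i = {k. wcube i j' k \<subseteq> c}" for i
      have fK: "finite (K i)" if "i \<in> wtypes" for i
        unfolding K_def by (rule finite_wavelets_in_cube[OF c that j])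
      have I: "I = Sigma wtypes K" by (auto simp: I_def K_def)
      have fI: "finite I" unfolding I using fK finite_wtypes by (intro finite_SigmaI) auto
      let ?w = "2 powr ((real j - real j') * real CARD('d))"
      have pt: "epow (ennreal (2 powr ((real j - real j') * (real CARD('d) * enn2real (inverse p))) * norm (wcoeff \<psi> f i j' k))) P
         = ennreal ?w * ennreal (norm (wcoeff \<psi> f i j' k) powr P)" for i k
        using P by (simp add: ip epow_mult powr_powr ennreal_mult)
      have S: "(\<Sum>k\<in>K i. ennreal (norm (wcoeff \<psi> f i j' k) powr P)) \<le> ennreal (C * 2 ^ (CARD('d) * j')) * epow ?T P"
        if i: "i \<in> wtypes" for i
      proof -
        have u: "test_fun (\<psi> i)" using \<psi>[OF i] by simp
        have "wcoeff \<psi> f i j' k = 2 ^ (CARD('d) * j') * (\<integral>x. f x * \<psi> i (2 ^ j' *\<^sub>R x - ivec k) \<partial>lborel)" for k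
          by (rule wcoeff_lborel[where \<psi> = \<psi>]) (use fm u in \<open>auto intro: measurable_completion\<close>)
        then have "(\<Sum>k\<in>K i. ennreal (norm (wcoeff \<psi> f i j' k) powr P)) \<le> ennreal (C * 2 ^ (CARD('d) * j')) *
           (SUP a\<in>{a. norm a \<le> A / 2 ^ j'}. energy P (dyadic_nbhd j' (K i) A) (fdiff m a f))"
          using b[OF i f fK[OF i]] by simp
        also have "(SUP a\<in>{a. norm a \<le> A / 2 ^ j'}. energy P (dyadic_nbhd j' (K i) A) (fdiff m a f)) \<le> epow ?T P"
        proof (rule SUP_least)
          fix a :: "real^'d" assume "a \<in> {a. norm a \<le> A / 2 ^ j'}"
          then have a: "norm a \<le> A / 2 ^ j'" by simp
          have "A / 2 ^ j' \<le> 2 ^ N / 2 ^ j"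
            using N A j by (intro frac_le power_increasing) auto
          with a have a': "norm a \<le> 2 ^ N / 2 ^ j" by linarith
          have "dyadic_nbhd j' (K i) A \<subseteq> ball_shift m a x0 (2 ^ N / 2 ^ j)"
            unfolding dyadic_nbhd_def by (intro UN_least g[OF j c i _ a]) (simp add: K_def)
          then have "energy P (dyadic_nbhd j' (K i) A) (fdiff m a f) \<le> energy P (ball_shift m a x0 (2 ^ N / 2 ^ j)) (fdiff m a f)"
            by (rule energy_mono)
          also have "\<dots> \<le> epow ?T P"
            unfolding P_def
          proof (rule energy_le_Lp_norm[OF p ball_shift_borel])
            show "Lp_norm (lebesgue_on (ball_shift m a x0 (2 ^ N / 2 ^ j))) p (fdiff m a f) \<le> ?T"
              unfolding local_modulus_def using a' by (intro SUP_upper) simp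
          qed
          finally show "energy P (dyadic_nbhd j' (K i) A) (fdiff m a f) \<le> epow ?T P" .
        qed
        finally show ?thesis by (simp add: mult_left_mono)
      qed
      have "Lp_enorm (count_space I) p (\<lambda>(i, k). ennreal (2 powr ((real j - real j') * (real CARD('d) * enn2real (inverse p))) * norm (wcoeff \<psi> f i j' k)))
        = epow (\<Sum>(i, k)\<in>I. ennreal ?w * ennreal (norm (wcoeff \<psi> f i j' k) powr P)) (1 / P)"
      proof -
        have "Lp_enorm (count_space I) p F = epow (\<Sum>x\<in>I. epow (F x) P) (1 / P)" for F
          using p(2) by (simp only: Lp_enorm_def nn_integral_count_space_finite[OF fI] P_def[symmetric] ip if_False)
        then show ?thesis
          by (simp only: case_prod_unfold pt)
      qed
      also have "(\<Sum>(i, k)\<in>I. ennreal ?w * ennreal (norm (wcoeff \<psi> f i j' k) powr P))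
         = ennreal ?w * (\<Sum>i\<in>wtypes. \<Sum>k\<in>K i. ennreal (norm (wcoeff \<psi> f i j' k) powr P))"
        unfolding I sum_distrib_left
        by (rule sum.Sigma[symmetric]) (use fK finite_wtypes in auto)
      also have "epow \<dots> (1 / P) \<le> epow (ennreal (M * 2 powr (real j * real CARD('d))) * epow ?T P) (1 / P)"
      proof (rule epow_mono)
        have "ennreal ?w * (\<Sum>i\<in>wtypes. \<Sum>k\<in>K i. ennreal (norm (wcoeff \<psi> f i j' k) powr P))
          \<le> ennreal ?w * (\<Sum>i\<in>(wtypes :: (int^'d) set). ennreal (C * 2 ^ (CARD('d) * j')) * epow ?T P)"
          by (intro mult_left_mono sum_mono S) auto
        also have "\<dots> = ennreal (?w * (M * 2 ^ (CARD('d) * j'))) * epow ?T P"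
          using C by (simp add: M_def ennreal_mult ennreal_of_nat_eq_real_of_nat mult.assoc)
        also have "?w * (M * 2 ^ (CARD('d) * j')) = M * 2 powr (real j * real CARD('d))"
        proof -
          have "?w * 2 ^ (CARD('d) * j') = 2 powr ((real j - real j') * real CARD('d)) * 2 powr (real (CARD('d) * j'))"
            by (simp only: powr_realpow[OF zero_less_numeral])
          also have "\<dots> = 2 powr (real j * real CARD('d))"
            by (simp add: powr_add[symmetric] algebra_simps)
          finally show ?thesis by simp
        qed
        finally show "ennreal ?w * (\<Sum>i\<in>wtypes. \<Sum>k\<in>K i. ennreal (norm (wcoeff \<psi> f i j' k) powr P))
          \<le> ennreal (M * 2 powr (real j * real CARD('d))) * epow ?T P" .
      qed (use P in simp)
      also have "\<dots> = ennreal (M powr (1 / P) * 2 powr (real j * (real CARD('d) * enn2real (inverse p)))) * ?T"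
        using P M by (simp add: epow_mult epow_root_power powr_mult powr_powr ip)
      finally show "Lp_enorm (count_space {(i, k). i \<in> wtypes \<and> wcube i j' k \<subseteq> c}) p
          (\<lambda>(i, k). ennreal (2 powr ((real j - real j') * (real CARD('d) * enn2real (inverse p))) * norm (wcoeff \<psi> f i j' k)))
          \<le> ennreal (M powr (1 / P) * 2 powr (real j * (real CARD('d) * enn2real (inverse p)))) * ?T"
        by (simp only: I_def)
    qed
  qed
qed

text \<open>For \<open>p = \<infinity>\<close> each coefficient is treated alone, by the estimate with exponent \<open>1\<close>: the integral over
a ball of radius \<open>A / 2 ^ j'\<close> is at most the essential supremum times the volume, and the volume
cancels the factor \<open>2 ^ (d j')\<close>.\<close>

lemma leader_bound_infinite:
  fixes \<psi> :: "int^'d \<Rightarrow> real^'d \<Rightarrow> complex" and x0 :: "real^'d"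
  assumes \<psi>: "\<And>i. i \<in> wtypes \<Longrightarrow> test_fun (\<psi> i) \<and> vanishing m (\<psi> i)"
  obtains C N where "0 \<le> C" "\<And>f j. loc_int f \<Longrightarrow> wleader \<infinity> \<psi> f x0 j \<le>
     ennreal C * local_modulus \<infinity> m x0 f (2 ^ N / 2 ^ j)"
proof -
  obtain C A where C: "0 \<le> C" and A: "0 \<le> A"
    and e: "\<And>i. i \<in> wtypes \<Longrightarrow> coefficient_estimate 1 m (\<psi> i) C A"
    using dyadic_coefficient_bound_uniform[where \<psi> = \<psi> and m = m, OF order_refl \<psi>] by blast
  note b = e[unfolded coefficient_estimate_def, THEN conjunct2, THEN conjunct2, rule_format]
  obtain N where N: "A \<le> 2 ^ N" and g:
    "\<And>j j' i k c h. j \<le> j' \<Longrightarrow> c \<in> neighbour_cubes j x0 \<Longrightarrow> i \<in> wtypes \<Longrightarrow> wcube i j' k \<subseteq> c \<Longrightarrow>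
      norm h \<le> A / 2 ^ j' \<Longrightarrow> ball ((1 / 2 ^ j') *\<^sub>R ivec k) (A / 2 ^ j') \<subseteq> ball_shift m h x0 (2 ^ N / 2 ^ j)"
    using wavelet_support_in_ball_shift[where m = m and ?x0.0 = x0, OF A] by blast
  define V where "V = unit_ball_vol (real CARD('d)) * A ^ CARD('d)"
  have V: "0 \<le> V" using A by (simp add: V_def)
  show thesis
  proof (rule that)
    show "0 \<le> C * V" using C V by simp
    fix f :: "real^'d \<Rightarrow> complex" and j assume f: "loc_int f"
    have fm: "f \<in> borel_measurable borel" using f by (rule loc_int_measurable)
    let ?T = "local_modulus \<infinity> m x0 f (2 ^ N / 2 ^ j)"
    show "wleader \<infinity> \<psi> f x0 j \<le> ennreal (C * V) * ?T"
      unfolding wleader_def cube_leader_def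
    proof (intro SUP_least)
      fix c :: "(real^'d) set" and j' assume c: "c \<in> neighbour_cubes j x0" and "j' \<in> {j..}"
      then have j: "j \<le> j'" by simp
      have S: "ennreal (norm (wcoeff \<psi> f i j' k)) \<le> ennreal (C * V) * ?T"
        if i: "i \<in> wtypes" and k: "wcube i j' k \<subseteq> c" for i k
      proof -
        let ?B = "ball ((1 / 2 ^ j') *\<^sub>R ivec k) (A / 2 ^ j') :: (real^'d) set"
        have u: "test_fun (\<psi> i)" using \<psi>[OF i] by simp
        have "wcoeff \<psi> f i j' k = 2 ^ (CARD('d) * j') * (\<integral>x. f x * \<psi> i (2 ^ j' *\<^sub>R x - ivec k) \<partial>lborel)"
          by (rule wcoeff_lborel[where \<psi> = \<psi>]) (use fm u in \<open>auto intro: measurable_completion\<close>)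
        then have "ennreal (norm (wcoeff \<psi> f i j' k)) \<le> ennreal (C * 2 ^ (CARD('d) * j')) *
           (SUP a\<in>{a. norm a \<le> A / 2 ^ j'}. energy 1 (dyadic_nbhd j' {k} A) (fdiff m a f))"
          using b[OF i f, of "{k}"] by simp
        also have "(SUP a\<in>{a. norm a \<le> A / 2 ^ j'}. energy 1 (dyadic_nbhd j' {k} A) (fdiff m a f)) \<le> ?T * emeasure lborel ?B"
        proof (rule SUP_least)
          fix a :: "real^'d" assume "a \<in> {a. norm a \<le> A / 2 ^ j'}"
          then have a: "norm a \<le> A / 2 ^ j'" by simp
          have "A / 2 ^ j' \<le> 2 ^ N / 2 ^ j"
            using N A j by (intro frac_le power_increasing) auto
          with a have a': "norm a \<le> 2 ^ N / 2 ^ j" by linarith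
          have "energy 1 ?B (fdiff m a f) \<le> ?T * emeasure lborel ?B"
          proof (rule energy_one_le_esssup[OF ball_shift_borel])
            show "?B \<subseteq> ball_shift m a x0 (2 ^ N / 2 ^ j)" by (rule g[OF j c i k a])
            show "Lp_norm (lebesgue_on (ball_shift m a x0 (2 ^ N / 2 ^ j))) \<infinity> (fdiff m a f) \<le> ?T"
              unfolding local_modulus_def using a' by (intro SUP_upper) simp
          qed simp
          then show "energy 1 (dyadic_nbhd j' {k} A) (fdiff m a f) \<le> ?T * emeasure lborel ?B"
            by (simp add: dyadic_nbhd_def)
        qed
        also have "emeasure lborel ?B = ennreal (V / 2 ^ (CARD('d) * j'))"
          using A by (simp add: emeasure_ball V_def power_divide power_mult[symmetric] mult.commute)
        finally have "ennreal (norm (wcoeff \<psi> f i j' k)) \<le> ennreal (C * 2 ^ (CARD('d) * j')) * (?T * ennreal (V / 2 ^ (CARD('d) * j')))"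
          by (simp add: mult_left_mono)
        also have "\<dots> = ennreal (C * 2 ^ (CARD('d) * j') * (V / 2 ^ (CARD('d) * j'))) * ?T"
          using C V by (subst ennreal_mult) (auto simp: ac_simps)
        finally show ?thesis by simp
      qed
      show "Lp_enorm (count_space {(i, k). i \<in> wtypes \<and> wcube i j' k \<subseteq> c}) \<infinity>
          (\<lambda>(i, k). ennreal (2 powr ((real j - real j') * (real CARD('d) * enn2real (inverse \<infinity>))) * norm (wcoeff \<psi> f i j' k)))
          \<le> ennreal (C * V) * ?T"
        using S by (auto simp: Lp_enorm_def AE_count_space intro!: esssup_I)
    qed
  qed
qed

lemma leader_bound:
  fixes \<psi> :: "int^'d \<Rightarrow> real^'d \<Rightarrow> complex" and x0 :: "real^'d"
  assumes p: "1 \<le> p" and \<psi>: "\<And>i. i \<in> wtypes \<Longrightarrow> test_fun (\<psi> i) \<and> vanishing m (\<psi> i)"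
  obtains C N where "0 \<le> C" "\<And>f j. loc_int f \<Longrightarrow> wleader p \<psi> f x0 j \<le>
     ennreal (C * 2 powr (real j * (real CARD('d) * enn2real (inverse p)))) * local_modulus p m x0 f (2 ^ N / 2 ^ j)"
proof (cases "p = \<infinity>")
  case True
  obtain C N where "0 \<le> C" "\<And>f j. loc_int f \<Longrightarrow> wleader \<infinity> \<psi> f x0 j \<le>
     ennreal C * local_modulus \<infinity> m x0 f (2 ^ N / 2 ^ j)"
    using leader_bound_infinite[where \<psi> = \<psi> and m = m and ?x0.0 = x0, OF \<psi>] by blast
  with True show thesis by (intro that[of C N]) auto
next
  case False
  then show thesis using leader_bound_finite[where \<psi> = \<psi> and m = m and ?x0.0 = x0, OF p False \<psi>] that by blast
qed

lemma fdiff_AE_cong: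
  fixes f g :: "real^'d \<Rightarrow> complex"
  assumes "AE x in lborel. f x = g x"
  shows "AE x in lborel. fdiff m h f x = fdiff m h g x"
proof -
  have "AE x in lborel. f (x + c) = g (x + c)" for c
  proof -
    have "AE x in distr lborel borel ((+) c). f x = g x"
      unfolding lborel_distr_plus by (rule assms)
    then have "AE x in lborel. f (c + x) = g (c + x)" by (rule AE_distrD[rotated]) simp
    then show ?thesis by (simp add: add.commute)
  qed
  then have "AE x in lborel. \<forall>l\<in>{..m}. f (x + real l *\<^sub>R h) = g (x + real l *\<^sub>R h)"
    by (subst AE_finite_all) auto
  then show ?thesis by eventually_elim (simp add: fdiff_binomial)
qed

lemma borel_representative:
  fixes f :: "real^'d \<Rightarrow> complex"
  assumes p: "1 \<le> p" and f: "f \<in> Lp_loc p"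
  obtains g where "loc_int g" "AE x in lborel. f x = g x"
proof -
  have fm: "f \<in> borel_measurable lebesgue" and
    fl: "\<And>K. compact K \<Longrightarrow> Lp_norm (lebesgue_on K) p f < \<infinity>"
    using f by (auto simp: Lp_loc_def)
  obtain g1 where g1 [measurable]: "g1 \<in> borel_measurable lborel" "AE x in lborel. Re (f x) = g1 x"
    using completion_ex_borel_measurable_real[of "\<lambda>x. Re (f x)" lborel] fm by auto
  obtain g2 where g2 [measurable]: "g2 \<in> borel_measurable lborel" "AE x in lborel. Im (f x) = g2 x"
    using completion_ex_borel_measurable_real[of "\<lambda>x. Im (f x)" lborel] fm by auto
  define g where "g x = Complex (g1 x) (g2 x)" for x
  have "g = (\<lambda>x. complex_of_real (g1 x) + \<i> * complex_of_real (g2 x))"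
    by (simp add: g_def fun_eq_iff complex_eq_iff)
  also have "\<dots> \<in> borel_measurable borel"
    using g1(1) g2(1) by simp
  finally have gm [measurable]: "g \<in> borel_measurable borel" .
  have ae: "AE x in lborel. f x = g x"
    using g1(2) g2(2) by eventually_elim (simp add: g_def complex_eq_iff)
  have "(\<integral>\<^sup>+x\<in>cball 0 r. ennreal (norm (g x)) \<partial>lborel) < \<infinity>" for r
  proof -
    have S: "cball (0::real^'d) r \<in> sets borel" by simp
    have fin: "emeasure lborel (cball (0::real^'d) r) < \<infinity>"
      by (rule emeasure_lborel_cball_finite)
    have N: "Lp_norm (lebesgue_on (cball 0 r)) p g < \<infinity>"
      using Lp_norm_AE_le[OF gm ae S, of p] fl[of "cball 0 r"] by (auto intro: le_less_trans)
    show ?thesis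
    proof (cases "p = \<infinity>")
      case True
      have "energy 1 (cball 0 r) g \<le> Lp_norm (lebesgue_on (cball 0 r)) p g * emeasure lborel (cball (0::real^'d) r)"
        by (rule energy_one_le_esssup[OF S S]) (simp_all add: True)
      also have "\<dots> < \<infinity>" using N fin by (simp add: ennreal_mult_less_top)
      finally show ?thesis by (simp add: energy_def)
    next
      case False
      let ?P = "enn2real p"
      have P: "1 \<le> ?P" by (rule enn2real_inverse(2)[OF p False])
      have E: "energy ?P (cball 0 r) g < \<infinity>"
        using N unfolding Lp_norm_eq_energy[OF p False S] epow_less_top_iff .
      have "(\<integral>\<^sup>+x\<in>cball 0 r. ennreal (norm (g x)) \<partial>lborel)
         \<le> (\<integral>\<^sup>+x. indicator (cball 0 r) x + ennreal (norm (g x) powr ?P) * indicator (cball 0 r) x \<partial>lborel)"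
      proof (intro nn_integral_mono)
        fix x
        have "norm (g x) \<le> 1 + norm (g x) powr ?P"
        proof (cases "norm (g x) \<le> 1")
          case False
          then have "norm (g x) powr 1 \<le> norm (g x) powr ?P" using P by (intro powr_mono) auto
          then show ?thesis using False by simp
        qed (simp add: add_increasing2)
        then have "ennreal (norm (g x)) \<le> 1 + ennreal (norm (g x) powr ?P)"
          using ennreal_leI by (fastforce simp flip: ennreal_1 ennreal_plus)
        then show "ennreal (norm (g x)) * indicator (cball 0 r) x
          \<le> indicator (cball 0 r) x + ennreal (norm (g x) powr ?P) * indicator (cball 0 r) x"
          by (auto simp: indicator_def)
      qed
      also have "\<dots> = emeasure lborel (cball (0::real^'d) r) + energy ?P (cball 0 r) g"
      proof -
        have [measurable]: "cball (0::real^'d) r \<in> sets borel" by simp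
        show ?thesis unfolding energy_def by (subst nn_integral_add) auto
      qed
      also have "\<dots> < \<infinity>" using fin E by simp
      finally show ?thesis .
    qed
  qed
  then have "loc_int g" by (simp add: loc_int_iff_nn_integral gm)
  then show thesis using ae by (rule that)
qed

lemma Lp_enorm_count_cong:
  assumes "\<And>x. x \<in> A \<Longrightarrow> F x = G x"
  shows "Lp_enorm (count_space A) p F = Lp_enorm (count_space A) p G"
proof -
  have "esssup (count_space A) F = esssup (count_space A) G"
    using assms by (intro esssup_AE_cong) (auto simp: AE_count_space)
  moreover have "(\<integral>\<^sup>+x. epow (F x) r \<partial>count_space A) = (\<integral>\<^sup>+x. epow (G x) r \<partial>count_space A)" for r
    using assms by (intro nn_integral_cong) auto
  ultimately show ?thesis by (simp add: Lp_enorm_def)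
qed

lemma wleader_cong:
  assumes "\<And>i j k. i \<in> wtypes \<Longrightarrow> wcoeff \<psi> f i j k = wcoeff \<psi> g i j k"
  shows "wleader p \<psi> f x0 j = wleader p \<psi> g x0 j"
  unfolding wleader_def cube_leader_def
  by (intro SUP_cong refl Lp_enorm_count_cong) (auto simp: assms)

text \<open>Coefficients do not change when \<open>f\<close> is replaced by a Borel function equal to it almost everywhere,
and the local modulus does not increase.\<close>

lemma local_leader_bound:
  fixes \<psi> :: "int^'d \<Rightarrow> real^'d \<Rightarrow> complex" and x0 :: "real^'d"
  assumes p: "1 \<le> p" and \<psi>: "\<And>i. i \<in> wtypes \<Longrightarrow> test_fun (\<psi> i) \<and> vanishing m (\<psi> i)"
    and f: "f \<in> Lp_loc p"
  obtains C N where "0 \<le> C" "\<And>j. wleader p \<psi> f x0 j \<le>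
     ennreal (C * 2 powr (real j * (real CARD('d) * enn2real (inverse p)))) * local_modulus p m x0 f (2 ^ N / 2 ^ j)"
proof -
  obtain C N where C: "0 \<le> C" and b: "\<And>f j. loc_int f \<Longrightarrow> wleader p \<psi> f x0 j \<le>
     ennreal (C * 2 powr (real j * (real CARD('d) * enn2real (inverse p)))) * local_modulus p m x0 f (2 ^ N / 2 ^ j)"
    using leader_bound[where \<psi> = \<psi> and m = m and ?x0.0 = x0, OF p \<psi>] by blast
  obtain g where g: "loc_int g" and ae: "AE x in lborel. f x = g x"
    using borel_representative[OF p f] by blast
  have fm: "f \<in> borel_measurable lebesgue" using f by (simp add: Lp_loc_def)
  have gm: "g \<in> borel_measurable borel" using g by (rule loc_int_measurable)
  have gl: "g \<in> borel_measurable lebesgue" by (rule measurable_completion) (use gm in simp)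
  have eq: "wleader p \<psi> f x0 j = wleader p \<psi> g x0 j" for j
  proof (rule wleader_cong)
    fix i :: "int^'d" and j k assume "i \<in> wtypes"
    then have u: "test_fun (\<psi> i)" using \<psi> by blast
    show "wcoeff \<psi> f i j k = wcoeff \<psi> g i j k"
      unfolding wcoeff_lborel[where \<psi> = \<psi>, OF fm gm ae u]
      by (rule wcoeff_lborel[where \<psi> = \<psi>, OF gl gm _ u, symmetric]) simp
  qed
  have le: "local_modulus p m x0 g r \<le> local_modulus p m x0 f r" for r
    unfolding local_modulus_def
    by (intro SUP_mono' Lp_norm_AE_le fdiff_measurable gm fdiff_AE_cong ae ball_shift_borel)
  show thesis
  proof (rule that[OF C])
    fix j
    show "wleader p \<psi> f x0 j \<le>
      ennreal (C * 2 powr (real j * (real CARD('d) * enn2real (inverse p)))) * local_modulus p m x0 f (2 ^ N / 2 ^ j)"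
      unfolding eq by (rule order_trans[OF b[OF g] mult_left_mono[OF le]]) simp
  qed
qed

text \<open>The bound with differences of order \<open>0\<close> involves only the norm of \<open>f\<close> on a ball.\<close>

lemma wleader_finite:
  fixes \<psi> :: "int^'d \<Rightarrow> real^'d \<Rightarrow> complex" and x0 :: "real^'d"
  assumes p: "1 \<le> p" and \<psi>: "\<And>i. i \<in> wtypes \<Longrightarrow> test_fun (\<psi> i)" and f: "f \<in> Lp_loc p"
  shows "wleader p \<psi> f x0 j < \<infinity>"
proof -
  have "test_fun (\<psi> i) \<and> vanishing 0 (\<psi> i)" if "i \<in> wtypes" for i
    using \<psi>[OF that] by (simp add: vanishing_def)
  then obtain C N where b: "\<And>j. wleader p \<psi> f x0 j \<le>
     ennreal (C * 2 powr (real j * (real CARD('d) * enn2real (inverse p)))) * local_modulus p 0 x0 f (2 ^ N / 2 ^ j)"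
    using local_leader_bound[where \<psi> = \<psi> and m = 0 and ?x0.0 = x0, OF p _ f] by blast
  have fm: "f \<in> borel_measurable lebesgue" using f by (simp add: Lp_loc_def)
  have "local_modulus p 0 x0 f r \<le> Lp_norm (lebesgue_on (cball x0 r)) p f" for r
    unfolding local_modulus_def
  proof (rule SUP_least)
    fix h :: "real^'d"
    have "Lp_norm (lebesgue_on (ball x0 r)) p f \<le> Lp_norm (lebesgue_on (cball x0 r)) p f"
      by (intro Lp_norm_subset_le fm p) auto
    then show "Lp_norm (lebesgue_on (ball_shift 0 h x0 r)) p (fdiff 0 h f) \<le> Lp_norm (lebesgue_on (cball x0 r)) p f"
      by (simp add: ball_shift_0)
  qed
  moreover have "Lp_norm (lebesgue_on (cball x0 r)) p f < \<infinity>" for r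
    using f by (simp add: Lp_loc_def)
  ultimately have "local_modulus p 0 x0 f (2 ^ N / 2 ^ j) < \<infinity>"
    by (rule le_less_trans)
  then have "ennreal (C * 2 powr (real j * (real CARD('d) * enn2real (inverse p)))) * local_modulus p 0 x0 f (2 ^ N / 2 ^ j) < \<infinity>"
    by (simp add: ennreal_mult_less_top)
  with b[of j] show ?thesis by (rule le_less_trans)
qed

section \<open>Weighted sequences\<close>

lemma in_ell_infinity: "in_ell \<infinity> a \<longleftrightarrow> (\<exists>B<\<infinity>. \<forall>j. a j \<le> B)"
proof
  assume "in_ell \<infinity> a"
  then have "esssup (count_space UNIV) a < \<infinity>" by (simp add: in_ell_def Lp_enorm_def)
  moreover have "\<forall>j. a j \<le> esssup (count_space UNIV) a"
    using esssup_AE[of a "count_space UNIV"] by (simp add: AE_count_space)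
  ultimately show "\<exists>B<\<infinity>. \<forall>j. a j \<le> B" by blast
next
  assume "\<exists>B<\<infinity>. \<forall>j. a j \<le> B"
  then obtain B where B: "B < \<infinity>" "\<forall>j. a j \<le> B" by blast
  then have "esssup (count_space UNIV) a \<le> B" by (intro esssup_I) (auto simp: AE_count_space)
  with B show "in_ell \<infinity> a" by (simp add: in_ell_def Lp_enorm_def le_less_trans)
qed

lemma in_ell_finite:
  assumes "q \<noteq> \<infinity>"
  shows "in_ell q a \<longleftrightarrow> (\<Sum>j. epow (a j) (enn2real q)) < \<infinity>"
  using assms by (simp only: in_ell_def Lp_enorm_def if_False epow_less_top_iff nn_integral_count_space_nat)

lemma in_ell_shift:
  assumes q: "1 \<le> q" and b: "in_ell q b" and le: "\<And>j. a (j + N) \<le> ennreal D * b j"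
    and fin: "\<And>j. a j < \<infinity>"
  shows "in_ell q a"
proof (cases "q = \<infinity>")
  case True
  then obtain B where B: "B < \<infinity>" "\<And>j. b j \<le> B" using b unfolding True in_ell_infinity by blast
  have "a j \<le> (\<Sum>j<N. a j) + ennreal D * B" for j
  proof (cases "j < N")
    case True
    then have "a j \<le> (\<Sum>j<N. a j)" by (intro member_le_sum) auto
    then show ?thesis by (simp add: add_increasing2)
  next
    case False
    then have "a j \<le> ennreal D * b (j - N)" using le[of "j - N"] by simp
    also have "\<dots> \<le> ennreal D * B" by (intro mult_left_mono B) simp
    finally show ?thesis by (simp add: add_increasing)
  qed
  moreover have "(\<Sum>j<N. a j) + ennreal D * B < \<infinity>"
    using fin B(1) by (simp add: ennreal_mult_less_top)
  ultimately show ?thesis unfolding True in_ell_infinity by blast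
next
  case False
  define Q where "Q = enn2real q"
  have Q: "1 \<le> Q" unfolding Q_def by (rule enn2real_inverse(2)[OF q False])
  have "(\<Sum>j. epow (a (j + N)) Q) \<le> (\<Sum>j. epow (ennreal D) Q * epow (b j) Q)"
    using Q le by (intro suminf_le) (auto simp: epow_mult[symmetric] intro!: epow_mono)
  also have "\<dots> = epow (ennreal D) Q * (\<Sum>j. epow (b j) Q)" by simp
  also have "\<dots> < \<infinity>"
    using b unfolding in_ell_finite[OF False] Q_def[symmetric]
    by (simp add: ennreal_mult_less_top epow_less_top_iff[unfolded infinity_ennreal_def])
  finally have 1: "(\<Sum>j. epow (a (j + N)) Q) < \<infinity>" .
  have "(\<Sum>j. epow (a j) Q) = (\<Sum>j. epow (a (j + N)) Q) + (\<Sum>j<N. epow (a j) Q)"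
    by (rule suminf_offset) simp
  also have "\<dots> < \<infinity>"
    using 1 fin by (simp add: epow_less_top_iff[unfolded infinity_ennreal_def])
  finally show ?thesis unfolding in_ell_finite[OF False] Q_def[symmetric] .
qed

lemma admissible_growth:
  assumes "admissible \<sigma>"
  obtains C where "\<And>j N. \<sigma> (j + N) \<le> C ^ N * \<sigma> j" "0 < C"
proof -
  obtain C where C: "0 < C" "\<And>j. \<sigma> (Suc j) \<le> C * \<sigma> j"
    using assms by (auto simp: admissible_def)
  have "\<sigma> (j + N) \<le> C ^ N * \<sigma> j" for j N
  proof (induction N)
    case (Suc N)
    have "\<sigma> (j + Suc N) \<le> C * \<sigma> (j + N)" using C(2)[of "j + N"] by simp
    also have "\<dots> \<le> C * (C ^ N * \<sigma> j)" using Suc C(1) by (intro mult_left_mono) auto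
    finally show ?case by (simp add: mult.assoc)
  qed simp
  then show thesis using C(1) by (rule that)
qed

section \<open>Wavelets and the theorem\<close>

lemma C_class_continuous: "C_class R u \<Longrightarrow> continuous_on UNIV u"
  by (cases R) (auto intro!: differentiable_imp_continuous_within continuous_at_imp_continuous_on)

lemma wavelet_test_fun:
  assumes "wavelet_basis R \<phi> \<psi>" "i \<in> wtypes"
  shows "test_fun (\<psi> i)"
proof -
  have c: "continuous_on UNIV (\<psi> i)" and s: "compactly_supported (\<psi> i)"
    using assms by (auto simp: wavelet_basis_def intro: C_class_continuous)
  have "bounded (closure {x. \<psi> i x \<noteq> 0})"
    using s unfolding compactly_supported_def by (rule compact_imp_bounded)
  then obtain A where A: "\<forall>x\<in>closure {x. \<psi> i x \<noteq> 0}. norm x \<le> A"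
    by (auto simp: bounded_iff)
  show ?thesis
  proof (rule test_fun_continuous[OF c])
    fix x assume "\<psi> i x \<noteq> 0"
    then have "x \<in> closure {x. \<psi> i x \<noteq> 0}" using closure_subset[of "{x. \<psi> i x \<noteq> 0}"] by auto
    then show "norm x \<le> A" using A by blast
  qed
qed

lemma wavelet_vanishing:
  fixes \<psi> :: "int^'d \<Rightarrow> real^'d \<Rightarrow> complex"
  assumes w: "wavelet_basis R \<phi> \<psi>" and i: "i \<in> wtypes" and m: "m \<le> Suc R"
  shows "vanishing m (\<psi> i)"
proof (rule vanishing_of_moments)
  show u: "test_fun (\<psi> i)" by (rule wavelet_test_fun[OF w i])
  fix \<alpha> :: "'d \<Rightarrow> nat" assume "(\<Sum>n\<in>UNIV. \<alpha> n) < m"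
  then have "(\<integral>x. complex_of_real (\<Prod>n\<in>UNIV. (x $ n) ^ \<alpha> n) * \<psi> i x \<partial>lebesgue) = 0"
    using w i m by (auto simp: wavelet_basis_def)
  moreover have "test_fun (\<lambda>x. complex_of_real (\<Prod>n\<in>UNIV. (x $ n) ^ \<alpha> n) * \<psi> i x)"
    by (intro test_fun_mult_continuous u continuous_intros)
  ultimately show "(\<integral>x. complex_of_real (\<Prod>n\<in>UNIV. (x $ n) ^ \<alpha> n) * \<psi> i x \<partial>lborel) = 0"
    by (subst (asm) integral_completion) (auto dest: test_fun_measurable)
qed

theorem theorem3p4:
  fixes p q :: ennreal and x0 :: "real^'d" and \<sigma> :: "nat \<Rightarrow> real" and R :: nat
    and \<phi> :: "real^'d \<Rightarrow> complex" and \<psi> :: "int^'d \<Rightarrow> real^'d \<Rightarrow> complex"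
    and f :: "real^'d \<Rightarrow> complex"
  assumes "1 \<le> p" and "1 \<le> q"
    and "admissible \<sigma>"
    and "wavelet_basis R \<phi> \<psi>" and "real R > upper_boyd \<sigma>"
    and "f \<in> Lp_loc p" and "f \<in> T_space \<sigma> p q x0"
  shows "in_ell q (\<lambda>j. ennreal (\<sigma> j) * wleader p \<psi> f x0 j)"
proof -
  define m where "m = diff_order \<sigma>"
  define \<delta> where "\<delta> = real CARD('d) * enn2real (inverse p)"
  \<comment> \<open>degrees less than \<open>m\<close> are at most \<open>\<lfloor>upper_boyd \<sigma>\<rfloor>\<close>, hence at most \<open>R\<close>\<close>
  have m: "m \<le> Suc R"
    unfolding m_def diff_order_def using assms(5) by linarith
  have \<psi>: "test_fun (\<psi> i) \<and> vanishing m (\<psi> i)" if "i \<in> wtypes" for i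
    using wavelet_test_fun[OF assms(4) that] wavelet_vanishing[OF assms(4) that m] by blast
  have pos: "0 < \<sigma> j" for j using assms(3) by (simp add: admissible_def)
  obtain C N where C: "0 \<le> C" and b: "\<And>j. wleader p \<psi> f x0 j \<le>
     ennreal (C * 2 powr (real j * \<delta>)) * local_modulus p m x0 f (2 ^ N / 2 ^ j)"
    unfolding \<delta>_def using local_leader_bound[where \<psi> = \<psi> and m = m and ?x0.0 = x0, OF assms(1) \<psi> assms(6)] by blast
  obtain S where S: "\<And>j N. \<sigma> (j + N) \<le> S ^ N * \<sigma> j" "0 < S"
    using admissible_growth[OF assms(3)] by blast
  let ?b = "\<lambda>j. ennreal (\<sigma> j * 2 powr (real j * \<delta>)) * local_modulus p m x0 f (1 / 2 ^ j)"
  have T: "in_ell q ?b"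
    using assms(7) by (simp add: T_space_def local_modulus_def m_def \<delta>_def)
  show ?thesis
  proof (rule in_ell_shift[OF assms(2) T])
    fix j
    have r: "2 ^ N / 2 ^ (j + N) = (1 / 2 ^ j :: real)" by (simp add: power_add)
    have "ennreal (\<sigma> (j + N)) * wleader p \<psi> f x0 (j + N)
       \<le> ennreal (S ^ N * \<sigma> j) * (ennreal (C * 2 powr (real (j + N) * \<delta>)) * local_modulus p m x0 f (1 / 2 ^ j))"
      using b[of "j + N"] unfolding r by (intro mult_mono ennreal_leI S) auto
    also have "\<dots> = ennreal ((S ^ N * \<sigma> j) * (C * 2 powr (real (j + N) * \<delta>))) * local_modulus p m x0 f (1 / 2 ^ j)"
      using C S(2) pos[of j] by (subst ennreal_mult) (auto simp: mult.assoc less_imp_le)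
    also have "(S ^ N * \<sigma> j) * (C * 2 powr (real (j + N) * \<delta>))
       = (S ^ N * C * 2 powr (real N * \<delta>)) * (\<sigma> j * 2 powr (real j * \<delta>))"
      by (simp add: powr_add distrib_right)
    also have "ennreal \<dots> * local_modulus p m x0 f (1 / 2 ^ j) = ennreal (S ^ N * C * 2 powr (real N * \<delta>)) * ?b j"
      using C S(2) pos[of j] by (subst ennreal_mult) (auto simp: mult.assoc less_imp_le)
    finally show "ennreal (\<sigma> (j + N)) * wleader p \<psi> f x0 (j + N) \<le> ennreal (S ^ N * C * 2 powr (real N * \<delta>)) * ?b j" .
  next
    fix j
    show "ennreal (\<sigma> j) * wleader p \<psi> f x0 j < \<infinity>"
      using wleader_finite[OF assms(1) _ assms(6), of \<psi> x0 j] \<psi> by (simp add: ennreal_mult_less_top)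
  qed
qed

end
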